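(* Let $n\ge 3$, $1<p<\infty$, let $K\in\mathcal{K}^n_{\mathrm{o}}$, and let $c_1,c_2\ge 0$ be not both zero. For $Q\in\mathcal{K}^n_{\mathrm{o}}$ let $\Psi_pQ$ be the convex body defined by $$\Psi_p Q=c_1\cdot\mathrm{M}_p^+Q+_p c_2\cdot\mathrm{M}_p^-Q .$$ Then $$V(K)^{-n/p-1}\,V(\Psi_pK)\ge V(B)^{-n/p-1}\,V(\Psi_pB),$$ with equality if and only if $K$ is an ellipsoid centered at the origin.
   Context: $\mathcal{K}^n_{\mathrm{o}}$ is the set of convex bodies (compact convex sets) in $\mathbb{R}^n$ containing the origin in their interiors; $V$ is volume; $B$ is the Euclidean unit ball. The support function is $h(K,x)=\max\{x\cdot y: y\in K\}$ and the radial function is $\rho(K,x)=\max\{\lambda\ge0:\lambda x\in K\}$, $x\ne0$. The $L_p$ Minkowski combination $\alpha\cdot K+_p\beta\cdot L$ ($\alpha,\beta\ge0$ not both zero) is the convex body with $h(\alpha\cdot K+_p\beta\cdot L,\cdot)^p=\alpha h(K,\cdot)^p+\beta h(L,\cdot)^p$. Let $c_{n,p}=\dfrac{\Gamma\left(\frac{n+p}{2}\right)}{\pi^{(n-1)/2}\,\Gamma\left(\frac{1+p}{2}\right)}$ and $(s)_+=\max\{s,0\}$. The nonsymmetric $L_p$ moment body $\mathrm{M}_p^+K$ is the convex body with $$h(\mathrm{M}_p^+K,u)^p=c_{n,p}\int_{S^{n-1}}(u\cdot v)_+^p\,\rho(K,v)^{n+p}\,dv=c_{n,p}(n+p)\int_K(u\cdot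 x)_+^p\,dx,\qquad u\in S^{n-1},$$ where $dv$ is spherical Lebesgue measure, and $\mathrm{M}_p^-K=\mathrm{M}_p^+(-K)$. *)

theory Defs
  imports "HOL-Analysis.Analysis"
begin

definition convex_body :: "(real ^ 'n) set \<Rightarrow> bool" where
  "convex_body K \<longleftrightarrow> compact K \<and> convex K \<and> K \<noteq> {}"

definition convex_body_o :: "(real ^ 'n) set \<Rightarrow> bool" where
  "convex_body_o K \<longleftrightarrow> convex_body K \<and> 0 \<in> interior K"

abbreviation vol :: "(real ^ 'n) set \<Rightarrow> real" where
  "vol K \<equiv> measure lebesgue K"

definition support_fun :: "(real ^ 'n) set \<Rightarrow> real ^ 'n \<Rightarrow> real" where
  "support_fun K x = (SUP y\<in>K. x \<bullet> y)"

text \<open>The bodies below are given by the \<open>p\<close>-th power of their support function.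
  Nonnegativity of the support function is required explicitly, because \<open>powr\<close> is a
  total function that does not determine a negative base in the intended way.\<close>

definition Lp_comb ::
  "real \<Rightarrow> real \<Rightarrow> (real ^ 'n) set \<Rightarrow> real \<Rightarrow> (real ^ 'n) set \<Rightarrow> (real ^ 'n) set" where
  "Lp_comb p a K b L =
     (THE M. convex_body M \<and>
        (\<forall>u. 0 \<le> support_fun M u \<and>
             support_fun M u powr p = a * support_fun K u powr p + b * support_fun L u powr p))"

definition c_np :: "nat \<Rightarrow> real \<Rightarrow> real" where
  "c_np n p = Gamma ((real n + p) / 2) / (pi powr ((real n - 1) / 2) * Gamma ((1 + p) / 2))"

text \<open>The volume-integral form of the support function of the moment body; in polar
  coordinates it is
  \<open>c_np n p\<close> times the integral of \<open>(u \<bullet> v)\<^sub>+\<^sup>p \<rho>(K,v)\<^bsup>n+p\<^esup>\<close> over the unit sphere,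
  \<open>\<rho>\<close> being the radial function.\<close>

definition moment_body_plus :: "real \<Rightarrow> (real ^ 'n) set \<Rightarrow> (real ^ 'n) set" where
  "moment_body_plus p K =
     (THE M. convex_body M \<and>
        (\<forall>u \<in> sphere 0 1. 0 \<le> support_fun M u \<and>
             support_fun M u powr p =
               c_np CARD('n) p * (real CARD('n) + p) *
                 (LINT x:K|lebesgue. max 0 (u \<bullet> x) powr p)))"

definition moment_body_minus :: "real \<Rightarrow> (real ^ 'n) set \<Rightarrow> (real ^ 'n) set" where
  "moment_body_minus p K = moment_body_plus p (uminus ` K)"

definition Psi :: "real \<Rightarrow> real \<Rightarrow> real \<Rightarrow> (real ^ 'n) set \<Rightarrow> (real ^ 'n) set" where
  "Psi p c1 c2 Q = Lp_comb p c1 (moment_body_plus p Q) c2 (moment_body_minus p Q)"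

definition origin_ellipsoid :: "(real ^ 'n) set \<Rightarrow> bool" where
  "origin_ellipsoid E \<longleftrightarrow>
     (\<exists>A :: real ^ 'n ^ 'n. invertible A \<and> E = (\<lambda>x. A *v x) ` cball 0 1)"

text \<open>Uniqueness behind the definite descriptions above.\<close>

lemma convex_body_subset_if_support_le:
  assumes K: "convex_body K" and L: "convex_body L"
    and le: "\<And>u. u \<in> sphere 0 1 \<Longrightarrow> support_fun K u \<le> support_fun L u"
  shows "K \<subseteq> L"
proof
  fix x assume x: "x \<in> K"
  show "x \<in> L"
  proof (rule ccontr)
    assume "x \<notin> L"
    then obtain a b where ab: "a \<bullet> x < b" "\<forall>y\<in>L. b < a \<bullet> y"
      using separating_hyperplane_closed_point[of L x] L compact_imp_closed
      unfolding convex_body_def by blast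
    obtain y0 where y0: "y0 \<in> L" using L unfolding convex_body_def by blast
    have a0: "a \<noteq> 0" using ab y0 by fastforce
    define u where "u = - (a /\<^sub>R norm a)"
    have u: "u \<in> sphere 0 1" using a0 by (simp add: u_def)
    have scale: "u \<bullet> y = - (a \<bullet> y) / norm a" for y
      by (simp add: u_def divide_inverse)
    have "bdd_above ((\<lambda>y. u \<bullet> y) ` K)"
      using K unfolding convex_body_def
      by (intro bounded_imp_bdd_above compact_imp_bounded compact_continuous_image)
         (auto intro!: continuous_intros)
    then have "u \<bullet> x \<le> support_fun K u"
      unfolding support_fun_def using x by (rule cSUP_upper2) simp
    also have "\<dots> \<le> support_fun L u" by (rule le[OF u])
    also have "\<dots> \<le> - b / norm a"
      unfolding support_fun_def
      using y0 ab(2) a0 by (intro cSUP_least) (auto simp: scale divide_le_cancel less_imp_le)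
    finally show False using ab(1) a0 by (simp add: scale divide_le_cancel)
  qed
qed

lemma convex_body_eq_if_support_eq:
  assumes "convex_body K" "convex_body L"
    and "\<And>u. u \<in> sphere 0 1 \<Longrightarrow> support_fun K u = support_fun L u"
  shows "K = L"
  using assms by (intro subset_antisym convex_body_subset_if_support_le) auto

end

theory Submission imports Defs
begin

text \<open>The \<open>p\<close>-th power of the support function of \<open>\<Psi>\<^sub>pK\<close> at \<open>u\<close> is the integral over \<open>K\<close> of
  \<open>\<phi>(u \<bullet> x)\<close>, where \<open>\<phi>(t)\<close> is \<open>c t\<^sup>p\<close> for positive and \<open>d \<bar>t\<bar>\<^sup>p\<close> for negative \<open>t\<close>, with \<open>c\<close> and \<open>d\<close> proportional to
  \<open>c\<^sub>1\<close> and \<open>c\<^sub>2\<close>. So \<open>\<Psi>\<^sub>p\<close> is an instance of a single construction, the centroid body, whose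
  support function is the functional \<open>f \<mapsto> (\<integral>\<^sub>K \<phi>(f))\<^bsup>1/p\<^esup>\<close> restricted to linear functions. The functional
  satisfies Minkowski's inequality because \<open>\<phi>\<close> is convex and homogeneous.

  The inequality is proved by Steiner symmetrization. Let \<open>S\<close> be the symmetrization in direction \<open>v\<close>. Each
  point of a chord of \<open>SK\<close> comes from two points of the chord of \<open>K\<close> on the same line, one at that height
  above and one at that height below the midpoint, and both assignments preserve the measure.
  Minkowski's inequality then bounds the support function of the centroid body of \<open>SK\<close> at a combination
  of two functionals by the sum of the values for \<open>K\<close>. By a separation argument this says that the centroid
  body of \<open>SK\<close> is contained in the symmetral of the centroid body of \<open>K\<close>
  (\<open>centroid_body_steiner\<close>), so its volume is at most that of the centroid body of \<open>K\<close>. Some direction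
  reduces the volume of the part of the ball of the same volume that is not covered by \<open>K\<close>, by an amount
  that is bounded below as long as this part is large (\<open>steiner_decreases_deficit\<close>). Hence symmetrizations come
  arbitrarily close to the ball, and the ball minimizes the volume of the centroid body.

  Suppose that \<open>K\<close> is a minimizer. Then the containment is an equality of sets for every direction, and
  comparing contact points of both bodies gives equality in Minkowski's inequality. Since \<open>\<phi>\<close> is strictly
  convex where it is positive, the midpoints of the chords of \<open>K\<close> in direction \<open>v\<close> lie on a hyperplane
  through the origin (\<open>affine_reflection_of_equality\<close>). If one of \<open>c\<close>, \<open>d\<close> is zero, a functional
  \<open>u\<close> yields this only for chords that meet the half-space \<open>\<phi>(u \<bullet> x) > 0\<close>. The centroid body has a
  unique normal at every boundary point, so that every functional with a component along \<open>v\<close> occurs in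
  such a comparison, and together they reach all chords. A body with an affine reflection for every direction is an ellipsoid, because its
  second moments turn all of them into orthogonal reflections
  (\<open>ellipsoid_of_affine_reflections\<close>). Conversely, the ratio of volumes is invariant under linear maps
  (\<open>volume_ratio_linear_image\<close>).\<close>

section \<open>The asymmetric power\<close>

definition asym_pow :: "real \<Rightarrow> real \<Rightarrow> real \<Rightarrow> real \<Rightarrow> real" where
  "asym_pow p c d t = c * max 0 t powr p + d * max 0 (- t) powr p"

text \<open>The derivative of the asymmetric power.\<close>

definition asym_slope :: "real \<Rightarrow> real \<Rightarrow> real \<Rightarrow> real \<Rightarrow> real" where
  "asym_slope p c d t = p * (c * max 0 t powr (p - 1) - d * max 0 (- t) powr (p - 1))"

text \<open>A tangent line of \<open>t\<^sup>p\<close> lies below the graph, by the mean value theorem, because the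
  derivative increases; extending the power by zero to the left keeps this.\<close>

lemma pos_part_powr_tangent:
  fixes p x y :: real
  assumes p: "1 < p" and ne: "x \<noteq> y" and pos: "0 < x \<or> 0 < y"
  shows "max 0 x powr p + p * max 0 x powr (p - 1) * (y - x) < max 0 y powr p"
proof -
  consider "x \<le> 0" "0 < y" | "0 < x" "y \<le> 0" | "0 < x" "0 < y" using pos by linarith
  then show ?thesis
  proof cases
    case 1
    then show ?thesis using p by simp
  next
    case 2
    have "x powr p = x powr (p - 1) * x" using 2 by (simp add: powr_diff)
    then have "x powr p + p * x powr (p - 1) * (y - x)
        = x powr (p - 1) * ((1 - p) * x + p * y)"
      by (simp add: algebra_simps)
    also have "\<dots> < 0"
    proof -
      have "(1 - p) * x < 0" using p 2 by (simp add: mult_neg_pos)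
      moreover have "p * y \<le> 0" using p 2 by (simp add: mult_nonneg_nonpos)
      ultimately show ?thesis using 2 by (intro mult_pos_neg) auto
    qed
    finally show ?thesis using 2 p by simp
  next
    case 3
    have deriv: "((\<lambda>t. t powr p) has_real_derivative p * t powr (p - 1)) (at t)" if "0 < t" for t
      using that by (auto intro!: derivative_eq_intros)
    show ?thesis
    proof (cases "x < y")
      case True
      obtain z where z: "x < z" "z < y" "y powr p - x powr p = (y - x) * (p * z powr (p - 1))"
        using MVT2[OF True, of "\<lambda>t. t powr p" "\<lambda>t. p * t powr (p - 1)"] deriv 3 by fastforce
      have "x powr (p - 1) < z powr (p - 1)" using z 3 p by (intro powr_less_mono2) auto
      then have "(y - x) * (p * x powr (p - 1)) < (y - x) * (p * z powr (p - 1))"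
        using True p by simp
      then show ?thesis using z 3 by (simp add: algebra_simps)
    next
      case False
      then have yx: "y < x" using ne by simp
      obtain z where z: "y < z" "z < x" "x powr p - y powr p = (x - y) * (p * z powr (p - 1))"
        using MVT2[OF yx, of "\<lambda>t. t powr p" "\<lambda>t. p * t powr (p - 1)"] deriv 3 by fastforce
      have "z powr (p - 1) < x powr (p - 1)" using z 3 p by (intro powr_less_mono2) auto
      then have "(x - y) * (p * z powr (p - 1)) < (x - y) * (p * x powr (p - 1))"
        using yx p by simp
      then show ?thesis using z 3 by (simp add: algebra_simps)
    qed
  qed
qed

lemma pos_part_powr_tangent_le:
  fixes p x y :: real
  assumes p: "1 < p"
  shows "max 0 x powr p + p * max 0 x powr (p - 1) * (y - x) \<le> max 0 y powr p"
  using pos_part_powr_tangent[OF p, of x y] p by (cases "x = y"; cases "0 < x \<or> 0 < y") auto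

lemma asym_pow_nonneg: "0 \<le> c \<Longrightarrow> 0 \<le> d \<Longrightarrow> 0 \<le> asym_pow p c d t"
  by (simp add: asym_pow_def)

lemma asym_pow_zero [simp]: "asym_pow p c d 0 = 0"
  by (simp add: asym_pow_def)

lemma asym_pow_scale: "0 \<le> s \<Longrightarrow> asym_pow p c d (s * t) = s powr p * asym_pow p c d t"
proof -
  assume s: "0 \<le> s"
  have "max 0 (s * r) powr p = s powr p * max 0 r powr p" for r
  proof -
    have "max 0 (s * r) = s * max 0 r" using s by (simp add: max_mult_distrib_left)
    then show ?thesis using s by (simp add: powr_mult)
  qed
  from this[of t] this[of "- t"] show ?thesis by (simp add: asym_pow_def algebra_simps)
qed

lemma continuous_on_asym_pow [continuous_intros]:
  assumes "0 < p" "continuous_on S f"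
  shows "continuous_on S (\<lambda>x. asym_pow p c d (f x))"
  unfolding asym_pow_def using assms
  by (intro continuous_intros continuous_on_powr') auto

lemma borel_measurable_asym_pow [measurable]:
  assumes [measurable]: "f \<in> borel_measurable M"
  shows "(\<lambda>x. asym_pow p c d (f x)) \<in> borel_measurable M"
  unfolding asym_pow_def by measurable

lemma asym_pow_pos_iff:
  assumes "0 \<le> c" "0 \<le> d"
  shows "0 < asym_pow p c d t \<longleftrightarrow> (0 < c \<and> 0 < t) \<or> (0 < d \<and> t < 0)"
proof -
  consider "0 < t" | "t = 0" | "t < 0" by linarith
  then show ?thesis using assms by cases (auto simp: asym_pow_def zero_less_mult_iff)
qed

lemma asym_pow_tangent_le:
  assumes "1 < p" "0 \<le> c" "0 \<le> d"
  shows "asym_pow p c d x + asym_slope p c d x * (y - x) \<le> asym_pow p c d y"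
proof -
  have "c * (max 0 x powr p + p * max 0 x powr (p - 1) * (y - x)) \<le> c * max 0 y powr p"
    using pos_part_powr_tangent_le[OF assms(1), of x y] assms by (intro mult_left_mono) auto
  moreover have "d * (max 0 (-x) powr p + p * max 0 (-x) powr (p - 1) * ((-y) - (-x)))
      \<le> d * max 0 (-y) powr p"
    using pos_part_powr_tangent_le[OF assms(1), of "-x" "-y"] assms by (intro mult_left_mono) auto
  ultimately show ?thesis by (simp add: asym_pow_def asym_slope_def algebra_simps)
qed

lemma asym_pow_tangent_strict:
  assumes "1 < p" "0 \<le> c" "0 \<le> d" "x \<noteq> y"
    and pos: "0 < asym_pow p c d x \<or> 0 < asym_pow p c d y"
  shows "asym_pow p c d x + asym_slope p c d x * (y - x) < asym_pow p c d y"
proof -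
  let ?L = "max 0 x powr p + p * max 0 x powr (p - 1) * (y - x)"
  let ?R = "max 0 (-x) powr p + p * max 0 (-x) powr (p - 1) * ((-y) - (-x))"
  have L: "c * ?L \<le> c * max 0 y powr p"
    using pos_part_powr_tangent_le[OF assms(1), of x y] assms by (intro mult_left_mono) auto
  have R: "d * ?R \<le> d * max 0 (-y) powr p"
    using pos_part_powr_tangent_le[OF assms(1), of "-x" "-y"] assms by (intro mult_left_mono) auto
  have "(0 < c \<and> (0 < x \<or> 0 < y)) \<or> (0 < d \<and> (0 < - x \<or> 0 < - y))"
    using pos asym_pow_pos_iff[OF assms(2,3)] by auto
  then have "c * ?L < c * max 0 y powr p \<or> d * ?R < d * max 0 (-y) powr p"
    using pos_part_powr_tangent[OF assms(1), of x y] pos_part_powr_tangent[OF assms(1), of "-x" "-y"]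
      assms(4) by (auto intro!: mult_strict_left_mono)
  then show ?thesis using L R by (auto simp: asym_pow_def asym_slope_def algebra_simps)
qed

text \<open>Minkowski's inequality for the functional \<open>f \<mapsto> (\<integral>\<phi>(f))\<^bsup>1/p\<^esup>\<close> follows from this
  pointwise inequality by integration, where \<open>a\<close> and \<open>b\<close> are the values of the functional at
  the two summands. It is the convexity of \<open>\<phi>\<close> at the points \<open>s/a\<close> and \<open>t/b\<close> with weights
  \<open>a/(a+b)\<close> and \<open>b/(a+b)\<close>; the strict tangent inequality gives the equality case.\<close>

lemma asym_pow_add:
  assumes p: "1 < p" and cd: "0 \<le> c" "0 \<le> d" and ab: "0 < a" "0 < b"
  shows asym_pow_add_le: "asym_pow p c d (s + t)
      \<le> (a + b) powr (p - 1) * (asym_pow p c d s / a powr (p - 1) + asym_pow p c d t / b powr (p - 1))"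
    (is ?le)
    and asym_pow_add_eqD: "asym_pow p c d (s + t)
      = (a + b) powr (p - 1) * (asym_pow p c d s / a powr (p - 1) + asym_pow p c d t / b powr (p - 1))
      \<Longrightarrow> 0 < asym_pow p c d s \<or> 0 < asym_pow p c d t \<Longrightarrow> b * s = a * t"
proof -
  let ?f = "asym_pow p c d"
  define z where "z = (s + t) / (a + b)"
  define D where "D x = ?f x - ?f z - asym_slope p c d z * (x - z)" for x
  have Dge: "0 \<le> D x" for x
    using asym_pow_tangent_le[OF p cd, of z x] by (simp add: D_def)
  have scale: "?f x = r powr p * ?f (x / r)" if "0 < r" for r x
    using asym_pow_scale[of r p c d "x / r"] that by simp
  have pw: "r powr p = r * r powr (p - 1)" if "0 < r" for r :: real
    using that by (simp add: powr_diff)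
  have cancel: "a * (s / a - z) + b * (t / b - z) = 0"
  proof -
    have "(a + b) * z = s + t" using ab by (simp add: z_def)
    then show ?thesis using ab by (simp add: algebra_simps)
  qed
  have fs: "?f s / a powr (p - 1) = a * ?f (s / a)" and ft: "?f t / b powr (p - 1) = b * ?f (t / b)"
    using scale[of a s] scale[of b t] pw ab by auto
  have "a * D (s / a) + b * D (t / b)
      = a * ?f (s / a) + b * ?f (t / b) - (a + b) * ?f z
        - asym_slope p c d z * (a * (s / a - z) + b * (t / b - z))"
    unfolding D_def by algebra
  then have D: "a * D (s / a) + b * D (t / b) = ?f s / a powr (p - 1) + ?f t / b powr (p - 1) - (a + b) * ?f z"
    by (simp add: cancel fs ft)
  have fz: "?f (s + t) = (a + b) powr (p - 1) * ((a + b) * ?f z)"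
    using scale[of "a + b" "s + t"] pw[of "a + b"] ab by (simp add: z_def)
  have pos: "0 < (a + b) powr (p - 1)" using ab by simp
  have "0 \<le> a * D (s / a) + b * D (t / b)" using Dge ab by simp
  then show ?le using pos D fz by (intro order.trans[OF eq_refl[OF fz]] mult_left_mono) auto
  show "b * s = a * t" if eq: "?f (s + t)
      = (a + b) powr (p - 1) * (?f s / a powr (p - 1) + ?f t / b powr (p - 1))"
    and p0: "0 < ?f s \<or> 0 < ?f t"
  proof -
    have "a * D (s / a) + b * D (t / b) = 0" using eq pos D fz by simp
    then have D0: "D (s / a) = 0" "D (t / b) = 0"
      using Dge[of "s / a"] Dge[of "t / b"] ab
      by (smt (verit) mult_nonneg_nonneg mult_pos_pos)+
    have strict: "x = z" if "D x = 0" "0 < ?f x \<or> 0 < ?f z" for x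
      using asym_pow_tangent_strict[OF p cd, of z x] that by (auto simp: D_def)
    have "0 < ?f (s / a) \<or> 0 < ?f (t / b)"
      using p0 scale[of a s] scale[of b t] ab by (auto simp: zero_less_mult_iff)
    then have "s / a = z" "t / b = z" using strict D0 by metis+
    then show ?thesis using ab by (simp add: field_simps)
  qed
qed

section \<open>Fubini's theorem along a direction\<close>

definition slab :: "'a::euclidean_space \<Rightarrow> 'a set" where
  "slab v = {x. 0 \<le> x \<bullet> v \<and> x \<bullet> v < 1}"

lemma slab_borel [measurable]: "slab v \<in> sets borel"
  unfolding slab_def by measurable

lemma nn_integral_lborel_shift:
  fixes f :: "'a::euclidean_space \<Rightarrow> ennreal"
  assumes [measurable]: "f \<in> borel_measurable borel"
  shows "(\<integral>\<^sup>+x. f (x + a) \<partial>lborel) = (\<integral>\<^sup>+x. f x \<partial>lborel)"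
proof -
  have "(\<integral>\<^sup>+x. f x \<partial>lborel) = (\<integral>\<^sup>+x. f x \<partial>(distr lborel borel ((+) a)))"
    by (simp add: lborel_distr_plus)
  also have "\<dots> = (\<integral>\<^sup>+x. f (a + x) \<partial>lborel)" by (rule nn_integral_distr) auto
  finally show ?thesis by (simp add: add.commute)
qed

text \<open>The slab plays the role of the hyperplane orthogonal to \<open>v\<close>: it has thickness one, so
  integrating line integrals over it is the same as integrating them over the hyperplane. This avoids
  splitting the space into coordinates. A translation by \<open>tv\<close> moves \<open>t\<close> from the integrand to the
  slab, and every point lies in the translated slab for a set of \<open>t\<close> of length one.\<close>

lemma nn_integral_slab:
  fixes v :: "'a::euclidean_space"
  assumes [measurable]: "f \<in> borel_measurable borel" and v: "norm v = 1"
  shows "(\<integral>\<^sup>+x. f x \<partial>lborel)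
    = (\<integral>\<^sup>+x. indicator (slab v) x * (\<integral>\<^sup>+t. f (x + t *\<^sub>R v) \<partial>lborel) \<partial>lborel)"
proof -
  have vv: "v \<bullet> v = 1" using v by (simp add: dot_square_norm)
  have "(\<integral>\<^sup>+x. indicator (slab v) x * (\<integral>\<^sup>+t. f (x + t *\<^sub>R v) \<partial>lborel) \<partial>lborel)
      = (\<integral>\<^sup>+x. (\<integral>\<^sup>+t. indicator (slab v) x * f (x + t *\<^sub>R v) \<partial>(lborel::real measure)) \<partial>lborel)"
    by (simp add: nn_integral_cmult)
  also have "\<dots> = (\<integral>\<^sup>+t. (\<integral>\<^sup>+x. indicator (slab v) x * f (x + t *\<^sub>R v) \<partial>lborel) \<partial>(lborel::real measure))"
    by (rule lborel_pair.Fubini') measurable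
  also have "\<dots> = (\<integral>\<^sup>+t. (\<integral>\<^sup>+x. indicator (slab v) (x - t *\<^sub>R v) * f x \<partial>lborel) \<partial>(lborel::real measure))"
  proof (rule nn_integral_cong)
    fix t :: real
    show "(\<integral>\<^sup>+x. indicator (slab v) x * f (x + t *\<^sub>R v) \<partial>lborel)
        = (\<integral>\<^sup>+x. indicator (slab v) (x - t *\<^sub>R v) * f x \<partial>lborel)"
      using nn_integral_lborel_shift[of "\<lambda>x. indicator (slab v) (x - t *\<^sub>R v) * f x" "t *\<^sub>R v"] by simp
  qed
  also have "\<dots> = (\<integral>\<^sup>+x. (\<integral>\<^sup>+t. indicator (slab v) (x - t *\<^sub>R v) * f x \<partial>(lborel::real measure)) \<partial>lborel)"
    by (rule lborel_pair.Fubini') measurable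
  also have "\<dots> = (\<integral>\<^sup>+x. f x \<partial>lborel)"
  proof (rule nn_integral_cong)
    fix x :: 'a
    have "(\<integral>\<^sup>+t. indicator (slab v) (x - t *\<^sub>R v) * f x \<partial>(lborel::real measure))
        = (\<integral>\<^sup>+t. f x * indicator {x \<bullet> v - 1<..x \<bullet> v} t \<partial>lborel)"
      by (intro nn_integral_cong) (auto simp: indicator_def slab_def inner_diff_left vv)
    also have "\<dots> = f x" by (subst nn_integral_cmult) auto
    finally show "(\<integral>\<^sup>+t. indicator (slab v) (x - t *\<^sub>R v) * f x \<partial>(lborel::real measure)) = f x" .
  qed
  finally show ?thesis by simp
qed

lemma nn_integral_slab_mono:
  fixes v :: "'a::euclidean_space"
  assumes "f \<in> borel_measurable borel" "g \<in> borel_measurable borel" and v: "norm v = 1"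
    and "\<And>x. (\<integral>\<^sup>+t. f (x + t *\<^sub>R v) \<partial>lborel) \<le> (\<integral>\<^sup>+t. g (x + t *\<^sub>R v) \<partial>lborel)"
  shows "(\<integral>\<^sup>+x. f x \<partial>lborel) \<le> (\<integral>\<^sup>+x. g x \<partial>lborel)"
  unfolding nn_integral_slab[OF assms(1) v] nn_integral_slab[OF assms(2) v]
  by (intro nn_integral_mono mult_left_mono assms) auto

lemma nn_integral_real_shift_reflect:
  fixes f :: "real \<Rightarrow> ennreal"
  assumes [measurable]: "f \<in> borel_measurable borel"
  shows "(\<integral>\<^sup>+t. f (b + t) \<partial>lborel) = (\<integral>\<^sup>+t. f t \<partial>lborel)"
    and "(\<integral>\<^sup>+t. f (b - t) \<partial>lborel) = (\<integral>\<^sup>+t. f t \<partial>lborel)"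
  using nn_integral_real_affine[of f 1 b] nn_integral_real_affine[of f "-1" b] by auto

text \<open>Line integrals do not depend on the point of the line. If two functions with the same
  finite integral are ordered on every line, their line integrals therefore agree at almost every
  point of the space, not only of the slab.\<close>

lemma AE_line_integral_eq:
  fixes v :: "'a::euclidean_space"
  assumes [measurable]: "f \<in> borel_measurable borel" "g \<in> borel_measurable borel"
    and v: "norm v = 1"
    and le: "\<And>x. (\<integral>\<^sup>+t. f (x + t *\<^sub>R v) \<partial>lborel) \<le> (\<integral>\<^sup>+t. g (x + t *\<^sub>R v) \<partial>lborel)"
    and eq: "(\<integral>\<^sup>+x. f x \<partial>lborel) = (\<integral>\<^sup>+x. g x \<partial>lborel)" and fin: "(\<integral>\<^sup>+x. g x \<partial>lborel) < \<infinity>"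
  shows "AE x in lborel. (\<integral>\<^sup>+t. f (x + t *\<^sub>R v) \<partial>lborel) = (\<integral>\<^sup>+t. g (x + t *\<^sub>R v) \<partial>lborel)"
proof -
  define F where "F x = (\<integral>\<^sup>+t. f (x + t *\<^sub>R v) \<partial>(lborel::real measure))" for x
  define G where "G x = (\<integral>\<^sup>+t. g (x + t *\<^sub>R v) \<partial>(lborel::real measure))" for x
  have [measurable]: "F \<in> borel_measurable borel" "G \<in> borel_measurable borel"
    unfolding F_def G_def by measurable
  have inv: "F (x + s *\<^sub>R v) = F x" "G (x + s *\<^sub>R v) = G x" for x s
    unfolding F_def G_def
    using nn_integral_real_shift_reflect(1)[of "\<lambda>t. f (x + t *\<^sub>R v)" s]
      nn_integral_real_shift_reflect(1)[of "\<lambda>t. g (x + t *\<^sub>R v)" s]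
    by (auto simp: scaleR_add_left add.assoc)
  let ?I = "indicator (slab v) :: 'a \<Rightarrow> ennreal"
  have f: "(\<integral>\<^sup>+x. f x \<partial>lborel) = (\<integral>\<^sup>+x. ?I x * F x \<partial>lborel)"
    and g: "(\<integral>\<^sup>+x. g x \<partial>lborel) = (\<integral>\<^sup>+x. ?I x * G x \<partial>lborel)"
    unfolding F_def G_def by (intro nn_integral_slab v; measurable)+
  have FG: "F x \<le> G x" for x using le unfolding F_def G_def .
  have "(\<integral>\<^sup>+x. ?I x * G x - ?I x * F x \<partial>lborel) = (\<integral>\<^sup>+x. ?I x * G x \<partial>lborel) - (\<integral>\<^sup>+x. ?I x * F x \<partial>lborel)"
    using eq fin f g FG by (intro nn_integral_diff) (auto intro!: mult_left_mono)
  also have "\<dots> = 0" using eq fin f g by simp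
  finally have "AE x in lborel. ?I x * G x - ?I x * F x = 0"
    by (subst (asm) nn_integral_0_iff_AE) measurable
  moreover have "AE x in lborel. ?I x * G x \<noteq> \<infinity>"
    using fin g by (intro nn_integral_PInf_AE) auto
  ultimately have "AE x in lborel. ?I x * F x = ?I x * G x"
  proof eventually_elim
    case (elim x)
    then have "?I x * G x \<le> ?I x * F x" by (simp add: diff_eq_0_iff_ennreal)
    moreover have "?I x * F x \<le> ?I x * G x" using FG by (intro mult_left_mono) auto
    ultimately show ?case by simp
  qed
  then have slab: "AE x in lborel. ?I x * (\<integral>\<^sup>+t. indicator {x. F x \<noteq> G x} (x + t *\<^sub>R v) \<partial>(lborel::real measure)) = 0"
    by eventually_elim (auto simp: inv indicator_def split: if_splits)
  have "(\<integral>\<^sup>+x. indicator {x. F x \<noteq> G x} x \<partial>lborel)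
      = (\<integral>\<^sup>+x. ?I x * (\<integral>\<^sup>+t. indicator {x. F x \<noteq> G x} (x + t *\<^sub>R v) \<partial>(lborel::real measure)) \<partial>lborel)"
    by (intro nn_integral_slab v) measurable
  also have "\<dots> = (\<integral>\<^sup>+x. 0 \<partial>(lborel :: 'a measure))" by (rule nn_integral_cong_AE[OF slab])
  finally have "(\<integral>\<^sup>+x. indicator {x. F x \<noteq> G x} x \<partial>lborel) = 0" by simp
  then have "AE x in lborel. (indicator {x. F x \<noteq> G x} x :: ennreal) = 0"
    by (subst (asm) nn_integral_0_iff_AE) measurable
  then show ?thesis
    by eventually_elim (auto simp: F_def G_def indicator_def split: if_splits)
qed

section \<open>Steiner symmetrization\<close>

text \<open>The symmetral consists of the points whose height over the hyperplane orthogonal to \<open>v\<close> is half the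
  difference of the heights of two points of \<open>K\<close> on the same line. As the image of a compact convex
  set under a linear map it is compact and convex.\<close>

definition steiner :: "'a::euclidean_space \<Rightarrow> 'a set \<Rightarrow> 'a set" where
  "steiner v K = (\<lambda>(a, b). a - (((a + b) \<bullet> v) / 2) *\<^sub>R v) `
     {(a, b). a \<in> K \<and> b \<in> K \<and> a - (a \<bullet> v) *\<^sub>R v = b - (b \<bullet> v) *\<^sub>R v}"

lemma steiner_as_image:
  "steiner v K = (\<lambda>z. fst z - (((fst z + snd z) \<bullet> v) / 2) *\<^sub>R v) `
     (K \<times> K \<inter> {z. (fst z - snd z) - ((fst z - snd z) \<bullet> v) *\<^sub>R v = 0})"
proof -
  have "a - (a \<bullet> v) *\<^sub>R v = b - (b \<bullet> v) *\<^sub>R v \<longleftrightarrow> (a - b) - ((a - b) \<bullet> v) *\<^sub>R v = 0" for a b :: 'a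
    by (auto simp: algebra_simps inner_diff_left)
  then have "{(a, b). a \<in> K \<and> b \<in> K \<and> a - (a \<bullet> v) *\<^sub>R v = b - (b \<bullet> v) *\<^sub>R v}
     = K \<times> K \<inter> {z. (fst z - snd z) - ((fst z - snd z) \<bullet> v) *\<^sub>R v = 0}"
    by auto
  then show ?thesis by (simp add: steiner_def case_prod_unfold)
qed

lemma compact_steiner: "compact K \<Longrightarrow> compact (steiner v K)"
  unfolding steiner_as_image
  by (intro compact_continuous_image compact_Int_closed compact_Times closed_Collect_eq
      continuous_intros) auto

lemma convex_steiner:
  assumes "convex K" shows "convex (steiner v K)"
  unfolding steiner_as_image
proof (intro convex_linear_image convex_Int convex_Times assms)
  show "linear (\<lambda>z::'a \<times> 'a. fst z - (((fst z + snd z) \<bullet> v) / 2) *\<^sub>R v)"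
    by (intro linearI) (auto simp: algebra_simps inner_add_left add_divide_distrib)
  have "linear (\<lambda>z::'a \<times> 'a. (fst z - snd z) - ((fst z - snd z) \<bullet> v) *\<^sub>R v)"
    by (intro linearI) (auto simp: algebra_simps inner_add_left inner_diff_left)
  then show "convex {z::'a \<times> 'a. (fst z - snd z) - ((fst z - snd z) \<bullet> v) *\<^sub>R v = 0}"
    using subspace_imp_convex linear_subspace_kernel by blast
qed

lemma steiner_line:
  assumes v: "norm v = 1"
  shows "x + t *\<^sub>R v \<in> steiner v K \<longleftrightarrow>
    (\<exists>s s'. x + s *\<^sub>R v \<in> K \<and> x + s' *\<^sub>R v \<in> K \<and> x \<bullet> v + t = (s - s') / 2)"
proof
  have vv: "v \<bullet> v = 1" using v by (simp add: dot_square_norm)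
  {
    assume "x + t *\<^sub>R v \<in> steiner v K"
    then obtain a b where ab: "a \<in> K" "b \<in> K" "a - (a \<bullet> v) *\<^sub>R v = b - (b \<bullet> v) *\<^sub>R v"
      and eq: "x + t *\<^sub>R v = a - (((a + b) \<bullet> v) / 2) *\<^sub>R v"
      unfolding steiner_def by auto
    have xa: "x = a - (((a + b) \<bullet> v) / 2 + t) *\<^sub>R v" using eq by (simp add: algebra_simps)
    have xv: "x \<bullet> v = (a \<bullet> v - b \<bullet> v) / 2 - t"
      by (subst xa) (simp add: inner_diff_left inner_add_left vv field_simps)
    have a: "a = x + (((a + b) \<bullet> v) / 2 + t) *\<^sub>R v" using xa by (simp add: algebra_simps)
    have "b = a + (b \<bullet> v - a \<bullet> v) *\<^sub>R v" using ab(3) by (simp add: algebra_simps)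
    also have "\<dots> = x + (((a + b) \<bullet> v) / 2 + t + (b \<bullet> v - a \<bullet> v)) *\<^sub>R v"
      by (subst a) (simp add: algebra_simps)
    finally have b: "b = x + (((a + b) \<bullet> v) / 2 + t + (b \<bullet> v - a \<bullet> v)) *\<^sub>R v" .
    show "\<exists>s s'. x + s *\<^sub>R v \<in> K \<and> x + s' *\<^sub>R v \<in> K \<and> x \<bullet> v + t = (s - s') / 2"
      using a b ab(1,2) xv by (intro exI[of _ "((a + b) \<bullet> v) / 2 + t"]
          exI[of _ "((a + b) \<bullet> v) / 2 + t + (b \<bullet> v - a \<bullet> v)"]) auto
  next
    assume "\<exists>s s'. x + s *\<^sub>R v \<in> K \<and> x + s' *\<^sub>R v \<in> K \<and> x \<bullet> v + t = (s - s') / 2"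
    then obtain s s' where s: "x + s *\<^sub>R v \<in> K" "x + s' *\<^sub>R v \<in> K" "x \<bullet> v + t = (s - s') / 2" by blast
    have "(x + s *\<^sub>R v) - (((x + s *\<^sub>R v + (x + s' *\<^sub>R v)) \<bullet> v) / 2) *\<^sub>R v
        = x + (s - x \<bullet> v - (s + s') / 2) *\<^sub>R v"
      by (simp add: inner_add_left vv algebra_simps add_divide_distrib)
        (simp flip: scaleR_add_left)
    also have "s - x \<bullet> v - (s + s') / 2 = t" using s(3) by (simp add: field_simps)
    finally have eq: "x + t *\<^sub>R v = (x + s *\<^sub>R v) - (((x + s *\<^sub>R v + (x + s' *\<^sub>R v)) \<bullet> v) / 2) *\<^sub>R v" by simp
    have "(x + s *\<^sub>R v) - ((x + s *\<^sub>R v) \<bullet> v) *\<^sub>R v = (x + s' *\<^sub>R v) - ((x + s' *\<^sub>R v) \<bullet> v) *\<^sub>R v"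
      by (simp add: inner_add_left vv algebra_simps)
    then show "x + t *\<^sub>R v \<in> steiner v K"
      unfolding eq steiner_def using s by (intro image_eqI[where x="(x + s *\<^sub>R v, x + s' *\<^sub>R v)"]) auto
  }
qed

lemma chord_interval:
  fixes K :: "'a::euclidean_space set"
  assumes "compact K" "convex K" "v \<noteq> 0"
  obtains (empty) "{t. x + t *\<^sub>R v \<in> K} = {}"
  | (interval) lo hi where "lo \<le> hi" "{t. x + t *\<^sub>R v \<in> K} = {lo..hi}"
proof -
  let ?T = "{t. x + t *\<^sub>R v \<in> K}"
  have "closed ?T"
  proof -
    have "continuous_on UNIV (\<lambda>t. x + t *\<^sub>R v)" by (intro continuous_intros)
    then have "closed ((\<lambda>t. x + t *\<^sub>R v) -` K)"
      using compact_imp_closed[OF assms(1)] by (rule closed_vimage[rotated])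
    then show ?thesis by (simp add: vimage_def)
  qed
  moreover have "bounded ?T"
  proof -
    obtain R where R: "\<And>y. y \<in> K \<Longrightarrow> norm y \<le> R"
      using compact_imp_bounded[OF assms(1)] unfolding bounded_iff by blast
    show ?thesis unfolding bounded_iff
    proof (intro exI ballI)
      fix t assume "t \<in> ?T"
      then have "norm (x + t *\<^sub>R v) \<le> R" using R by blast
      then have "norm (t *\<^sub>R v) \<le> R + norm x" using norm_triangle_ineq4[of "x + t *\<^sub>R v" x] by simp
      then show "norm t \<le> (R + norm x) / norm v" using assms(3) by (simp add: field_simps)
    qed
  qed
  ultimately have "compact ?T" by (simp add: compact_eq_bounded_closed)
  moreover have "connected ?T"
  proof -
    have "convex ((\<lambda>t. t *\<^sub>R v) -` ((+) (- x) ` K))"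
      using assms(2) by (intro convex_linear_vimage convex_translation) (auto intro: linearI simp: scaleR_add_left)
    moreover have "(\<lambda>t. t *\<^sub>R v) -` ((+) (- x) ` K) = ?T"
      by (force simp: algebra_simps)
    ultimately show ?thesis using convex_connected by metis
  qed
  ultimately obtain a b where "?T = {a..b}" using connected_compact_interval_1[of ?T] by auto
  then show ?thesis using that by (cases "a \<le> b") auto
qed

text \<open>Symmetrization shifts a chord along its line until its midpoint lies on the hyperplane through the
  origin orthogonal to \<open>v\<close>, which the line meets at the parameter \<open>- x \<bullet> v\<close>.\<close>

lemma steiner_chord:
  assumes v: "norm v = 1" and K: "{t. x + t *\<^sub>R v \<in> K} = {lo..hi}" "lo \<le> hi"
  shows "x + t *\<^sub>R v \<in> steiner v K \<longleftrightarrow> t + x \<bullet> v + (lo + hi) / 2 \<in> {lo..hi}"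
proof -
  have "x + s *\<^sub>R v \<in> K \<longleftrightarrow> s \<in> {lo..hi}" for s unfolding K(1)[symmetric] by simp
  then have *: "x + t *\<^sub>R v \<in> steiner v K \<longleftrightarrow>
      (\<exists>s s'. s \<in> {lo..hi} \<and> s' \<in> {lo..hi} \<and> x \<bullet> v + t = (s - s') / 2)"
    by (simp add: steiner_line[OF v])
  show ?thesis
  proof
    assume "x + t *\<^sub>R v \<in> steiner v K"
    then show "t + x \<bullet> v + (lo + hi) / 2 \<in> {lo..hi}" using * by (auto simp: field_simps)
  next
    assume t: "t + x \<bullet> v + (lo + hi) / 2 \<in> {lo..hi}"
    show "x + t *\<^sub>R v \<in> steiner v K"
      unfolding * using t
      by (intro exI[of _ "t + x \<bullet> v + (lo + hi) / 2"] exI[of _ "(lo + hi) / 2 - (t + x \<bullet> v)"])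
        (auto simp: field_simps)
  qed
qed

lemma steiner_chord_empty:
  assumes "norm v = 1" "{t. x + t *\<^sub>R v \<in> K} = {}"
  shows "x + t *\<^sub>R v \<notin> steiner v K"
  using assms by (auto simp: steiner_line)

lemma steiner_cball_subset:
  assumes v: "norm v = 1" and K: "K \<subseteq> cball 0 R"
  shows "steiner v K \<subseteq> cball 0 R"
proof
  fix y assume "y \<in> steiner v K"
  then obtain a b where ab: "a \<in> K" "b \<in> K" "a - (a \<bullet> v) *\<^sub>R v = b - (b \<bullet> v) *\<^sub>R v"
    and y: "y = a - (((a + b) \<bullet> v) / 2) *\<^sub>R v"
    unfolding steiner_def by auto
  have vv: "v \<bullet> v = 1" using v by (simp add: dot_square_norm)
  define b' where "b' = b - (2 * (b \<bullet> v)) *\<^sub>R v"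
  have "norm b' = norm b"
    unfolding b'_def norm_eq by (simp add: inner_diff_left inner_diff_right vv inner_commute algebra_simps)
  moreover have "2 *\<^sub>R y = a + b'"
  proof -
    define \<alpha> \<beta> where "\<alpha> = a \<bullet> v" and "\<beta> = b \<bullet> v"
    have b: "b = a + (\<beta> - \<alpha>) *\<^sub>R v" using ab(3) by (simp add: \<alpha>_def \<beta>_def algebra_simps)
    have "b' = a - (\<alpha> + \<beta>) *\<^sub>R v"
      unfolding b'_def \<beta>_def[symmetric] by (subst b) (simp add: algebra_simps flip: scaleR_2)
    moreover have "y = a - ((\<alpha> + \<beta>) / 2) *\<^sub>R v"
      using y by (simp add: inner_add_left \<alpha>_def \<beta>_def)
    ultimately show ?thesis by (simp add: scaleR_diff_right scaleR_2)
  qed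
  then have "2 * norm y \<le> norm a + norm b'"
    using norm_triangle_ineq[of a b'] by (metis norm_scaleR abs_numeral)
  moreover have "norm a \<le> R" "norm b \<le> R" using K ab by auto
  ultimately show "y \<in> cball 0 R" by simp
qed

lemma cball_subset_steiner:
  assumes v: "norm v = 1" and K: "cball 0 r \<subseteq> K"
  shows "cball 0 r \<subseteq> steiner v K"
proof
  fix x :: 'a assume x: "x \<in> cball 0 r"
  have vv: "v \<bullet> v = 1" using v by (simp add: dot_square_norm)
  have "norm (x - (2 * (x \<bullet> v)) *\<^sub>R v) = norm x"
    unfolding norm_eq by (simp add: inner_diff_left inner_diff_right vv inner_commute algebra_simps)
  then have "x + 0 *\<^sub>R v \<in> K" "x + (- 2 * (x \<bullet> v)) *\<^sub>R v \<in> K" using x K by auto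
  then have "x + 0 *\<^sub>R v \<in> steiner v K"
    unfolding steiner_line[OF v]
    by (intro exI[of _ 0] exI[of _ "- 2 * (x \<bullet> v)"]) auto
  then show "x \<in> steiner v K" by simp
qed

text \<open>Cavalieri's principle: the chords have the same lengths.\<close>

lemma emeasure_steiner:
  assumes K: "compact K" "convex K" and v: "norm v = 1"
  shows "emeasure lborel (steiner v K) = emeasure lborel K"
proof -
  have [measurable]: "K \<in> sets borel" "steiner v K \<in> sets borel"
    using K compact_steiner by (auto intro: borel_compact)
  have v0: "v \<noteq> 0" using v by auto
  have line: "(\<integral>\<^sup>+t. indicator (steiner v K) (x + t *\<^sub>R v) \<partial>(lborel::real measure))
      = (\<integral>\<^sup>+t. indicator K (x + t *\<^sub>R v) \<partial>(lborel::real measure))" for x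
  proof -
    consider (empty) "{t. x + t *\<^sub>R v \<in> K} = {}"
      | (interval) lo hi where "lo \<le> hi" "{t. x + t *\<^sub>R v \<in> K} = {lo..hi}"
      by (rule chord_interval[OF K v0, of x])
    then show ?thesis
    proof cases
      case empty
      then have "x + t *\<^sub>R v \<notin> K" for t by auto
      then show ?thesis using steiner_chord_empty[OF v empty] by simp
    next
      case (interval lo hi)
      have "(\<integral>\<^sup>+t. indicator (steiner v K) (x + t *\<^sub>R v) \<partial>(lborel::real measure))
          = (\<integral>\<^sup>+t. indicator {lo..hi} ((x \<bullet> v + (lo + hi) / 2) + t) \<partial>(lborel::real measure))"
      proof (rule nn_integral_cong)
        fix t
        show "indicator (steiner v K) (x + t *\<^sub>R v) = (indicator {lo..hi} ((x \<bullet> v + (lo + hi) / 2) + t) :: ennreal)"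
          unfolding indicator_def steiner_chord[OF v interval(2,1)] by (simp only: add_ac)
      qed
      also have "\<dots> = (\<integral>\<^sup>+t. indicator {lo..hi} t \<partial>(lborel::real measure))"
        by (rule nn_integral_real_shift_reflect) measurable
      also have "\<dots> = (\<integral>\<^sup>+t. indicator K (x + t *\<^sub>R v) \<partial>(lborel::real measure))"
      proof (rule nn_integral_cong)
        fix t
        have "t \<in> {lo..hi} \<longleftrightarrow> x + t *\<^sub>R v \<in> K" unfolding interval(2)[symmetric] by simp
        then show "indicator {lo..hi} t = (indicator K (x + t *\<^sub>R v) :: ennreal)"
          by (simp only: indicator_def)
      qed
      finally show ?thesis .
    qed
  qed
  have "(\<integral>\<^sup>+x. indicator (steiner v K) x \<partial>lborel) = (\<integral>\<^sup>+x. indicator K x \<partial>lborel)"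
    by (rule antisym; rule nn_integral_slab_mono[OF _ _ v]) (simp_all add: line)
  then show ?thesis by simp
qed

section \<open>The body with support function the asymmetric norm\<close>

definition solid :: "'a::euclidean_space set \<Rightarrow> bool" where
  "solid K \<longleftrightarrow> compact K \<and> convex K \<and> 0 \<in> interior K"

lemma solidD:
  assumes "solid K"
  shows "compact K" "convex K" "0 \<in> interior K" "K \<in> sets borel" "0 \<in> K" "bounded K" "closed K"
  using assms interior_subset unfolding solid_def
  by (auto intro: borel_compact compact_imp_bounded compact_imp_closed)

lemma solid_contains_cball:
  assumes "solid K" obtains e where "0 < e" "cball 0 e \<subseteq> K"
  using assms unfolding solid_def mem_interior_cball by blast

lemma measure_solid_pos:
  assumes "solid (K :: 'a::euclidean_space set)" shows "0 < measure lborel K"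
proof -
  obtain e where e: "0 < e" "cball 0 e \<subseteq> K" by (rule solid_contains_cball[OF assms])
  have "measure lborel (cball (0::'a) e) \<le> measure lborel K"
    using e(2) solidD[OF assms] by (intro measure_mono_fmeasurable fmeasurableI emeasure_compact_finite) auto
  then show ?thesis using content_cball_pos[OF e(1), of "0::'a"] by linarith
qed

lemma solidI_cball:
  assumes "compact K" "convex K" "0 < e" "cball 0 e \<subseteq> K" shows "solid K"
  using assms unfolding solid_def mem_interior_cball by blast

lemma solid_steiner:
  assumes "solid K" "norm v = 1" shows "solid (steiner v K)"
proof -
  obtain e where "0 < e" "cball 0 e \<subseteq> K" using solid_contains_cball[OF assms(1)] .
  then show ?thesis
    using assms by (intro solidI_cball[of _ e] compact_steiner convex_steiner cball_subset_steiner)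
      (auto dest: solidD)
qed

lemma AE_meets_open:
  fixes W :: "'a::euclidean_space set"
  assumes "AE x in lborel. P x" "open W" "W \<noteq> {}"
  obtains x where "x \<in> W" "P x"
proof -
  obtain N where N: "{x \<in> space lborel. \<not> P x} \<subseteq> N" "emeasure lborel N = 0" "N \<in> sets lborel"
    using AE_E[OF assms(1)] by blast
  have "negligible N"
    unfolding negligible_iff_null_sets using N null_sets_completionI[of N lborel] by (auto simp: null_sets_def)
  then have "\<not> W \<subseteq> N"
    using assms(2,3) open_not_negligible negligible_subset by blast
  then show ?thesis using that N by auto
qed

lemma inner_zero_on_open:
  fixes z :: "'a::euclidean_space"
  assumes "AE x in lborel. x \<in> W \<longrightarrow> z \<bullet> x = 0" "open W" "W \<noteq> {}"
  shows "z = 0"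
proof -
  have zero: "z \<bullet> x = 0" if "x \<in> W" for x
  proof (rule ccontr)
    assume "z \<bullet> x \<noteq> 0"
    then have ne: "W \<inter> {x. z \<bullet> x \<noteq> 0} \<noteq> {}" using that by blast
    have "open (W \<inter> {x. z \<bullet> x \<noteq> 0})"
      using assms(2) by (intro open_Int open_Collect_neq continuous_intros)
    from AE_meets_open[OF assms(1) this ne] show False by blast
  qed
  obtain x where x: "x \<in> W" using assms(3) by blast
  then obtain e where e: "0 < e" "cball x e \<subseteq> W" using assms(2) open_contains_cball by blast
  show "z = 0"
  proof (rule ccontr)
    assume "z \<noteq> 0"
    moreover from this have "x + (e / norm z) *\<^sub>R z \<in> W" using e by (intro subsetD[OF e(2)]) (auto simp: dist_norm)
    ultimately show False using zero[OF x] zero[of "x + (e / norm z) *\<^sub>R z"] e by (simp add: inner_add_right)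
  qed
qed

locale asym_exponent =
  fixes p c d :: real
  assumes p1: "1 < p" and c0: "0 \<le> c" and d0: "0 \<le> d" and cd: "0 < c + d"
begin

abbreviation \<phi> :: "real \<Rightarrow> real" where "\<phi> \<equiv> asym_pow p c d"

definition moment :: "'a::euclidean_space set \<Rightarrow> 'a \<Rightarrow> real" where
  "moment K u = (LINT x:K|lborel. \<phi> (u \<bullet> x))"

definition gauge_norm :: "'a::euclidean_space set \<Rightarrow> 'a \<Rightarrow> real" where
  "gauge_norm K u = moment K u powr (1 / p)"

text \<open>The largest set whose support function is at most \<open>gauge_norm K\<close>. With \<open>c\<close> and \<open>d\<close> proportional
  to \<open>c\<^sub>1\<close> and \<open>c\<^sub>2\<close> it is the body \<open>\<Psi>\<^sub>pK\<close>.\<close>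

definition centroid_body :: "'a::euclidean_space set \<Rightarrow> 'a set" where
  "centroid_body K = {y. \<forall>u. u \<bullet> y \<le> gauge_norm K u}"

lemma phi_nonneg [simp]: "0 \<le> \<phi> t"
  using c0 d0 by (rule asym_pow_nonneg)

lemma phi_scale: "0 \<le> s \<Longrightarrow> \<phi> (s * t) = s powr p * \<phi> t"
  by (rule asym_pow_scale)

lemma continuous_on_phi_inner: "continuous_on S (\<lambda>x. \<phi> (u \<bullet> x))"
  using p1 by (intro continuous_intros) auto

lemma phi_inner_integrable: "compact K \<Longrightarrow> set_integrable lborel K (\<lambda>x. \<phi> (u \<bullet> x))"
  unfolding set_integrable_def by (intro borel_integrable_compact continuous_on_phi_inner)

lemma moment_nonneg: "0 \<le> moment K u"
  unfolding moment_def set_lebesgue_integral_def by (intro integral_nonneg_AE) auto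

lemma moment_nn_integral:
  assumes "compact K"
  shows "ennreal (moment K u) = (\<integral>\<^sup>+x. indicator K x * ennreal (\<phi> (u \<bullet> x)) \<partial>lborel)"
proof -
  have "(\<integral>\<^sup>+x. ennreal (indicator K x *\<^sub>R \<phi> (u \<bullet> x)) \<partial>lborel) = ennreal (moment K u)"
    unfolding moment_def set_lebesgue_integral_def
    using phi_inner_integrable[OF assms, of u] unfolding set_integrable_def
    by (intro nn_integral_eq_integral) auto
  moreover have "(\<integral>\<^sup>+x. ennreal (indicator K x *\<^sub>R \<phi> (u \<bullet> x)) \<partial>lborel)
      = (\<integral>\<^sup>+x. indicator K x * ennreal (\<phi> (u \<bullet> x)) \<partial>lborel)"
    by (intro nn_integral_cong) (auto simp: indicator_def)
  ultimately show ?thesis by simp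
qed

lemma moment_mono:
  assumes "compact K" "compact L" "K \<subseteq> L" shows "moment K u \<le> moment L u"
proof -
  have "ennreal (moment K u) \<le> ennreal (moment L u)"
    unfolding moment_nn_integral[OF assms(1)] moment_nn_integral[OF assms(2)]
    using assms(3) by (intro nn_integral_mono) (auto simp: indicator_def)
  then show ?thesis by (simp only: ennreal_le_iff[OF moment_nonneg])
qed

text \<open>If \<open>c\<close> or \<open>d\<close> vanishes, only one side of the hyperplane orthogonal to \<open>u\<close> contributes. A small
  ball on a side that contributes gives a uniform lower bound.\<close>

lemma moment_lower_bound:
  assumes "0 < e"
  obtains k where "0 < k" "\<And>K u. compact K \<Longrightarrow> cball (0::'a::euclidean_space) e \<subseteq> K \<Longrightarrow>
    k * norm u powr p \<le> moment K u"
proof -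
  define s :: real where "s = (if 0 < c then 1 else - 1)"
  define m where "m = (if 0 < c then c else d)"
  have m: "0 < m" using cd c0 by (auto simp: m_def)
  have phi_s: "m * t powr p \<le> \<phi> (s * t)" if "0 \<le> t" for t
    using that c0 d0 p1 by (auto simp: s_def m_def asym_pow_def)
  define k where "k = m * (e / 4) powr p * measure lborel (cball (0::'a) (e / 4))"
  have k: "0 < k"
    using m assms content_cball_pos[of "e / 4" "0::'a"] by (simp add: k_def)
  moreover have "k * norm u powr p \<le> moment K u" if K: "compact K" "cball (0::'a) e \<subseteq> K" for K u
  proof (cases "u = 0")
    case True then show ?thesis using p1 by (simp add: moment_nonneg)
  next
    case False
    define z where "z = (s * (e / 2) / norm u) *\<^sub>R u"
    have s: "\<bar>s\<bar> = 1" "s * s = 1" by (auto simp: s_def)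
    have nz: "norm z = e / 2" using False assms s by (simp add: z_def abs_mult)
    let ?B = "cball z (e / 4)"
    have BK: "?B \<subseteq> K"
    proof
      fix x assume "x \<in> ?B"
      then have "norm x \<le> e" using nz norm_triangle_ineq4[of x z] assms
        norm_triangle_sub[of x z] by (auto simp: dist_norm norm_minus_commute)
      then show "x \<in> K" using K by auto
    qed
    have low: "m * (e / 4) powr p * norm u powr p \<le> \<phi> (u \<bullet> x)" if "x \<in> ?B" for x
    proof -
      have "s * (u \<bullet> z) = norm u * (e / 2)"
        using False s by (simp add: z_def dot_square_norm power2_eq_square field_simps)
      moreover have "\<bar>s * (u \<bullet> (x - z))\<bar> \<le> norm u * (e / 4)"
      proof -
        have "\<bar>s * (u \<bullet> (x - z))\<bar> = \<bar>u \<bullet> (x - z)\<bar>" using s by (simp add: abs_mult)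
        also have "\<dots> \<le> norm u * norm (x - z)" by (rule Cauchy_Schwarz_ineq2)
        also have "\<dots> \<le> norm u * (e / 4)"
          using that by (intro mult_left_mono) (auto simp: dist_norm norm_minus_commute)
        finally show ?thesis .
      qed
      ultimately have ge: "norm u * (e / 4) \<le> s * (u \<bullet> x)"
        unfolding inner_diff_right right_diff_distrib by linarith
      have "m * (e / 4) powr p * norm u powr p = m * (norm u * (e / 4)) powr p"
        using assms powr_mult[of "norm u" "e / 4" p] by simp
      also have "\<dots> \<le> m * (s * (u \<bullet> x)) powr p"
        using ge assms m p1 by (intro mult_left_mono powr_mono2) auto
      also have "\<dots> \<le> \<phi> (s * (s * (u \<bullet> x)))"
        using ge assms by (intro phi_s) (meson divide_nonneg_nonneg less_imp_le mult_nonneg_nonneg norm_ge_zero order.trans zero_le_numeral)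
      finally show ?thesis using s by (simp flip: mult.assoc)
    qed
    have "k * norm u powr p = (LINT x:?B|lborel. m * (e / 4) powr p * norm u powr p)"
      using content_ball_conv_unit_ball[of "e/4" z] content_ball_conv_unit_ball[of "e/4" "0::'a"] assms
      by (simp add: k_def set_lebesgue_integral_def content_cball_conv_ball)
    also have "\<dots> \<le> moment ?B u"
      unfolding moment_def
    proof (rule set_integral_mono)
      show "set_integrable lborel ?B (\<lambda>x. m * (e / 4) powr p * norm u powr p)"
        unfolding set_integrable_def by (intro borel_integrable_compact) auto
    qed (use low in \<open>auto intro!: phi_inner_integrable\<close>)
    also have "\<dots> \<le> moment K u" using K BK by (intro moment_mono) auto
    finally show ?thesis .
  qed
  ultimately show ?thesis using that by blast
qed

lemma gauge_nonneg [simp]: "0 \<le> gauge_norm K u"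
  by (simp add: gauge_norm_def)

lemma gauge_powr: "gauge_norm K u powr p = moment K u"
  using p1 moment_nonneg[of K u] by (simp add: gauge_norm_def powr_powr)

lemma gauge_scale: "0 \<le> s \<Longrightarrow> gauge_norm K (s *\<^sub>R u) = s * gauge_norm K u"
proof -
  assume s: "0 \<le> s"
  have "moment K (s *\<^sub>R u) = s powr p * moment K u"
    unfolding moment_def using s by (simp add: phi_scale)
  then show ?thesis using s p1 moment_nonneg[of K u] by (simp add: gauge_norm_def powr_mult powr_powr)
qed

lemma gauge_zero [simp]: "gauge_norm K 0 = 0"
  using gauge_scale[of 0 K 0] by simp

lemma gauge_lower_bound:
  assumes "solid (K :: 'a::euclidean_space set)"
  obtains k where "0 < k" "\<And>u. k * norm u \<le> gauge_norm K u"
proof -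
  obtain e where e: "0 < e" "cball 0 e \<subseteq> K" using solid_contains_cball[OF assms] .
  obtain k where k: "0 < k" "\<And>K u. compact K \<Longrightarrow> cball (0::'a) e \<subseteq> K \<Longrightarrow> k * norm u powr p \<le> moment K u"
    using moment_lower_bound[OF e(1), where 'a='a] by metis
  have "k powr (1/p) * norm u \<le> gauge_norm K u" for u
  proof -
    have "k powr (1/p) * norm u = (k * norm u powr p) powr (1/p)"
      using k(1) p1 by (simp add: powr_mult powr_powr)
    also have "\<dots> \<le> gauge_norm K u"
      unfolding gauge_norm_def using k e solidD[OF assms] p1 by (intro powr_mono2) auto
    finally show ?thesis .
  qed
  then show ?thesis using that[of "k powr (1/p)"] k(1) by auto
qed

lemma gauge_pos: "solid K \<Longrightarrow> u \<noteq> 0 \<Longrightarrow> 0 < gauge_norm K u"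
proof -
  assume K: "solid K" and u: "u \<noteq> 0"
  obtain k where "0 < k" "\<And>u. k * norm u \<le> gauge_norm K u" using gauge_lower_bound[OF K] by blast
  then show ?thesis using u by (smt (verit) mult_pos_pos zero_less_norm_iff)
qed

text \<open>With \<open>a\<close> and \<open>b\<close> the two norms, the right-hand side of the pointwise inequality
  integrates to exactly \<open>(a+b)\<^sup>p\<close>.\<close>

lemma weighted_powers_sum:
  assumes "0 < a" "0 < b"
  shows "(a + b) powr (p - 1) * (a powr p / a powr (p - 1) + b powr p / b powr (p - 1)) = (a + b) powr p"
proof -
  have pw: "r powr p = r * r powr (p - 1)" if "0 < r" for r :: real
    using that by (simp add: powr_diff)
  show ?thesis using assms pw[of a] pw[of b] pw[of "a+b"] by simp
qed

lemma gauge_le_add: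
  assumes "0 < a" "0 < b" "moment L w
    \<le> (a + b) powr (p - 1) * (a powr p / a powr (p - 1) + b powr p / b powr (p - 1))"
  shows "gauge_norm L w \<le> a + b"
proof -
  have "gauge_norm L w \<le> ((a + b) powr p) powr (1 / p)"
    unfolding gauge_norm_def using assms p1 weighted_powers_sum[of a b] moment_nonneg[of L w]
    by (intro powr_mono2) auto
  also have "\<dots> = a + b" using assms p1 by (simp add: powr_powr)
  finally show ?thesis .
qed

text \<open>The difference of the two sides of the pointwise inequality \<open>asym_pow_add_le\<close> for the weights that
  occur in Minkowski's inequality.\<close>

definition add_defect :: "'a::euclidean_space set \<Rightarrow> 'a \<Rightarrow> 'a \<Rightarrow> 'a \<Rightarrow> real" where
  "add_defect K u w x = (let a = gauge_norm K u; b = gauge_norm K w in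
     (a + b) powr (p - 1) * (\<phi> (u \<bullet> x) / a powr (p - 1) + \<phi> (w \<bullet> x) / b powr (p - 1))
     - \<phi> (u \<bullet> x + w \<bullet> x))"

lemma integral_add_defect:
  assumes K: "solid K" and uw: "u \<noteq> 0" "w \<noteq> 0"
  shows "set_integrable lborel K (add_defect K u w)"
    "(LINT x:K|lborel. add_defect K u w x)
      = (gauge_norm K u + gauge_norm K w) powr p - moment K (u + w)"
proof -
  define a b where "a = gauge_norm K u" and "b = gauge_norm K w"
  have ab: "0 < a" "0 < b" using gauge_pos[OF K] uw by (auto simp: a_def b_def)
  define r where "r = (a + b) powr (p - 1)"
  have eq: "add_defect K u w = (\<lambda>x. r * (\<phi> (u \<bullet> x) / a powr (p - 1) + \<phi> (w \<bullet> x) / b powr (p - 1))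
      - \<phi> ((u + w) \<bullet> x))"
    by (rule ext) (simp add: add_defect_def a_def b_def r_def Let_def inner_add_left)
  note int = phi_inner_integrable[OF solidD(1)[OF K]]
  have int1: "set_integrable lborel K (\<lambda>x. \<phi> (u \<bullet> x) / a powr (p - 1))"
    "set_integrable lborel K (\<lambda>x. \<phi> (w \<bullet> x) / b powr (p - 1))"
    using int[of u] int[of w] ab by (auto intro: set_integrable_divide)
  have int2: "set_integrable lborel K (\<lambda>x. r * (\<phi> (u \<bullet> x) / a powr (p - 1) + \<phi> (w \<bullet> x) / b powr (p - 1)))"
    using int1 by (intro set_integrable_mult_right set_integral_add(1))
  show "set_integrable lborel K (add_defect K u w)"
    unfolding eq using int2 int by (intro set_integral_diff(1))
  have "(LINT x:K|lborel. add_defect K u w x)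
     = r * (moment K u / a powr (p - 1) + moment K w / b powr (p - 1)) - moment K (u + w)"
    unfolding eq moment_def
    by (subst set_integral_diff(2)[OF int2 int], subst set_integral_mult_right,
        subst set_integral_add(2)[OF int1]) simp
  also have "\<dots> = (a + b) powr p - moment K (u + w)"
    using weighted_powers_sum[OF ab] gauge_powr[of K u] gauge_powr[of K w]
    by (simp add: r_def a_def b_def)
  finally show "(LINT x:K|lborel. add_defect K u w x)
      = (gauge_norm K u + gauge_norm K w) powr p - moment K (u + w)" by (simp add: a_def b_def)
qed

lemma add_defect_nonneg: "solid K \<Longrightarrow> u \<noteq> 0 \<Longrightarrow> w \<noteq> 0 \<Longrightarrow> 0 \<le> add_defect K u w x"
  using asym_pow_add_le[OF p1 c0 d0 gauge_pos gauge_pos, of K u K w] by (simp add: add_defect_def Let_def)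

lemma gauge_add:
  assumes K: "solid K" shows "gauge_norm K (u + w) \<le> gauge_norm K u + gauge_norm K w"
proof (cases "u = 0 \<or> w = 0")
  case True then show ?thesis by auto
next
  case False
  have "0 \<le> (LINT x:K|lborel. add_defect K u w x)"
    using add_defect_nonneg[OF K] False
    unfolding set_lebesgue_integral_def by (intro integral_nonneg_AE) auto
  then show ?thesis
    using integral_add_defect[OF K] weighted_powers_sum[OF gauge_pos gauge_pos, OF K _ K] False
    by (intro gauge_le_add gauge_pos K) auto
qed

text \<open>Equality forces the two linear forms to be proportional where they contribute to the
  norm, which is an open set; hence they are proportional. Geometrically, a boundary point of the
  body has only one normal direction.\<close>

lemma gauge_add_eqD:
  assumes K: "solid K" and uw: "u \<noteq> 0" "w \<noteq> 0"
    and eq: "gauge_norm K (u + w) = gauge_norm K u + gauge_norm K w"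
  shows "gauge_norm K w *\<^sub>R u = gauge_norm K u *\<^sub>R w"
proof -
  define z where "z = gauge_norm K w *\<^sub>R u - gauge_norm K u *\<^sub>R w"
  define W where "W = {x. 0 < \<phi> (u \<bullet> x)} \<inter> interior K"
  note ab = gauge_pos[OF K uw(1)] gauge_pos[OF K uw(2)]
  have "(LINT x:K|lborel. add_defect K u w x) = 0"
    using integral_add_defect(2)[OF K uw] eq gauge_powr[of K "u + w"] by simp
  then have "AE x in lborel. indicator K x *\<^sub>R add_defect K u w x = 0"
    using integral_add_defect(1)[OF K uw] add_defect_nonneg[OF K uw]
    unfolding set_lebesgue_integral_def set_integrable_def
    by (subst (asm) integral_nonneg_eq_0_iff_AE) auto
  then have "AE x in lborel. x \<in> W \<longrightarrow> z \<bullet> x = 0"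
  proof eventually_elim
    case (elim x)
    show ?case
    proof
      assume x: "x \<in> W"
      then have "add_defect K u w x = 0" using elim interior_subset[of K] by (auto simp: W_def)
      then have "gauge_norm K w * (u \<bullet> x) = gauge_norm K u * (w \<bullet> x)"
        using x by (intro asym_pow_add_eqD[OF p1 c0 d0 ab]) (auto simp: add_defect_def Let_def W_def)
      then show "z \<bullet> x = 0" by (simp add: z_def inner_diff_left)
    qed
  qed
  moreover have "open W"
  proof -
    have "open {x. 0 < \<phi> (u \<bullet> x)}"
      by (intro open_Collect_less continuous_on_phi_inner) auto
    then show ?thesis by (auto simp: W_def)
  qed
  moreover have "W \<noteq> {}"
  proof -
    obtain e where e: "0 < e" "cball 0 e \<subseteq> interior K"
      using solidD(3)[OF K] open_contains_cball[of "interior K"] by auto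
    define x where "x = ((if 0 < c then e else - e) / norm u) *\<^sub>R u"
    have "norm x \<le> e" using e uw by (auto simp: x_def)
    moreover have "0 < \<phi> (u \<bullet> x)"
      unfolding asym_pow_pos_iff[OF c0 d0] using cd c0 e uw
      by (auto simp: x_def dot_square_norm zero_less_mult_iff divide_simps)
    ultimately show ?thesis using e by (auto simp: W_def)
  qed
  ultimately have "z = 0" by (rule inner_zero_on_open)
  then show ?thesis by (simp add: z_def)
qed


end

section \<open>Sublinear functions and their bodies\<close>

text \<open>The epigraph of a sublinear function is a closed convex cone. A hyperplane that separates
  it from a point slightly below the graph has the normal \<open>(- y, 1)\<close> up to a positive factor, and \<open>y\<close> is
  then a point of the body that almost attains the value. Compactness gives a point that attains it.\<close>

lemma sublinear_support:
  fixes h :: "'a::euclidean_space \<Rightarrow> real"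
  assumes add: "\<And>u w. h (u + w) \<le> h u + h w"
    and scale: "\<And>s u. 0 \<le> s \<Longrightarrow> h (s *\<^sub>R u) = s * h u"
    and nonneg: "\<And>u. 0 \<le> h u"
  shows sublinear_body_compact: "compact {y. \<forall>u. u \<bullet> y \<le> h u}"
    and sublinear_body_convex: "convex {y. \<forall>u. u \<bullet> y \<le> h u}"
    and sublinear_attained: "\<exists>y. (\<forall>u. u \<bullet> y \<le> h u) \<and> u0 \<bullet> y = h u0"
proof -
  let ?Y = "{y. \<forall>u. u \<bullet> y \<le> h u}"
  have Y: "?Y = (\<Inter>u. {y. u \<bullet> y \<le> h u})" by auto
  show "convex ?Y" unfolding Y by (intro convex_INT convex_halfspace_le)
  have closed: "closed ?Y" unfolding Y by (intro closed_INT ballI closed_halfspace_le)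
  have "bounded ?Y"
    unfolding bounded_iff
  proof (intro exI ballI)
    fix y assume y: "y \<in> ?Y"
    have "\<bar>y \<bullet> i\<bar> \<le> h i + h (- i)" for i
      using y[simplified, rule_format, of i] y[simplified, rule_format, of "- i"] nonneg[of i]
        nonneg[of "- i"] by (simp add: inner_commute)
    then have "(\<Sum>i\<in>Basis. \<bar>y \<bullet> i\<bar>) \<le> (\<Sum>i\<in>Basis. h i + h (- i))" by (intro sum_mono)
    then show "norm y \<le> (\<Sum>i\<in>Basis. h i + h (- i))" using norm_le_l1[of y] by linarith
  qed
  with closed show compact: "compact ?Y" by (simp add: compact_eq_bounded_closed)
  have h0: "h 0 = 0" using scale[of 0 0] by simp
  have "convex_on UNIV h"
  proof (rule convex_onI)
    fix t :: real and x y assume "0 < t" "t < 1"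
    then show "h ((1 - t) *\<^sub>R x + t *\<^sub>R y) \<le> (1 - t) * h x + t * h y"
      using add[of "(1 - t) *\<^sub>R x" "t *\<^sub>R y"] scale[of "1 - t" x] scale[of t y] by simp
  qed simp
  then have cont: "continuous_on UNIV h" by (rule convex_on_continuous[OF open_UNIV])
  define E where "E = {z :: 'a \<times> real. h (fst z) \<le> snd z}"
  have "closed E"
    unfolding E_def by (intro closed_Collect_le continuous_intros continuous_on_compose2[OF cont]) auto
  have "convex E"
  proof (rule convexI)
    fix x y :: "'a \<times> real" and a b :: real
    assume xy: "x \<in> E" "y \<in> E" "0 \<le> a" "0 \<le> b"
    have "h (a *\<^sub>R fst x + b *\<^sub>R fst y) \<le> a * h (fst x) + b * h (fst y)"
      using add[of "a *\<^sub>R fst x" "b *\<^sub>R fst y"] scale xy by simp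
    also have "\<dots> \<le> a * snd x + b * snd y"
      using xy by (intro add_mono mult_left_mono) (auto simp: E_def)
    finally show "a *\<^sub>R x + b *\<^sub>R y \<in> E" by (simp add: E_def)
  qed
  have approx: "\<exists>y\<in>?Y. h u0 - e \<le> u0 \<bullet> y" if e: "0 < e" for e
  proof -
    have "(u0, h u0 - e) \<notin> E" using e by (simp add: E_def)
    then obtain n b where n: "n \<bullet> (u0, h u0 - e) < b" "\<And>z. z \<in> E \<Longrightarrow> b < n \<bullet> z"
      using separating_hyperplane_closed_point[OF \<open>convex E\<close> \<open>closed E\<close>] by blast
    obtain a r where ar: "n = (a, r)" by (cases n)
    have b: "b < 0" using n(2)[of "(0, 0)"] by (simp add: E_def h0 ar)
    \<comment> \<open>A linear function that is bounded below on a cone is nonnegative on it.\<close>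
    have cone: "0 \<le> a \<bullet> u + r * s" if "h u \<le> s" for u s
    proof (rule ccontr)
      assume neg: "\<not> 0 \<le> a \<bullet> u + r * s"
      define k where "k = b / (a \<bullet> u + r * s)"
      have k: "0 \<le> k" using neg b by (simp add: k_def divide_nonpos_neg)
      have "h (k *\<^sub>R u) \<le> k * s" using scale[OF k, of u] that k by (simp add: mult_left_mono)
      then have "b < k * (a \<bullet> u + r * s)"
        using n(2)[of "(k *\<^sub>R u, k * s)"] by (simp add: E_def ar algebra_simps)
      then show False using neg by (simp add: k_def)
    qed
    have below: "a \<bullet> u0 + r * (h u0 - e) < 0" using n(1) b by (simp add: ar)
    have r: "0 < r"
    proof -
      have "0 \<le> a \<bullet> u0 + r * h u0" by (rule cone) simp
      then have "0 < r * e" using below by (simp add: algebra_simps)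
      then show ?thesis using e by (simp add: zero_less_mult_iff)
    qed
    define y where "y = - (1 / r) *\<^sub>R a"
    have "u \<bullet> y \<le> h u" for u
      using cone[of u "h u"] r by (simp add: y_def inner_commute field_simps)
    moreover have "h u0 - e \<le> u0 \<bullet> y"
      using below r by (simp add: y_def inner_commute field_simps)
    ultimately show ?thesis by blast
  qed
  have "?Y \<noteq> {}" using approx[of 1] by auto
  then obtain y where y: "y \<in> ?Y" "\<And>z. z \<in> ?Y \<Longrightarrow> u0 \<bullet> z \<le> u0 \<bullet> y"
    using continuous_attains_sup[OF compact, of "\<lambda>y. u0 \<bullet> y"] continuous_on_inner[OF continuous_on_const continuous_on_id]
    by blast
  have "h u0 \<le> u0 \<bullet> y"
  proof (rule field_le_epsilon)
    fix e :: real assume "0 < e"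
    then obtain z where "z \<in> ?Y" "h u0 - e \<le> u0 \<bullet> z" using approx by blast
    then show "h u0 \<le> u0 \<bullet> y + e" using y(2) by fastforce
  qed
  then show "\<exists>y. (\<forall>u. u \<bullet> y \<le> h u) \<and> u0 \<bullet> y = h u0" using y(1) by (auto intro: antisym)
qed

context asym_exponent
begin

lemma centroid_body_le: "y \<in> centroid_body K \<Longrightarrow> u \<bullet> y \<le> gauge_norm K u"
  by (simp add: centroid_body_def)

lemma centroid_body_attained:
  assumes "solid K" obtains y where "y \<in> centroid_body K" "u \<bullet> y = gauge_norm K u"
  using sublinear_attained[OF gauge_add[OF assms] gauge_scale gauge_nonneg, of u]
  unfolding centroid_body_def by blast

lemma solid_centroid_body:
  assumes "solid K" shows "solid (centroid_body K)"
proof -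
  obtain k where k: "0 < k" "\<And>u. k * norm u \<le> gauge_norm K u" using gauge_lower_bound[OF assms] by blast
  show ?thesis
  proof (rule solidI_cball[OF _ _ k(1)])
    show "compact (centroid_body K)" "convex (centroid_body K)"
      unfolding centroid_body_def
      by (intro sublinear_body_compact sublinear_body_convex gauge_add[OF assms] gauge_scale gauge_nonneg; assumption)+
    show "cball 0 k \<subseteq> centroid_body K"
    proof (clarsimp simp: centroid_body_def)
      fix y u :: 'a assume y: "norm y \<le> k"
      have "u \<bullet> y \<le> norm u * norm y" by (rule norm_cauchy_schwarz)
      also have "\<dots> \<le> k * norm u" using y mult_left_mono[of "norm y" k "norm u"] by (simp add: mult.commute)
      finally show "u \<bullet> y \<le> gauge_norm K u" using k(2)[of u] by linarith
    qed
  qed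
qed

section \<open>The centroid body of the symmetral\<close>

text \<open>Let \<open>m\<close> be the midpoint of a chord of \<open>K\<close>. A point at height \<open>s\<close> in the chord of the symmetral
  comes from the points at heights \<open>m + s\<close> and \<open>m - s\<close> in \<open>K\<close>; both maps preserve length. The
  functional \<open>N\<^sub>1 + N\<^sub>2 + 2(N\<^sub>1\<cdot>v)v\<close> at the former is the sum of the functionals \<open>N\<^sub>1\<close> and \<open>N\<^sub>2\<close> at
  the latter, because \<open>N\<^sub>1\<close> and \<open>N\<^sub>2\<close> have opposite components along \<open>v\<close>. The pointwise inequality is
  integrated over each chord, where reflecting the chord does not change the integral of the second term.

  If the two integrals over a chord agree, the pointwise inequality is an equality on the chord.
  Where \<open>N\<^sub>1\<close> contributes, this is a linear equation in the height; two different heights force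
  \<open>a = b\<close>, and the remaining equation determines the midpoint.\<close>

lemma steiner_chord_integral_le:
  fixes K :: "'a::euclidean_space set"
  assumes K: "compact K" "convex K" and v: "norm v = 1" and opp: "N2 \<bullet> v = - (N1 \<bullet> v)"
    and ab: "0 < a" "0 < b"
  defines "N \<equiv> N1 + N2 + (2 * (N1 \<bullet> v)) *\<^sub>R v"
  defines "F \<equiv> (\<lambda>x. ennreal (indicator (steiner v K) x * \<phi> (N \<bullet> x)))"
  defines "G \<equiv> (\<lambda>x. ennreal (indicator K x * ((a + b) powr (p - 1) *
      (\<phi> (N1 \<bullet> x) / a powr (p - 1)))) + ennreal (indicator K x * ((a + b) powr (p - 1) *
      (\<phi> (N2 \<bullet> x) / b powr (p - 1)))))"
  shows "(\<integral>\<^sup>+t. F (x + t *\<^sub>R v) \<partial>lborel) \<le> (\<integral>\<^sup>+t. G (x + t *\<^sub>R v) \<partial>lborel)" (is ?le)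
    and "{t. x + t *\<^sub>R v \<in> K} = {lo..hi} \<Longrightarrow> N1 \<bullet> v = 1 \<Longrightarrow> lo < hi \<Longrightarrow>
      (\<integral>\<^sup>+t. F (x + t *\<^sub>R v) \<partial>lborel) = (\<integral>\<^sup>+t. G (x + t *\<^sub>R v) \<partial>lborel) \<Longrightarrow>
      t0 \<in> {lo<..<hi} \<Longrightarrow> 0 < \<phi> (N1 \<bullet> (x + t0 *\<^sub>R v)) \<Longrightarrow>
      lo + hi = (N2 - N1) \<bullet> x"
proof -
  have [measurable]: "K \<in> sets borel" "steiner v K \<in> sets borel"
    using K compact_steiner by (auto intro: borel_compact)
  have vv: "v \<bullet> v = 1" using v by (simp add: dot_square_norm)
  define r where "r = (a + b) powr (p - 1)"
  define A where "A s = r * (\<phi> (N1 \<bullet> (x + s *\<^sub>R v)) / a powr (p - 1))" for s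
  define B where "B s = r * (\<phi> (N2 \<bullet> (x + s *\<^sub>R v)) / b powr (p - 1))" for s
  have AB0: "0 \<le> A s" "0 \<le> B s" for s using ab by (auto simp: A_def B_def r_def)
  have [measurable]: "A \<in> borel_measurable borel" "B \<in> borel_measurable borel"
    unfolding A_def B_def by measurable
  define FI where "FI = (\<integral>\<^sup>+t. F (x + t *\<^sub>R v) \<partial>(lborel::real measure))"
  define GI where "GI = (\<integral>\<^sup>+t. G (x + t *\<^sub>R v) \<partial>(lborel::real measure))"
  have chord: "FI = (\<integral>\<^sup>+s. ennreal (indicator {lo..hi} s *
          \<phi> (N1 \<bullet> (x + s *\<^sub>R v) + N2 \<bullet> (x + (lo + hi - s) *\<^sub>R v))) \<partial>(lborel::real measure))"
      "GI = (\<integral>\<^sup>+s. ennreal (indicator {lo..hi} s * (A s + B (lo + hi - s))) \<partial>(lborel::real measure))"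
    if KT: "{t. x + t *\<^sub>R v \<in> K} = {lo..hi}" and lohi: "lo \<le> hi" for lo hi
  proof -
    have memK: "x + s *\<^sub>R v \<in> K \<longleftrightarrow> s \<in> {lo..hi}" for s unfolding KT[symmetric] by simp
    let ?m = "x \<bullet> v + (lo + hi) / 2"
    have "FI = (\<integral>\<^sup>+t. ennreal (indicator {lo..hi} (?m + t) *
          \<phi> (N1 \<bullet> (x + (?m + t) *\<^sub>R v) + N2 \<bullet> (x + (lo + hi - (?m + t)) *\<^sub>R v))) \<partial>(lborel::real measure))"
      unfolding FI_def
    proof (rule nn_integral_cong)
      fix t :: real
      have N: "N \<bullet> (x + t *\<^sub>R v) = N1 \<bullet> (x + (?m + t) *\<^sub>R v) + N2 \<bullet> (x + (lo + hi - (?m + t)) *\<^sub>R v)"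
      proof -
        have vx: "v \<bullet> x = x \<bullet> v" by (rule inner_commute)
        show ?thesis
          unfolding N_def by (simp add: inner_add_left inner_add_right vv opp vx) (simp add: field_simps)
      qed
      have "indicat_real (steiner v K) (x + t *\<^sub>R v) = indicator {lo..hi} (?m + t)"
        unfolding indicator_def steiner_chord[OF v KT lohi] by (simp only: add_ac)
      then show "F (x + t *\<^sub>R v) = ennreal (indicator {lo..hi} (?m + t) *
          \<phi> (N1 \<bullet> (x + (?m + t) *\<^sub>R v) + N2 \<bullet> (x + (lo + hi - (?m + t)) *\<^sub>R v)))"
        unfolding F_def N by simp
    qed
    also have "\<dots> = (\<integral>\<^sup>+s. ennreal (indicator {lo..hi} s *
          \<phi> (N1 \<bullet> (x + s *\<^sub>R v) + N2 \<bullet> (x + (lo + hi - s) *\<^sub>R v))) \<partial>(lborel::real measure))"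
      by (rule nn_integral_real_shift_reflect(1)) measurable
    finally show "FI = \<dots>" .
    have "GI = (\<integral>\<^sup>+s. ennreal (indicator {lo..hi} s * A s) + ennreal (indicator {lo..hi} s * B s) \<partial>(lborel::real measure))"
      unfolding GI_def
    proof (rule nn_integral_cong)
      fix t :: real
      have "indicat_real K (x + t *\<^sub>R v) = indicator {lo..hi} t" by (simp only: indicator_def memK)
      then show "G (x + t *\<^sub>R v) = ennreal (indicator {lo..hi} t * A t) + ennreal (indicator {lo..hi} t * B t)"
        unfolding G_def A_def B_def r_def by simp
    qed
    also have "\<dots> = (\<integral>\<^sup>+s. ennreal (indicator {lo..hi} s * A s) \<partial>(lborel::real measure))
        + (\<integral>\<^sup>+s. ennreal (indicator {lo..hi} s * B s) \<partial>(lborel::real measure))"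
      by (rule nn_integral_add) measurable
    also have "(\<integral>\<^sup>+s. ennreal (indicator {lo..hi} s * B s) \<partial>(lborel::real measure))
        = (\<integral>\<^sup>+s. ennreal (indicator {lo..hi} (lo + hi - s) * B (lo + hi - s)) \<partial>(lborel::real measure))"
      by (rule nn_integral_real_shift_reflect(2)[symmetric]) measurable
    also have "(\<integral>\<^sup>+s. ennreal (indicator {lo..hi} s * A s) \<partial>(lborel::real measure)) + \<dots>
        = (\<integral>\<^sup>+s. ennreal (indicator {lo..hi} s * A s)
            + ennreal (indicator {lo..hi} (lo + hi - s) * B (lo + hi - s)) \<partial>(lborel::real measure))"
      by (rule nn_integral_add[symmetric]) measurable
    also have "\<dots> = (\<integral>\<^sup>+s. ennreal (indicator {lo..hi} s * (A s + B (lo + hi - s))) \<partial>(lborel::real measure))"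
      by (rule nn_integral_cong) (auto simp: indicator_def AB0 ennreal_plus)
    finally show "GI = \<dots>" .
  qed
  have pw: "\<phi> (N1 \<bullet> (x + s *\<^sub>R v) + N2 \<bullet> (x + s' *\<^sub>R v)) \<le> A s + B s'" for s s'
    using asym_pow_add_le[OF p1 c0 d0 ab] by (simp add: A_def B_def r_def distrib_left)
  show ?le
    unfolding FI_def[symmetric] GI_def[symmetric]
  proof -
    have v0: "v \<noteq> 0" using v by auto
    consider (empty) "{t. x + t *\<^sub>R v \<in> K} = {}"
      | (interval) lo hi where "lo \<le> hi" "{t. x + t *\<^sub>R v \<in> K} = {lo..hi}"
      by (rule chord_interval[OF K v0, of x])
    then show "FI \<le> GI"
    proof cases
      case empty
      then show ?thesis using steiner_chord_empty[OF v empty] by (simp add: FI_def F_def)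
    next
      case (interval lo hi)
      show ?thesis
        unfolding chord[OF interval(2,1)]
        by (intro nn_integral_mono ennreal_leI mult_left_mono pw) auto
    qed
  qed
  assume KT: "{t. x + t *\<^sub>R v \<in> K} = {lo..hi}" and w: "N1 \<bullet> v = 1" and lohi: "lo < hi"
    and eq: "(\<integral>\<^sup>+t. F (x + t *\<^sub>R v) \<partial>lborel) = (\<integral>\<^sup>+t. G (x + t *\<^sub>R v) \<partial>lborel)"
    and t0: "t0 \<in> {lo<..<hi}" "0 < \<phi> (N1 \<bullet> (x + t0 *\<^sub>R v))"
  let ?f = "\<lambda>s. N1 \<bullet> (x + s *\<^sub>R v)" and ?g = "\<lambda>s. N2 \<bullet> (x + (lo + hi - s) *\<^sub>R v)"
  note ch = chord[OF KT less_imp_le[OF lohi]]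
  define D where "D s = A s + B (lo + hi - s) - \<phi> (?f s + ?g s)" for s
  have D0: "0 \<le> D s" for s using pw by (simp add: D_def)
  have cont: "continuous_on S (\<lambda>s. A s + B (lo + hi - s))" "continuous_on S (\<lambda>s. \<phi> (?f s + ?g s))"
     "continuous_on S (\<lambda>s. \<phi> (?f s))" for S
    unfolding A_def B_def using p1 ab by (auto intro!: continuous_intros)
  have fin: "(\<integral>\<^sup>+s. ennreal (indicator {lo..hi} s * \<phi> (?f s + ?g s)) \<partial>(lborel::real measure)) < \<infinity>"
    using borel_integrable_compact[OF compact_Icc cont(2)]
    by (auto simp: integrable_iff_bounded real_norm_def abs_mult)
  have "(\<integral>\<^sup>+s. ennreal (indicator {lo..hi} s * D s) \<partial>(lborel::real measure))
    = (\<integral>\<^sup>+s. ennreal (indicator {lo..hi} s * (A s + B (lo + hi - s)))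
        - ennreal (indicator {lo..hi} s * \<phi> (?f s + ?g s)) \<partial>(lborel::real measure))"
    unfolding D_def by (intro nn_integral_cong) (auto simp: ennreal_minus right_diff_distrib)
  also have "\<dots> = GI - FI"
    unfolding ch using fin pw
    by (intro nn_integral_diff) (auto intro!: ennreal_leI mult_left_mono)
  also have "\<dots> = 0"
  proof -
    have "FI < \<infinity>" using fin ch(1) by simp
    moreover have "GI = FI" using eq by (simp add: FI_def GI_def)
    ultimately show ?thesis by simp
  qed
  finally have ae: "AE s in lborel. ennreal (indicator {lo..hi} s * D s) = 0"
    unfolding D_def by (subst (asm) nn_integral_0_iff_AE) measurable
  define W where "W = {lo<..<hi} \<inter> {s. 0 < \<phi> (?f s)}"
  have W: "open W" "W \<noteq> {}"
    using t0 cont(3) by (auto simp: W_def intro!: open_Int open_Collect_less)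
  have rel: "b * ?f s = a * ?g s" if "s \<in> W" "ennreal (indicator {lo..hi} s * D s) = 0" for s
  proof (rule asym_pow_add_eqD[OF p1 c0 d0 ab])
    have "D s = 0" using that D0[of s] by (auto simp: W_def ennreal_eq_0_iff)
    then show "\<phi> (?f s + ?g s) = (a + b) powr (p - 1) * (\<phi> (?f s) / a powr (p - 1) + \<phi> (?g s) / b powr (p - 1))"
      by (simp add: D_def A_def B_def r_def distrib_left)
  qed (use that in \<open>auto simp: W_def\<close>)
  obtain s where s: "s \<in> W" "ennreal (indicator {lo..hi} s * D s) = 0"
    by (rule AE_meets_open[OF ae W])
  have "AE s' in lborel. s' \<noteq> s" by (rule AE_lborel_singleton)
  with ae have ae': "AE s' in lborel. ennreal (indicator {lo..hi} s' * D s') = 0 \<and> s' \<noteq> s"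
    by eventually_elim blast
  obtain s' where s0: "s' \<in> W" "ennreal (indicator {lo..hi} s' * D s') = 0 \<and> s' \<noteq> s"
    by (rule AE_meets_open[OF ae' W])
  then have s': "s' \<in> W" "ennreal (indicator {lo..hi} s' * D s') = 0" "s' \<noteq> s" by auto
  have e: "b * (N1 \<bullet> x + q) = a * (N2 \<bullet> x - (lo + hi - q))" if "b * ?f q = a * ?g q" for q
    using that w opp by (simp add: inner_add_right algebra_simps)
  have e1: "b * (N1 \<bullet> x + s) = a * (N2 \<bullet> x - (lo + hi - s))" by (rule e[OF rel[OF s]])
  have e2: "b * (N1 \<bullet> x + s') = a * (N2 \<bullet> x - (lo + hi - s'))" by (rule e[OF rel[OF s'(1,2)]])
  have "(b - a) * (s - s') = 0" using e1 e2 by (simp add: algebra_simps)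
  then have "a = b" using s'(3) by simp
  then show "lo + hi = (N2 - N1) \<bullet> x" using e1 ab by (simp add: inner_diff_left)
qed

end

context asym_exponent
begin

lemma nn_integral_weighted_moment:
  assumes "compact K" "0 \<le> r"
  shows "(\<integral>\<^sup>+x. ennreal (indicator K x * (r * (\<phi> (u \<bullet> x) / s powr q))) \<partial>lborel)
    = ennreal (r * (moment K u / s powr q))"
proof -
  have [measurable]: "K \<in> sets borel" using assms by (auto intro: borel_compact)
  have "(\<integral>\<^sup>+x. ennreal (indicator K x * (r * (\<phi> (u \<bullet> x) / s powr q))) \<partial>lborel)
     = (\<integral>\<^sup>+x. ennreal (r / s powr q) * (indicator K x * ennreal (\<phi> (u \<bullet> x))) \<partial>lborel)"
    using assms by (intro nn_integral_cong) (auto simp: indicator_def ennreal_mult[symmetric])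
  also have "\<dots> = ennreal (r / s powr q) * ennreal (moment K u)"
    by (subst nn_integral_cmult) (auto simp: moment_nn_integral[OF assms(1)])
  also have "\<dots> = ennreal (r * (moment K u / s powr q))"
    using assms moment_nonneg[of K u] by (simp add: ennreal_mult[symmetric])
  finally show ?thesis .
qed

text \<open>The inequality on chords integrates to the inequality for the norms if \<open>a\<close> and \<open>b\<close> are
  the norms of \<open>N\<^sub>1\<close> and \<open>N\<^sub>2\<close>. Equality for the norms forces equality on almost every chord. The
  resulting condition on the endpoints is linear in \<open>x\<close>: the midpoints of the chords on which \<open>N\<^sub>1\<close>
  contributes lie on a hyperplane through the origin.\<close>

lemma gauge_steiner:
  fixes K :: "'a::euclidean_space set"
  assumes K: "solid K" and v: "norm v = 1" and opp: "N2 \<bullet> v = - (N1 \<bullet> v)"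
    and ne: "N1 \<noteq> 0" "N2 \<noteq> 0"
  defines "N \<equiv> N1 + N2 + (2 * (N1 \<bullet> v)) *\<^sub>R v"
  shows gauge_steiner_le: "gauge_norm (steiner v K) N \<le> gauge_norm K N1 + gauge_norm K N2"
    and gauge_steiner_eqD: "gauge_norm (steiner v K) N = gauge_norm K N1 + gauge_norm K N2 \<Longrightarrow> N1 \<bullet> v = 1 \<Longrightarrow>
      AE x in lborel. \<forall>lo hi. {t. x + t *\<^sub>R v \<in> K} = {lo..hi} \<longrightarrow>
        (\<exists>t\<in>{lo<..<hi}. 0 < \<phi> (N1 \<bullet> (x + t *\<^sub>R v))) \<longrightarrow> lo + hi = (N2 - N1) \<bullet> x"
proof -
  define a b where "a = gauge_norm K N1" and "b = gauge_norm K N2"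
  have ab: "0 < a" "0 < b" using gauge_pos[OF K] ne by (auto simp: a_def b_def)
  have K': "compact K" "convex K" using solidD[OF K] by auto
  have [measurable]: "K \<in> sets borel" "steiner v K \<in> sets borel"
    using K' compact_steiner by (auto intro: borel_compact)
  define r where "r = (a + b) powr (p - 1)"
  define F where "F x = ennreal (indicator (steiner v K) x * \<phi> (N \<bullet> x))" for x
  define G1 where "G1 x = ennreal (indicator K x * (r * (\<phi> (N1 \<bullet> x) / a powr (p - 1))))" for x
  define G2 where "G2 x = ennreal (indicator K x * (r * (\<phi> (N2 \<bullet> x) / b powr (p - 1))))" for x
  have [measurable]: "F \<in> borel_measurable borel" "G1 \<in> borel_measurable borel" "G2 \<in> borel_measurable borel"
    unfolding F_def G1_def G2_def by measurable
  have intF: "(\<integral>\<^sup>+x. F x \<partial>lborel) = ennreal (moment (steiner v K) N)"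
    unfolding moment_nn_integral[OF compact_steiner[OF K'(1)]] F_def
    by (intro nn_integral_cong) (auto simp: indicator_def)
  have r0: "0 \<le> r" by (simp add: r_def)
  have g: "(\<integral>\<^sup>+x. G1 x \<partial>lborel) = ennreal (r * (moment K N1 / a powr (p - 1)))"
    "(\<integral>\<^sup>+x. G2 x \<partial>lborel) = ennreal (r * (moment K N2 / b powr (p - 1)))"
    unfolding G1_def G2_def by (rule nn_integral_weighted_moment[OF K'(1) r0])+
  have "(\<integral>\<^sup>+x. G1 x + G2 x \<partial>lborel) = (\<integral>\<^sup>+x. G1 x \<partial>lborel) + (\<integral>\<^sup>+x. G2 x \<partial>lborel)"
    by (rule nn_integral_add) measurable
  also have "\<dots> = ennreal (r * (moment K N1 / a powr (p - 1))) + ennreal (r * (moment K N2 / b powr (p - 1)))"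
    unfolding g ..
  also have "\<dots> = ennreal (r * (a powr p / a powr (p - 1) + b powr p / b powr (p - 1)))"
    using r0 ab by (simp add: a_def b_def gauge_powr moment_nonneg ennreal_plus[symmetric] distrib_left del: ennreal_plus)
  also have "\<dots> = ennreal ((a + b) powr p)"
    unfolding r_def by (simp only: weighted_powers_sum[OF ab])
  finally have intG: "(\<integral>\<^sup>+x. G1 x + G2 x \<partial>lborel) = ennreal ((a + b) powr p)" .
  have line: "(\<integral>\<^sup>+t. F (x + t *\<^sub>R v) \<partial>lborel) \<le> (\<integral>\<^sup>+t. G1 (x + t *\<^sub>R v) + G2 (x + t *\<^sub>R v) \<partial>lborel)" for x
    unfolding F_def G1_def G2_def r_def N_def by (rule steiner_chord_integral_le(1)[OF K' v opp ab])
  have "(\<integral>\<^sup>+x. F x \<partial>lborel) \<le> (\<integral>\<^sup>+x. G1 x + G2 x \<partial>lborel)"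
    by (rule nn_integral_slab_mono[OF _ _ v line]) measurable
  then have "moment (steiner v K) N \<le> (a + b) powr p"
    unfolding intF intG by (simp add: ennreal_le_iff)
  then show "gauge_norm (steiner v K) N \<le> gauge_norm K N1 + gauge_norm K N2"
    unfolding a_def[symmetric] b_def[symmetric]
    by (intro gauge_le_add ab) (simp only: weighted_powers_sum[OF ab])
  assume eq: "gauge_norm (steiner v K) N = gauge_norm K N1 + gauge_norm K N2" and w: "N1 \<bullet> v = 1"
  have "moment (steiner v K) N = (a + b) powr p"
    using eq gauge_powr[of "steiner v K" N] by (simp add: a_def b_def)
  then have "AE x in lborel. (\<integral>\<^sup>+t. F (x + t *\<^sub>R v) \<partial>lborel) = (\<integral>\<^sup>+t. G1 (x + t *\<^sub>R v) + G2 (x + t *\<^sub>R v) \<partial>lborel)"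
    by (intro AE_line_integral_eq v line) (auto simp: intF intG)
  then show "AE x in lborel. \<forall>lo hi. {t. x + t *\<^sub>R v \<in> K} = {lo..hi} \<longrightarrow>
        (\<exists>t\<in>{lo<..<hi}. 0 < \<phi> (N1 \<bullet> (x + t *\<^sub>R v))) \<longrightarrow> lo + hi = (N2 - N1) \<bullet> x"
  proof eventually_elim
    case (elim x)
    show ?case
    proof (intro allI impI)
      fix lo hi assume KT: "{t. x + t *\<^sub>R v \<in> K} = {lo..hi}"
        and "\<exists>t\<in>{lo<..<hi}. 0 < \<phi> (N1 \<bullet> (x + t *\<^sub>R v))"
      then obtain t where t: "t \<in> {lo<..<hi}" "0 < \<phi> (N1 \<bullet> (x + t *\<^sub>R v))" by blast
      then have "lo < hi" by auto
      show "lo + hi = (N2 - N1) \<bullet> x"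
        by (rule steiner_chord_integral_le(2)[OF K' v opp ab KT w \<open>lo < hi\<close> _ t])
          (use elim in \<open>simp only: F_def G1_def G2_def r_def N_def\<close>)
    qed
  qed
qed

text \<open>A point \<open>z\<close> outside the symmetral of a convex body \<open>M\<close> means that no two points of \<open>M\<close> on the line
  of \<open>z\<close> have the required difference. This says that a linear image of \<open>M \<times> M\<close> misses a point, and
  a separating functional on the product is a pair \<open>N\<^sub>1, N\<^sub>2\<close> with opposite components along \<open>v\<close>.\<close>

lemma not_in_steiner_separation:
  fixes M :: "'a::euclidean_space set"
  assumes M: "compact M" "convex M" and v: "norm v = 1" and z: "z \<notin> steiner v M"
  obtains N1 N2 where "N2 \<bullet> v = - (N1 \<bullet> v)"
    "\<And>x y. x \<in> M \<Longrightarrow> y \<in> M \<Longrightarrow> N1 \<bullet> x + N2 \<bullet> y < (N1 + N2 + (2 * (N1 \<bullet> v)) *\<^sub>R v) \<bullet> z"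
proof -
  have vv: "v \<bullet> v = 1" using v by (simp add: dot_square_norm)
  define P where "P x = x - (x \<bullet> v) *\<^sub>R v" for x :: 'a
  have linP: "linear P" unfolding P_def by (intro linearI) (auto simp: algebra_simps inner_add_left)
  define T where "T = (\<lambda>(x, y). (P x, P y, (x - y) \<bullet> v))"
  have linT: "linear T"
    unfolding T_def using linP
    by (intro linearI) (auto simp: linear_add linear_scale inner_add_left inner_diff_left algebra_simps)
  define q where "q = (P z, P z, 2 * (z \<bullet> v))"
  have "q \<notin> T ` (M \<times> M)"
  proof
    assume "q \<in> T ` (M \<times> M)"
    then obtain x y where xy: "x \<in> M" "y \<in> M" "P x = P z" "P y = P z" "(x - y) \<bullet> v = 2 * (z \<bullet> v)"
      by (auto simp: T_def q_def)
    have "z = x - (((x + y) \<bullet> v) / 2) *\<^sub>R v"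
    proof -
      have x: "x = z - (z \<bullet> v) *\<^sub>R v + (x \<bullet> v) *\<^sub>R v" using xy(3) unfolding P_def by (simp add: algebra_simps)
      have c: "((x + y) \<bullet> v) / 2 = x \<bullet> v - z \<bullet> v" using xy(5) by (simp add: inner_add_left inner_diff_left)
      show ?thesis unfolding c by (subst x) (simp add: algebra_simps inner_add_left inner_diff_left vv)
    qed
    moreover have "x - (x \<bullet> v) *\<^sub>R v = y - (y \<bullet> v) *\<^sub>R v" using xy(3,4) by (simp add: P_def)
    ultimately have "z \<in> steiner v M" unfolding steiner_def using xy(1,2) by force
    with z show False by blast
  qed
  moreover have "convex (T ` (M \<times> M))" using M linT by (intro convex_linear_image convex_Times)
  moreover have "closed (T ` (M \<times> M))"
    using M linT
    by (intro compact_imp_closed compact_continuous_image linear_continuous_on compact_Times)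
      (auto simp: linear_conv_bounded_linear)
  ultimately obtain n \<beta> where n: "n \<bullet> q < \<beta>" "\<And>w. w \<in> T ` (M \<times> M) \<Longrightarrow> \<beta> < n \<bullet> w"
    using separating_hyperplane_closed_point by metis
  obtain \<alpha>1 \<alpha>2 \<omega> where n': "n = (\<alpha>1, \<alpha>2, \<omega>)" by (metis prod.exhaust)
  define N1 where "N1 = - P \<alpha>1 - \<omega> *\<^sub>R v"
  define N2 where "N2 = - P \<alpha>2 + \<omega> *\<^sub>R v"
  have Pv: "P x \<bullet> v = 0" for x by (simp add: P_def inner_diff_left vv)
  have PP: "x \<bullet> P y = P x \<bullet> y" for x y by (simp add: P_def inner_diff_left inner_diff_right inner_commute)
  show ?thesis
  proof
    show "N2 \<bullet> v = - (N1 \<bullet> v)" by (simp add: N1_def N2_def inner_diff_left inner_add_left Pv vv)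
  next
    fix x y assume xy: "x \<in> M" "y \<in> M"
    have "n \<bullet> q < n \<bullet> T (x, y)" using n(1) n(2)[of "T (x, y)"] xy by force
    then have "P \<alpha>1 \<bullet> z + (P \<alpha>2 \<bullet> z + \<omega> * (2 * (z \<bullet> v))) < P \<alpha>1 \<bullet> x + (P \<alpha>2 \<bullet> y + \<omega> * (x \<bullet> v - y \<bullet> v))"
      by (simp add: n' q_def T_def PP inner_diff_left)
    moreover have "N1 \<bullet> x + N2 \<bullet> y = - (P \<alpha>1 \<bullet> x + (P \<alpha>2 \<bullet> y + \<omega> * (x \<bullet> v - y \<bullet> v)))"
      by (simp add: N1_def N2_def inner_diff_left inner_add_left inner_commute[of v] algebra_simps)
    moreover have "(N1 + N2 + (2 * (N1 \<bullet> v)) *\<^sub>R v) \<bullet> z = - (P \<alpha>1 \<bullet> z + (P \<alpha>2 \<bullet> z + \<omega> * (2 * (z \<bullet> v))))"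
    proof -
      have N1v: "N1 \<bullet> v = - \<omega>" by (simp add: N1_def inner_diff_left Pv vv)
      show ?thesis unfolding N1v
        by (simp add: N1_def N2_def inner_diff_left inner_add_left inner_commute[of v] algebra_simps)
    qed
    ultimately show "N1 \<bullet> x + N2 \<bullet> y < (N1 + N2 + (2 * (N1 \<bullet> v)) *\<^sub>R v) \<bullet> z" by linarith
  qed
qed

text \<open>For a point outside the symmetral of the centroid body, the separating functionals \<open>N\<^sub>1\<close> and \<open>N\<^sub>2\<close>
  are evaluated at contact points. This bounds the sum of their norms strictly by the value of the combined
  functional at the point, which contradicts the inequality for the norms.\<close>

theorem centroid_body_steiner:
  fixes K :: "'a::euclidean_space set"
  assumes K: "solid K" and v: "norm v = 1"
  shows "centroid_body (steiner v K) \<subseteq> steiner v (centroid_body K)"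
proof (rule subsetI, rule ccontr)
  fix z assume z: "z \<in> centroid_body (steiner v K)" "z \<notin> steiner v (centroid_body K)"
  let ?M = "centroid_body K"
  note M = solidD[OF solid_centroid_body[OF K]]
  obtain N1 N2 where N: "N2 \<bullet> v = - (N1 \<bullet> v)"
    "\<And>x y. x \<in> ?M \<Longrightarrow> y \<in> ?M \<Longrightarrow> N1 \<bullet> x + N2 \<bullet> y < (N1 + N2 + (2 * (N1 \<bullet> v)) *\<^sub>R v) \<bullet> z"
    using not_in_steiner_separation[OF M(1,2) v z(2)] by metis
  let ?N = "N1 + N2 + (2 * (N1 \<bullet> v)) *\<^sub>R v"
  obtain x y where xy: "x \<in> ?M" "y \<in> ?M" "N1 \<bullet> x = gauge_norm K N1" "N2 \<bullet> y = gauge_norm K N2"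
    using centroid_body_attained[OF K] by metis
  have vv: "v \<bullet> v = 1" using v by (simp add: dot_square_norm)
  \<comment> \<open>If one functional vanishes, the other is orthogonal to \<open>v\<close>. The inequality is then applied
      to its two halves.\<close>
  have "gauge_norm (steiner v K) ?N \<le> gauge_norm K N1 + gauge_norm K N2"
  proof (cases "N1 \<noteq> 0 \<and> N2 \<noteq> 0")
    case True then show ?thesis using gauge_steiner_le[OF K v N(1)] by blast
  next
    case False
    have half: "gauge_norm (steiner v K) n \<le> gauge_norm K n" if n: "n \<bullet> v = 0" for n
    proof (cases "n = 0")
      case False
      have "gauge_norm (steiner v K) ((1/2) *\<^sub>R n + (1/2) *\<^sub>R n + (2 * (((1/2) *\<^sub>R n) \<bullet> v)) *\<^sub>R v)
        \<le> gauge_norm K ((1/2) *\<^sub>R n) + gauge_norm K ((1/2) *\<^sub>R n)"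
        using False n by (intro gauge_steiner_le[OF K v]) auto
      moreover have "(1/2) *\<^sub>R n + (1/2) *\<^sub>R n = n" by (simp flip: scaleR_add_left)
      ultimately show ?thesis using gauge_scale[of "1/2" K n] n by simp
    qed simp
    have "N1 \<bullet> v = 0" "N2 \<bullet> v = 0" using False N(1) by auto
    then show ?thesis using False half[of N1] half[of N2] by auto
  qed
  then show False using N(2)[OF xy(1,2)] xy(3,4) centroid_body_le[OF z(1), of ?N] by simp
qed

corollary measure_centroid_body_steiner:
  fixes K :: "'a::euclidean_space set"
  assumes K: "solid K" and v: "norm v = 1"
  shows "measure lborel (centroid_body (steiner v K)) \<le> measure lborel (centroid_body K)"
proof -
  note M = solidD[OF solid_centroid_body[OF K]]
  have "measure lborel (centroid_body (steiner v K)) \<le> measure lborel (steiner v (centroid_body K))"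
    using centroid_body_steiner[OF K v] solidD[OF solid_centroid_body[OF solid_steiner[OF K v]]]
      M(1) compact_steiner emeasure_compact_finite[OF compact_steiner[OF M(1)], of v]
    by (intro measure_mono_fmeasurable fmeasurableI) (auto intro!: borel_compact)
  also have "\<dots> = measure lborel (centroid_body K)"
    using emeasure_steiner[OF M(1,2) v] by (simp add: measure_def)
  finally show ?thesis .
qed

end

section \<open>Linear maps\<close>

text \<open>The measure \<open>S \<mapsto> vol(A\<^sup>-\<^sup>1 S)\<close> is translation invariant, hence a multiple of the volume. The
  usual uniqueness argument integrates \<open>1\<^sub>S(x + Az) 1\<^sub>C(Az)\<close>, with \<open>C\<close> the unit ball, in both orders.\<close>

lemma nn_integral_linear_change:
  fixes A :: "'a::euclidean_space \<Rightarrow> 'a"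
  assumes A: "linear A" "bij A"
  obtains \<delta> where "0 < \<delta>"
    "\<And>f. f \<in> borel_measurable borel \<Longrightarrow> (\<integral>\<^sup>+z. f (A z) \<partial>lborel) = ennreal \<delta> * (\<integral>\<^sup>+x. f x \<partial>lborel)"
proof -
  define B where "B = inv A"
  have linB: "linear B" using A unfolding B_def by (simp add: bij_is_inj inj_linear_imp_inv_linear)
  have AB [simp]: "A (B x) = x" "B (A x) = x" for x
    using A(2) by (auto simp: B_def bij_is_surj surj_f_inv_f bij_is_inj)
  have bl: "bounded_linear A" "bounded_linear B" using A(1) linB linear_conv_bounded_linear by auto
  have [measurable]: "A \<in> borel_measurable borel"
    using bl by (intro borel_measurable_continuous_onI linear_continuous_on)
  define C :: "'a set" where "C = cball 0 1"
  have [measurable]: "C \<in> sets borel" by (simp add: C_def)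
  define mC where "mC = measure lborel C"
  define mB where "mB = measure lborel (B ` C)"
  have compBC: "compact (B ` C)"
    unfolding C_def using bl by (intro compact_continuous_image linear_continuous_on compact_cball)
  have [measurable]: "B ` C \<in> sets borel" using compBC by (rule borel_compact)
  have mC: "0 < mC" "emeasure lborel C = ennreal mC"
    unfolding mC_def C_def using emeasure_lborel_cball_finite[of "0::'a" 1]
    by (auto simp: content_cball_pos intro!: emeasure_eq_ennreal_measure)
  have mB: "emeasure lborel (B ` C) = ennreal mB"
    unfolding mB_def using emeasure_compact_finite[OF compBC] by (intro emeasure_eq_ennreal_measure) auto
  have "0 < mB"
  proof -
    obtain k where k: "0 < k" "\<And>x. norm (A x) \<le> k * norm x"
      using bounded_linear.pos_bounded[OF bl(1)] by (auto simp: mult.commute)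
    have "cball 0 (1 / k) \<subseteq> B ` C"
    proof
      fix x :: 'a assume "x \<in> cball 0 (1 / k)"
      then have "norm (A x) \<le> 1" using k(1) k(2)[of x] mult_left_mono[of "norm x" "1 / k" k] by simp
      then show "x \<in> B ` C" by (intro image_eqI[of _ _ "A x"]) (auto simp: C_def)
    qed
    then have "measure lborel (cball (0::'a) (1 / k)) \<le> mB"
      unfolding mB_def using compBC emeasure_compact_finite[OF compBC]
      by (intro measure_mono_fmeasurable fmeasurableI) (auto intro: borel_compact)
    then show ?thesis using content_cball_pos[of "1 / k" "0::'a"] k(1) by (meson less_le_trans zero_less_divide_1_iff)
  qed
  have indC: "indicator C (A z) = indicator (B ` C) z" for z :: 'a
  proof -
    have "A z \<in> C \<longleftrightarrow> z \<in> B ` C" by (metis AB image_iff)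
    then show ?thesis by (simp add: indicator_def)
  qed
  show ?thesis
  proof (rule that[of "mB / mC"])
    show "0 < mB / mC" using mC \<open>0 < mB\<close> by simp
    fix f :: "'a \<Rightarrow> ennreal" assume [measurable]: "f \<in> borel_measurable borel"
    have "(\<integral>\<^sup>+z. (\<integral>\<^sup>+x. f (x + A z) * indicator C (A z) \<partial>lborel) \<partial>lborel)
        = (\<integral>\<^sup>+z. (\<integral>\<^sup>+x. f x \<partial>lborel) * indicator C (A z) \<partial>lborel)"
      by (intro nn_integral_cong) (simp add: nn_integral_multc nn_integral_lborel_shift)
    also have "\<dots> = (\<integral>\<^sup>+x. f x \<partial>lborel) * ennreal mB"
      unfolding indC by (simp add: nn_integral_cmult mB)
    finally have 1: "(\<integral>\<^sup>+z. (\<integral>\<^sup>+x. f (x + A z) * indicator C (A z) \<partial>lborel) \<partial>lborel) = \<dots>" .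
    have "(\<integral>\<^sup>+z. (\<integral>\<^sup>+x. f (x + A z) * indicator C (A z) \<partial>lborel) \<partial>lborel)
        = (\<integral>\<^sup>+x. (\<integral>\<^sup>+z. f (x + A z) * indicator C (A z) \<partial>lborel) \<partial>lborel)"
      by (rule lborel_pair.Fubini') measurable
    also have "\<dots> = (\<integral>\<^sup>+x. (\<integral>\<^sup>+z. f (A z) * indicator C (A z - x) \<partial>lborel) \<partial>lborel)"
    proof (rule nn_integral_cong)
      fix x
      show "(\<integral>\<^sup>+z. f (x + A z) * indicator C (A z) \<partial>lborel) = (\<integral>\<^sup>+z. f (A z) * indicator C (A z - x) \<partial>lborel)"
        using nn_integral_lborel_shift[of "\<lambda>z. f (A z) * indicator C (A z - x)" "B x"]
        by (simp add: linear_add[OF A(1)] add.commute)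
    qed
    also have "\<dots> = (\<integral>\<^sup>+z. (\<integral>\<^sup>+x. f (A z) * indicator C (A z - x) \<partial>lborel) \<partial>lborel)"
      by (rule lborel_pair.Fubini') measurable
    also have "\<dots> = (\<integral>\<^sup>+z. f (A z) * ennreal mC \<partial>lborel)"
    proof (rule nn_integral_cong)
      fix z
      have "(\<integral>\<^sup>+x. indicator C (A z - x) \<partial>lborel) = (\<integral>\<^sup>+x. indicator C x \<partial>(lborel :: 'a measure))"
      proof -
        have "indicator C (A z - x) = (indicator C (x + (- A z)) :: ennreal)" for x
          by (auto simp: C_def indicator_def norm_minus_commute)
        then show ?thesis using nn_integral_lborel_shift[of "indicator C" "- A z"] by simp
      qed
      then show "(\<integral>\<^sup>+x. f (A z) * indicator C (A z - x) \<partial>lborel) = f (A z) * ennreal mC"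
        by (simp add: nn_integral_cmult mC)
    qed
    also have "\<dots> = (\<integral>\<^sup>+z. f (A z) \<partial>lborel) * ennreal mC" by (rule nn_integral_multc) measurable
    finally have "(\<integral>\<^sup>+z. f (A z) \<partial>lborel) * ennreal mC = (\<integral>\<^sup>+x. f x \<partial>lborel) * ennreal mB" using 1 by simp
    then have "(\<integral>\<^sup>+z. f (A z) \<partial>lborel) * ennreal mC * ennreal (1 / mC) = (\<integral>\<^sup>+x. f x \<partial>lborel) * ennreal mB * ennreal (1 / mC)"
      by simp
    then show "(\<integral>\<^sup>+z. f (A z) \<partial>lborel) = ennreal (mB / mC) * (\<integral>\<^sup>+x. f x \<partial>lborel)"
      using mC \<open>0 < mB\<close> by (simp add: mult.assoc ennreal_mult[symmetric]) (simp add: mult.commute)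
  qed
qed

lemma nn_integral_linear_image:
  fixes A :: "'a::euclidean_space \<Rightarrow> 'a"
  assumes A: "linear A" "bij A"
  obtains J where "0 < J"
    "\<And>S f. S \<in> sets borel \<Longrightarrow> A ` S \<in> sets borel \<Longrightarrow> f \<in> borel_measurable borel \<Longrightarrow>
      (\<integral>\<^sup>+x. indicator (A ` S) x * f x \<partial>lborel) = ennreal J * (\<integral>\<^sup>+z. indicator S z * f (A z) \<partial>lborel)"
proof -
  obtain \<delta> where \<delta>: "0 < \<delta>"
    "\<And>f. f \<in> borel_measurable borel \<Longrightarrow> (\<integral>\<^sup>+z. f (A z) \<partial>lborel) = ennreal \<delta> * (\<integral>\<^sup>+x. f x \<partial>lborel)"
    by (rule nn_integral_linear_change[OF A]) blast
  show ?thesis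
  proof (rule that[of "1 / \<delta>"])
    fix S :: "'a set" and f :: "'a \<Rightarrow> ennreal" assume [measurable]: "S \<in> sets borel" "A ` S \<in> sets borel" "f \<in> borel_measurable borel"
    have "(\<integral>\<^sup>+z. indicator S z * f (A z) \<partial>lborel) = (\<integral>\<^sup>+z. indicator (A ` S) (A z) * f (A z) \<partial>lborel)"
      using A(2) by (intro nn_integral_cong) (auto simp: indicator_def bij_is_inj inj_image_mem_iff)
    also have "\<dots> = ennreal \<delta> * (\<integral>\<^sup>+x. indicator (A ` S) x * f x \<partial>lborel)"
      by (rule \<delta>(2)) measurable
    finally show "(\<integral>\<^sup>+x. indicator (A ` S) x * f x \<partial>lborel)
        = ennreal (1 / \<delta>) * (\<integral>\<^sup>+z. indicator S z * f (A z) \<partial>lborel)"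
      using \<delta>(1) by (simp flip: mult.assoc add: ennreal_mult[symmetric])
  qed (use \<delta> in simp)
qed

lemma measure_scaleR_image:
  fixes S :: "'a::euclidean_space set"
  assumes s: "0 < s" and S: "compact S"
  shows "measure lborel ((*\<^sub>R) s ` S) = s ^ DIM('a) * measure lborel S"
proof -
  have bij: "bij ((*\<^sub>R) s :: 'a \<Rightarrow> 'a)"
    using s by (intro o_bij[of "(*\<^sub>R) (1 / s)"]) (auto simp: o_def)
  have lin: "linear ((*\<^sub>R) s :: 'a \<Rightarrow> 'a)" by (rule linear_scaleR)
  obtain J where J: "0 < J"
    "\<And>T f. T \<in> sets borel \<Longrightarrow> (*\<^sub>R) s ` T \<in> sets borel \<Longrightarrow> f \<in> borel_measurable borel \<Longrightarrow>
      (\<integral>\<^sup>+x. indicator ((*\<^sub>R) s ` T) x * f x \<partial>lborel) = ennreal J * (\<integral>\<^sup>+z. indicator T z * f (s *\<^sub>R (z::'a)) \<partial>lborel)"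
    by (rule nn_integral_linear_image[OF lin bij]) blast
  have m: "measure lborel ((*\<^sub>R) s ` T) = J * measure lborel T" if T: "compact T" for T :: "'a set"
  proof -
    have T': "T \<in> sets borel" "(*\<^sub>R) s ` T \<in> sets borel"
      using T compact_scaling[OF T, of s] by (auto intro: borel_compact)
    then have "emeasure lborel ((*\<^sub>R) s ` T) = ennreal J * emeasure lborel T"
      using J(2)[of T "\<lambda>_. 1"] by simp
    then show ?thesis using J(1) by (simp add: measure_def enn2real_mult)
  qed
  have "(*\<^sub>R) s ` cball (0::'a) 1 = cball 0 s"
    using s cball_scale[of s "0::'a" 1] by simp
  then have "J * measure lborel (cball (0::'a) 1) = s ^ DIM('a) * measure lborel (cball (0::'a) 1)"
    using m[of "cball 0 1"] content_ball_conv_unit_ball[of s "0::'a"] s by (simp add: content_cball_conv_ball)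
  then have "J = s ^ DIM('a)" using content_cball_pos[of 1 "0::'a"] by simp
  then show ?thesis using m[OF S] by simp
qed

lemma solid_linear_image:
  fixes A :: "'a::euclidean_space \<Rightarrow> 'a"
  assumes A: "linear A" "bij A" and K: "solid K"
  shows "solid (A ` K)"
proof -
  have "0 \<in> A ` interior K" using solidD(3)[OF K] linear_0[OF A(1)] by (metis image_eqI)
  then have "0 \<in> interior (A ` K)"
    using interior_injective_linear_image[OF A(1) bij_is_inj[OF A(2)]] by simp
  then show ?thesis
    using solidD[OF K] A(1) unfolding solid_def
    by (auto intro!: convex_linear_image compact_continuous_image linear_continuous_on
        simp: linear_conv_bounded_linear)
qed

context asym_exponent
begin

text \<open>Let \<open>J\<close> be the factor by which \<open>A\<close> multiplies volumes. The norm belonging to \<open>AK\<close> is \<open>J\<^bsup>1/p\<^esup>\<close> times the norm belonging to \<open>K\<close> composed with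
  the adjoint of \<open>A\<close>, so the centroid body of \<open>AK\<close> is \<open>J\<^bsup>1/p\<^esup> A\<close> applied to that of \<open>K\<close>.\<close>

lemma measure_centroid_body_linear_image:
  fixes A :: "'a::euclidean_space \<Rightarrow> 'a"
  assumes A: "linear A" "bij A"
  obtains J where "0 < J" "\<And>K. solid K \<Longrightarrow> measure lborel (A ` K) = J * measure lborel K"
    "\<And>K. solid K \<Longrightarrow> measure lborel (centroid_body (A ` K))
      = J powr (real DIM('a) / p + 1) * measure lborel (centroid_body K)"
proof -
  obtain J where J: "0 < J"
    "\<And>S f. S \<in> sets borel \<Longrightarrow> A ` S \<in> sets borel \<Longrightarrow> f \<in> borel_measurable borel \<Longrightarrow>
      (\<integral>\<^sup>+x. indicator (A ` S) x * f x \<partial>lborel) = ennreal J * (\<integral>\<^sup>+z. indicator S z * f (A z) \<partial>lborel)"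
    by (rule nn_integral_linear_image[OF A]) blast
  have meas: "measure lborel (A ` K) = J * measure lborel K" if K: "solid K" for K
  proof -
    have "emeasure lborel (A ` K) = ennreal J * emeasure lborel K"
      using J(2)[of K "\<lambda>_. 1"] solidD(4)[OF K] solidD(4)[OF solid_linear_image[OF A K]] by simp
    then show ?thesis using J(1) by (simp add: measure_def enn2real_mult)
  qed
  have "measure lborel (centroid_body (A ` K)) = J powr (real DIM('a) / p + 1) * measure lborel (centroid_body K)"
    if K: "solid K" for K
  proof -
    note K' = solid_linear_image[OF A K]
    have mom: "moment (A ` K) u = J * moment K (adjoint A u)" for u
    proof -
      have "ennreal (moment (A ` K) u) = ennreal J * ennreal (moment K (adjoint A u))"
        unfolding moment_nn_integral[OF solidD(1)[OF K']] moment_nn_integral[OF solidD(1)[OF K]]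
        using J(2)[of K "\<lambda>x. ennreal (\<phi> (u \<bullet> x))"] solidD(4)[OF K] solidD(4)[OF K']
        by (simp add: adjoint_clauses(2)[OF A(1)])
      then show ?thesis using J(1) moment_nonneg[of "A ` K" u] moment_nonneg[of K "adjoint A u"]
        by (simp add: ennreal_mult[symmetric])
    qed
    define s where "s = J powr (1 / p)"
    have s: "0 < s" using J(1) by (simp add: s_def)
    have gauge: "gauge_norm (A ` K) u = s * gauge_norm K (adjoint A u)" for u
      unfolding gauge_norm_def mom s_def using J(1) moment_nonneg by (simp add: powr_mult)
    have adj_surj: "\<exists>w. u = adjoint A w" for u
    proof -
      have "inj A" using A(2) by (rule bij_is_inj)
      then have "surj (adjoint A)" using A(1) by (simp add: surj_adjoint_iff_inj)
      then show ?thesis by (metis surjD)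
    qed
    have "centroid_body (A ` K) = A ` ((*\<^sub>R) s ` centroid_body K)"
    proof (intro set_eqI iffI)
      fix y assume y: "y \<in> centroid_body (A ` K)"
      obtain z where z: "y = A z" using A(2) by (metis bij_pointE)
      have "(1 / s) *\<^sub>R z \<in> centroid_body K"
        unfolding centroid_body_def
      proof (intro CollectI allI)
        fix u obtain w where w: "u = adjoint A w" using adj_surj by blast
        have "w \<bullet> A z \<le> s * gauge_norm K u"
          using centroid_body_le[OF y, of w] by (simp add: gauge z w)
        then show "u \<bullet> ((1 / s) *\<^sub>R z) \<le> gauge_norm K u"
          using s by (simp add: w adjoint_clauses(2)[OF A(1)] field_simps)
      qed
      then show "y \<in> A ` ((*\<^sub>R) s ` centroid_body K)"
        using s by (intro image_eqI[of _ _ z] image_eqI[of _ _ "(1 / s) *\<^sub>R z"]) (auto simp: z)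
    next
      fix y assume "y \<in> A ` ((*\<^sub>R) s ` centroid_body K)"
      then obtain z where z: "z \<in> centroid_body K" "y = A (s *\<^sub>R z)" by blast
      show "y \<in> centroid_body (A ` K)"
        unfolding centroid_body_def
      proof (intro CollectI allI)
        fix u
        have "u \<bullet> y = s * (adjoint A u \<bullet> z)"
          by (simp add: z(2) linear_scale[OF A(1)] adjoint_clauses(2)[OF A(1)])
        also have "\<dots> \<le> gauge_norm (A ` K) u"
          unfolding gauge using s centroid_body_le[OF z(1), of "adjoint A u"] by (intro mult_left_mono) auto
        finally show "u \<bullet> y \<le> gauge_norm (A ` K) u" .
      qed
    qed
    moreover have sol: "solid ((*\<^sub>R) s ` centroid_body K)"
      using s by (intro solid_linear_image linear_scaleR solid_centroid_body K o_bij[of "(*\<^sub>R) (1 / s)"]) (auto simp: o_def)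
    ultimately have "measure lborel (centroid_body (A ` K)) = J * (s ^ DIM('a) * measure lborel (centroid_body K))"
      using meas[OF sol] measure_scaleR_image[OF s solidD(1)[OF solid_centroid_body[OF K]]] by simp
    moreover have "J powr (real DIM('a) / p + 1) = J * s ^ DIM('a)"
      using J(1) s by (simp add: s_def powr_add powr_powr flip: powr_realpow)
    ultimately show ?thesis by (simp add: mult.assoc)
  qed
  then show ?thesis using that J(1) meas by blast
qed

end

section \<open>Approaching the ball\<close>

lemma steiner_cball: "norm v = 1 \<Longrightarrow> steiner v (cball 0 r) = cball (0 :: 'a::euclidean_space) r"
  using steiner_cball_subset[of v "cball 0 r" r] cball_subset_steiner[of v r "cball 0 r"] by blast

lemma measure_Diff_Int:
  assumes "C \<in> fmeasurable M" "D \<in> fmeasurable M"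
  shows "measure M (C - D) = measure M C - measure M (C \<inter> D)"
proof -
  have "C - D = C - (C \<inter> D)" by blast
  then show ?thesis
    using measurable_measure_Diff[OF assms(1), of "C \<inter> D"] assms
    by (auto simp: fmeasurable_def)
qed

text \<open>On every line the ball and the symmetral of \<open>K\<close> cut out concentric intervals, so one contains
  the other, and the part of the ball that is not covered has length \<open>max 0 (|B| - |K|)\<close>. This is the
  length of \<open>B - K\<close> diminished by the smaller of the lengths of \<open>K - B\<close> and \<open>B - K\<close>, and a part of
  \<open>K - B\<close> that a translation along the line moves into \<open>B - K\<close> is not longer than that.\<close>

lemma steiner_chord_gain:
  fixes K :: "'a::euclidean_space set" and r \<tau> :: real
  assumes K: "compact K" "convex K" and v: "norm v = 1"
  defines "B \<equiv> cball (0::'a) r"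
  shows "(\<integral>\<^sup>+t. indicator (B - steiner v K) (x + t *\<^sub>R v)
      + indicator (K - B) (x + t *\<^sub>R v) * indicator (B - K) (x + t *\<^sub>R v + \<tau> *\<^sub>R v) \<partial>lborel)
    \<le> (\<integral>\<^sup>+t. indicator (B - K) (x + t *\<^sub>R v) \<partial>lborel)"
proof -
  have [measurable]: "K \<in> sets borel" "steiner v K \<in> sets borel" "B \<in> sets borel"
    using K compact_steiner by (auto intro: borel_compact simp: B_def)
  have v0: "v \<noteq> 0" using v by auto
  have shift: "indicator (B - K) (x + t *\<^sub>R v + \<tau> *\<^sub>R v) = (indicator (B - K) (x + (\<tau> + t) *\<^sub>R v) :: ennreal)" for t
    by (simp add: scaleR_add_left add_ac)
  let ?X = "\<integral>\<^sup>+t. indicator (B - steiner v K) (x + t *\<^sub>R v) \<partial>(lborel::real measure)"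
  let ?Y = "\<integral>\<^sup>+t. indicator (K - B) (x + t *\<^sub>R v) * indicator (B - K) (x + t *\<^sub>R v + \<tau> *\<^sub>R v) \<partial>(lborel::real measure)"
  let ?Z = "\<integral>\<^sup>+t. indicator (B - K) (x + t *\<^sub>R v) \<partial>(lborel::real measure)"
  have split: "(\<integral>\<^sup>+t. indicator (B - steiner v K) (x + t *\<^sub>R v)
      + indicator (K - B) (x + t *\<^sub>R v) * indicator (B - K) (x + t *\<^sub>R v + \<tau> *\<^sub>R v) \<partial>lborel) = ?X + ?Y"
    by (rule nn_integral_add) measurable
  have YZ: "?Y \<le> ?Z"
  proof -
    have "?Y \<le> (\<integral>\<^sup>+t. indicator (B - K) (x + (\<tau> + t) *\<^sub>R v) \<partial>(lborel::real measure))"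
      unfolding shift by (intro nn_integral_mono) (auto simp: indicator_def)
    also have "\<dots> = ?Z" by (rule nn_integral_real_shift_reflect(1)) measurable
    finally show ?thesis .
  qed
  have YK: "?Y \<le> (\<integral>\<^sup>+t. indicator (K - B) (x + t *\<^sub>R v) \<partial>(lborel::real measure))"
    by (intro nn_integral_mono) (auto simp: indicator_def)
  consider (noB) "{t. x + t *\<^sub>R v \<in> B} = {}"
    | (noK) "{t. x + t *\<^sub>R v \<in> K} = {}"
    | (both) lo hi lo' hi' where "lo \<le> hi" "{t. x + t *\<^sub>R v \<in> K} = {lo..hi}"
        "lo' \<le> hi'" "{t. x + t *\<^sub>R v \<in> B} = {lo'..hi'}"
  proof -
    have B: "compact B" "convex B" by (auto simp: B_def)
    show ?thesis
    proof (rule chord_interval[OF B v0, of x])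
      fix lo' hi' assume B': "lo' \<le> hi'" "{t. x + t *\<^sub>R v \<in> B} = {lo'..hi'}"
      show ?thesis
      proof (rule chord_interval[OF K v0, of x])
        fix lo hi assume "lo \<le> hi" "{t. x + t *\<^sub>R v \<in> K} = {lo..hi}"
        then show ?thesis by (rule that(3)[OF _ _ B'])
      qed (rule that(2))
    qed (rule that(1))
  qed
  then have "?X + ?Y \<le> ?Z"
  proof cases
    case noB
    then have "?X = 0" by (subst nn_integral_0_iff_AE) auto
    then show ?thesis using YZ by simp
  next
    case noK
    have "?X = ?Z" using noK steiner_chord_empty[OF v noK] by (intro nn_integral_cong) (auto simp: indicator_def)
    moreover have "?Y = 0" using noK by (subst nn_integral_0_iff_AE) auto
    ultimately show ?thesis by simp
  next
    case (both lo hi lo' hi')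
    have memK: "x + t *\<^sub>R v \<in> K \<longleftrightarrow> t \<in> {lo..hi}" and memB: "x + t *\<^sub>R v \<in> B \<longleftrightarrow> t \<in> {lo'..hi'}" for t
      unfolding both(2,4)[symmetric] by simp_all
    \<comment> \<open>The ball is its own symmetral, hence its chord is centered at the foot of the perpendicular.\<close>
    have center: "lo' + hi' = - 2 * (x \<bullet> v)"
    proof -
      have "t \<in> {lo'..hi'} \<longleftrightarrow> t + x \<bullet> v + (lo' + hi') / 2 \<in> {lo'..hi'}" for t
        using steiner_chord[OF v both(4,3), of t] memB[of t] steiner_cball[OF v, of r] by (simp add: B_def)
      from this[of lo'] this[of hi'] this[of "lo' - (x \<bullet> v + (lo' + hi') / 2)"]
        this[of "hi' - (x \<bullet> v + (lo' + hi') / 2)"] both(3)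
      show ?thesis by (simp add: field_simps)
    qed
    define m where "m = x \<bullet> v + (lo + hi) / 2"
    have memS: "x + t *\<^sub>R v \<in> steiner v K \<longleftrightarrow> t \<in> {lo - m..hi - m}" for t
      unfolding steiner_chord[OF v both(2,1)] m_def by auto
    show ?thesis
    proof (cases "hi' - lo' \<le> hi - lo")
      case True
      have "t \<in> {lo - m..hi - m}" if "t \<in> {lo'..hi'}" for t
        using True that center by (auto simp: m_def field_simps)
      then have "?X = 0" by (subst nn_integral_0_iff_AE) (auto simp: memB memS)
      then show ?thesis using YZ by simp
    next
      case False
      have sub: "{lo - m..hi - m} \<subseteq> {lo'..hi'}"
        using False center by (auto simp: m_def field_simps)
      have fin: "{a..b::real} \<in> fmeasurable lborel" for a b
        by (intro fmeasurableI emeasure_compact_finite) auto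
      have len: "(\<integral>\<^sup>+t. indicator ({a..b} - {a'..b'}) t \<partial>lborel)
          = ennreal (measure lborel ({a..b} - {a'..b'}))" for a b a' b' :: real
        using emeasure_eq_measure2[OF fmeasurable.Diff[OF fin fin]] by simp
      have X: "?X = ennreal (measure lborel ({lo'..hi'} - {lo - m..hi - m}))"
        unfolding len[symmetric] by (intro nn_integral_cong) (auto simp: indicator_def memB memS)
      have Y: "?Y \<le> ennreal (measure lborel ({lo..hi} - {lo'..hi'}))"
        unfolding len[symmetric]
        by (rule order.trans[OF YK], intro nn_integral_mono) (auto simp: indicator_def memB memK)
      have Z: "?Z = ennreal (measure lborel ({lo'..hi'} - {lo..hi}))"
        unfolding len[symmetric] by (intro nn_integral_cong) (auto simp: indicator_def memB memK)
      have d: "measure lborel (C - D) = measure lborel C - measure lborel (C \<inter> D)"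
        if "C \<in> fmeasurable lborel" "D \<in> fmeasurable lborel" for C D :: "real set"
        using that by (rule measure_Diff_Int)
      have "measure lborel ({lo'..hi'} - {lo - m..hi - m}) = (hi' - lo') - (hi - lo)"
        using d[OF fin fin, of lo' hi' "lo - m" "hi - m"] sub both(1,3) by (simp add: Int_absorb1)
      moreover have "measure lborel ({lo..hi} - {lo'..hi'}) = (hi - lo) - measure lborel ({lo..hi} \<inter> {lo'..hi'})"
        using d[OF fin fin, of lo hi lo' hi'] both(1) by simp
      moreover have "measure lborel ({lo'..hi'} - {lo..hi}) = (hi' - lo') - measure lborel ({lo..hi} \<inter> {lo'..hi'})"
        using d[OF fin fin, of lo' hi' lo hi] both(3) by (simp add: Int_commute)
      ultimately have "?Z = ennreal (measure lborel ({lo'..hi'} - {lo - m..hi - m}) + measure lborel ({lo..hi} - {lo'..hi'}))"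
        unfolding Z by simp
      then show ?thesis unfolding X using Y by (simp add: ennreal_plus add_left_mono)
    qed
  qed
  then show ?thesis unfolding split .
qed

text \<open>Integrating the overlap of \<open>B - K\<close> with the translates of \<open>K - B\<close> over all translations gives the
  product of their volumes, so some translation \<open>z\<close> achieves at least the average. Its
  direction is a good direction for symmetrization.\<close>

lemma steiner_decreases_deficit:
  fixes K :: "'a::euclidean_space set" and r R :: real
  assumes K: "compact K" "convex K" and KR: "K \<subseteq> cball 0 R" and R: "0 < R" "0 \<le> r"
  defines "B \<equiv> cball (0::'a) r"
  assumes vol: "measure lborel K = measure lborel B" and pos: "0 < measure lborel (B - K)"
  obtains v where "norm v = 1" "measure lborel (B - steiner v K)
    \<le> measure lborel (B - K) - (measure lborel (B - K))\<^sup>2 / (2 * measure lborel (cball (0::'a) (R + r)))"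
proof -
  have bor [measurable]: "K \<in> sets borel" "B \<in> sets borel"
    using K by (auto intro: borel_compact simp: B_def)
  have finK: "K \<in> fmeasurable lborel" and finB: "B \<in> fmeasurable lborel"
    using bor K emeasure_compact_finite[OF K(1)] emeasure_compact_finite[of B]
    by (auto simp: fmeasurable_def B_def)
  define m where "m = measure lborel (B - K)"
  define Vc where "Vc = measure lborel (cball (0::'a) (R + r))"
  have Vc: "0 < Vc" "emeasure lborel (cball (0::'a) (R + r)) = ennreal Vc"
    unfolding Vc_def using R emeasure_lborel_cball_finite[of "0::'a" "R + r"]
    by (auto simp: content_cball_pos intro!: emeasure_eq_ennreal_measure)
  have mK: "measure lborel (K - B) = m"
    unfolding m_def measure_Diff_Int[OF finK finB] measure_Diff_Int[OF finB finK]
    using vol by (simp add: Int_commute)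
  have eB: "emeasure lborel (B - K) = ennreal m" and eK: "emeasure lborel (K - B) = ennreal m"
    using emeasure_eq_measure2[OF fmeasurable.Diff[OF finB finK]]
      emeasure_eq_measure2[OF fmeasurable.Diff[OF finK finB]] mK by (auto simp: m_def)
  define f where "f z = (\<integral>\<^sup>+x. indicator (K - B) x * indicator (B - K) (x + z) \<partial>lborel)" for z :: 'a
  have [measurable]: "f \<in> borel_measurable borel" unfolding f_def by measurable
  have "(\<integral>\<^sup>+z. f z \<partial>lborel) = (\<integral>\<^sup>+x. (\<integral>\<^sup>+z. indicator (K - B) x * indicator (B - K) (x + z) \<partial>lborel) \<partial>lborel)"
    unfolding f_def by (rule lborel_pair.Fubini') measurable
  also have "\<dots> = (\<integral>\<^sup>+x. indicator (K - B) x * ennreal m \<partial>lborel)"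
  proof (rule nn_integral_cong)
    fix x
    have "(\<integral>\<^sup>+z. indicator (B - K) (x + z) \<partial>lborel) = ennreal m"
      using nn_integral_lborel_shift[of "indicator (B - K)" x] eB by (simp add: add.commute)
    then show "(\<integral>\<^sup>+z. indicator (K - B) x * indicator (B - K) (x + z) \<partial>lborel) = indicator (K - B) x * ennreal m"
      by (simp add: nn_integral_cmult)
  qed
  also have "\<dots> = ennreal (m\<^sup>2)"
    using pos by (simp add: nn_integral_multc eK m_def ennreal_mult[symmetric] power2_eq_square)
  finally have intf: "(\<integral>\<^sup>+z. f z \<partial>lborel) = ennreal (m\<^sup>2)" .
  have supp: "f z = 0" if "z \<notin> cball 0 (R + r)" for z
  proof -
    have "indicator (K - B) x * indicator (B - K) (x + z) = (0::ennreal)" for x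
    proof (rule ccontr)
      assume "\<not> ?thesis"
      then have "x \<in> K" "x + z \<in> B" by (auto simp: indicator_def split: if_splits)
      then have "norm x \<le> R" "norm (x + z) \<le> r" using KR by (auto simp: B_def)
      then have "norm z \<le> R + r" using norm_triangle_ineq4[of "x + z" x] by simp
      with that show False by simp
    qed
    then have "f z = (\<integral>\<^sup>+x. 0 \<partial>(lborel :: 'a measure))" unfolding f_def by (intro nn_integral_cong) blast
    then show ?thesis by simp
  qed
  have "\<exists>z. ennreal (m\<^sup>2 / (2 * Vc)) < f z"
  proof (rule ccontr)
    assume neg: "\<not> ?thesis"
    have "f z \<le> ennreal (m\<^sup>2 / (2 * Vc)) * indicator (cball 0 (R + r)) z" for z
      using neg supp[of z] by (auto simp: indicator_def not_less)
    then have "(\<integral>\<^sup>+z. f z \<partial>lborel) \<le> (\<integral>\<^sup>+z. ennreal (m\<^sup>2 / (2 * Vc)) * indicator (cball (0::'a) (R + r)) z \<partial>lborel)"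
      by (intro nn_integral_mono) blast
    also have "\<dots> = ennreal (m\<^sup>2 / 2)"
      using Vc by (subst nn_integral_cmult_indicator) (simp_all add: ennreal_mult[symmetric])
    finally have "m\<^sup>2 \<le> m\<^sup>2 / 2" unfolding intf using pos by (simp add: ennreal_le_iff)
    then show False using pos by (simp add: m_def)
  qed
  then obtain z where z: "ennreal (m\<^sup>2 / (2 * Vc)) < f z" by blast
  have "f 0 = 0" unfolding f_def by (subst nn_integral_0_iff_AE) (auto simp: indicator_def)
  then have z0: "z \<noteq> 0" using z by auto
  define v where "v = z /\<^sub>R norm z"
  have v: "norm v = 1" and zv: "z = norm z *\<^sub>R v" using z0 by (auto simp: v_def)
  have [measurable]: "steiner v K \<in> sets borel" using K compact_steiner by (auto intro: borel_compact)
  have finS: "B - steiner v K \<in> fmeasurable lborel"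
    using finB by (intro fmeasurable_Diff) auto
  have "(\<integral>\<^sup>+x. indicator (B - steiner v K) x + indicator (K - B) x * indicator (B - K) (x + z) \<partial>lborel)
      \<le> (\<integral>\<^sup>+x. indicator (B - K) x \<partial>lborel)"
  proof (rule nn_integral_slab_mono[OF _ _ v])
    show "(\<integral>\<^sup>+t. indicator (B - steiner v K) (x + t *\<^sub>R v)
        + indicator (K - B) (x + t *\<^sub>R v) * indicator (B - K) (x + t *\<^sub>R v + z) \<partial>lborel)
      \<le> (\<integral>\<^sup>+t. indicator (B - K) (x + t *\<^sub>R v) \<partial>lborel)" for x
      unfolding B_def by (subst zv, subst zv, rule steiner_chord_gain[OF K v])
  qed measurable
  moreover have "(\<integral>\<^sup>+x. indicator (B - steiner v K) x + indicator (K - B) x * indicator (B - K) (x + z) \<partial>lborel)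
      = emeasure lborel (B - steiner v K) + f z"
    unfolding f_def by (subst nn_integral_add) auto
  ultimately have "emeasure lborel (B - steiner v K) + f z \<le> ennreal m" using eB by simp
  then have "emeasure lborel (B - steiner v K) + ennreal (m\<^sup>2 / (2 * Vc)) \<le> ennreal m"
    using z by (meson add_left_mono less_imp_le order.trans)
  then have "measure lborel (B - steiner v K) + m\<^sup>2 / (2 * Vc) \<le> m"
    using emeasure_eq_measure2[OF finS] pos Vc(1)
    by (simp add: m_def ennreal_plus[symmetric] ennreal_le_iff del: ennreal_plus)
  then show ?thesis using that[OF v] by (simp add: m_def Vc_def)
qed

text \<open>The gain of a symmetrization is bounded below as long as the deficit is, so a positive infimum
  of the deficit over the bodies of the same volume with \<open>\<Phi> L \<le> \<Phi> K\<close> in a fixed ball would be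
  undercut.\<close>

lemma steiner_approaches_ball:
  fixes K :: "'a::euclidean_space set"
  assumes K: "solid K" and r: "0 \<le> r" and vol: "measure lborel K = measure lborel (cball (0::'a) r)"
    and mono: "\<And>K v. solid K \<Longrightarrow> norm v = 1 \<Longrightarrow> \<Phi> (steiner v K) \<le> (\<Phi> K :: real)" and e: "0 < e"
  obtains L where "solid L" "\<Phi> L \<le> \<Phi> K" "measure lborel (cball 0 r - L) < e"
proof -
  let ?B = "cball (0::'a) r"
  obtain R where R: "0 < R" "K \<subseteq> cball 0 R"
    using solidD(6)[OF K] unfolding bounded_pos by (auto simp: subset_iff)
  define \<C> where "\<C> = {L. solid L \<and> measure lborel L = measure lborel ?B \<and> L \<subseteq> cball 0 R \<and> \<Phi> L \<le> \<Phi> K}"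
  have KC: "K \<in> \<C>" using K R vol by (simp add: \<C>_def)
  have step: "steiner v L \<in> \<C>" if "L \<in> \<C>" "norm v = 1" for L v
  proof -
    have L: "solid L" using that(1) by (simp add: \<C>_def)
    have "measure lborel (steiner v L) = measure lborel L"
      using emeasure_steiner[OF solidD(1,2)[OF L] that(2)] by (simp add: measure_def)
    then show ?thesis
      using that solid_steiner[OF L that(2)] steiner_cball_subset[OF that(2), of L R] mono[OF L that(2)]
      by (auto simp: \<C>_def)
  qed
  define q where "q L = measure lborel (?B - L)" for L
  have q0: "0 \<le> q L" for L by (simp add: q_def)
  have bdd: "bdd_below (q ` \<C>)" using q0 by (intro bdd_belowI[of _ 0]) auto
  define Vc where "Vc = measure lborel (cball (0::'a) (R + r))"
  have Vc: "0 < Vc" unfolding Vc_def using R r by (intro content_cball_pos) auto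
  have "\<exists>L\<in>\<C>. q L < e"
  proof (rule ccontr)
    assume neg: "\<not> ?thesis"
    define i where "i = Inf (q ` \<C>)"
    have ie: "e \<le> i" unfolding i_def using neg KC by (intro cInf_greatest) auto
    have "i < i + e\<^sup>2 / (2 * Vc)" using e Vc by simp
    then obtain L where L: "L \<in> \<C>" "q L < i + e\<^sup>2 / (2 * Vc)"
      using cInf_lessD[of "q ` \<C>" "i + e\<^sup>2 / (2 * Vc)"] KC unfolding i_def by auto
    have qL: "e \<le> q L" using neg L(1) by auto
    have sL: "solid L" "L \<subseteq> cball 0 R" "measure lborel L = measure lborel ?B" using L(1) by (auto simp: \<C>_def)
    have "0 < measure lborel (?B - L)" using qL e by (simp add: q_def)
    then obtain v where v: "norm v = 1" "q (steiner v L) \<le> q L - (q L)\<^sup>2 / (2 * Vc)"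
      using steiner_decreases_deficit[OF solidD(1,2)[OF sL(1)] sL(2) R(1) r sL(3)]
      unfolding q_def Vc_def by metis
    have "e\<^sup>2 / (2 * Vc) \<le> (q L)\<^sup>2 / (2 * Vc)"
      using qL e Vc by (intro divide_right_mono power_mono) auto
    then have "q (steiner v L) < i" using v(2) L(2) by linarith
    moreover have "i \<le> q (steiner v L)"
      unfolding i_def using step[OF L(1) v(1)] bdd by (intro cInf_lower) auto
    ultimately show False by simp
  qed
  then show ?thesis using that by (auto simp: \<C>_def q_def)
qed

section \<open>The ball minimizes the volume of the centroid body\<close>

context asym_exponent
begin

lemma phi_le: "\<phi> t \<le> (c + d) * \<bar>t\<bar> powr p"
proof -
  have "c * max 0 t powr p \<le> c * \<bar>t\<bar> powr p" "d * max 0 (- t) powr p \<le> d * \<bar>t\<bar> powr p"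
    using c0 d0 p1 by (auto intro!: mult_left_mono powr_mono2)
  then show ?thesis by (simp add: asym_pow_def algebra_simps)
qed

text \<open>The integrand is bounded on the ball, so the part of the ball that \<open>L\<close> misses contributes at most
  a multiple of its volume.\<close>

lemma moment_deficit:
  fixes L :: "'a::euclidean_space set"
  assumes L: "compact L" and r: "0 \<le> r"
  shows "moment (cball 0 r) u
    \<le> moment L u + (c + d) * r powr p * norm u powr p * measure lborel (cball 0 r - L)"
proof -
  let ?B = "cball (0::'a) r"
  define k where "k = (c + d) * r powr p * norm u powr p"
  have [measurable]: "L \<in> sets borel" using L by (rule borel_compact)
  have k: "0 \<le> k" using cd by (simp add: k_def)
  have fin: "?B - L \<in> fmeasurable lborel"
    by (intro fmeasurable_Diff fmeasurableI emeasure_lborel_cball_finite) auto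
  have bound: "\<phi> (u \<bullet> x) \<le> k" if "x \<in> ?B" for x
  proof -
    have "\<bar>u \<bullet> x\<bar> \<le> norm u * r"
      using Cauchy_Schwarz_ineq2[of u x] that by (smt (verit) mem_cball_0 mult_left_mono norm_ge_zero)
    then have "\<bar>u \<bullet> x\<bar> powr p \<le> (norm u * r) powr p" using p1 by (intro powr_mono2) auto
    then have "(c + d) * \<bar>u \<bullet> x\<bar> powr p \<le> (c + d) * (norm u * r) powr p" using cd by simp
    then show ?thesis using phi_le[of "u \<bullet> x"] r by (simp add: k_def powr_mult mult_ac)
  qed
  have "ennreal (moment ?B u) \<le> (\<integral>\<^sup>+x. indicator L x * ennreal (\<phi> (u \<bullet> x)) + ennreal k * indicator (?B - L) x \<partial>lborel)"
    unfolding moment_nn_integral[OF compact_cball]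
  proof (rule nn_integral_mono)
    fix x :: 'a
    have "ennreal (\<phi> (u \<bullet> x)) \<le> ennreal k" if "x \<in> ?B" using bound[OF that] by (rule ennreal_leI)
    then show "indicator ?B x * ennreal (\<phi> (u \<bullet> x))
        \<le> indicator L x * ennreal (\<phi> (u \<bullet> x)) + ennreal k * indicator (?B - L) x"
      by (cases "x \<in> ?B"; cases "x \<in> L") simp_all
  qed
  also have "\<dots> = ennreal (moment L u) + ennreal k * emeasure lborel (?B - L)"
  proof -
    have "(\<integral>\<^sup>+x. ennreal k * indicator (?B - L) x \<partial>lborel) = ennreal k * emeasure lborel (?B - L)"
      by (rule nn_integral_cmult_indicator) (use \<open>L \<in> sets borel\<close> in auto)
    moreover have "(\<integral>\<^sup>+x. indicator L x * ennreal (\<phi> (u \<bullet> x)) + ennreal k * indicator (?B - L) x \<partial>lborel)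
        = (\<integral>\<^sup>+x. indicator L x * ennreal (\<phi> (u \<bullet> x)) \<partial>lborel) + (\<integral>\<^sup>+x. ennreal k * indicator (?B - L) x \<partial>lborel)"
    proof (rule nn_integral_add)
      show "(\<lambda>x. ennreal k * indicator (?B - L) x) \<in> borel_measurable lborel"
        using \<open>L \<in> sets borel\<close> by (intro borel_measurable_times_ennreal borel_measurable_indicator) auto
    qed measurable
    ultimately show ?thesis unfolding moment_nn_integral[OF L] by simp
  qed
  also have "\<dots> = ennreal (moment L u + k * measure lborel (?B - L))"
    using k moment_nonneg[of L u] emeasure_eq_measure2[OF fin]
    by (simp add: ennreal_mult[symmetric] ennreal_plus[symmetric] del: ennreal_plus)
  finally show ?thesis
    unfolding k_def[symmetric]
    using k moment_nonneg[of L u] by (subst (asm) ennreal_le_iff) auto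
qed

text \<open>Since the norm is positive and homogeneous, a norm that is almost as large as that of the ball
  means a body that contains the centroid body of the ball shrunk by a factor \<open>s\<close> close to one.\<close>

theorem measure_centroid_body_ball_le:
  fixes K :: "'a::euclidean_space set"
  assumes K: "solid K" and r: "0 < r" and vol: "measure lborel K = measure lborel (cball (0::'a) r)"
  shows "measure lborel (centroid_body (cball (0::'a) r)) \<le> measure lborel (centroid_body K)"
proof (rule field_le_mult_one_interval)
  fix q :: real assume q: "0 < q" "q < 1"
  let ?B = "cball (0::'a) r"
  have B: "solid ?B" using r by (intro solidI_cball[of _ r]) auto
  define s where "s = root DIM('a) q"
  have s: "0 < s" "s < 1" "s ^ DIM('a) = q"
    using q by (auto simp: s_def real_root_gt_zero)
  obtain k where k: "0 < k" "\<And>K u. compact K \<Longrightarrow> cball (0::'a) r \<subseteq> K \<Longrightarrow> k * norm u powr p \<le> moment K u"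
    by (rule moment_lower_bound[OF r, where 'a='a]) blast
  define e where "e = (1 - s powr p) * k / ((c + d) * r powr p)"
  have sp: "s powr p < 1" using s p1 powr_less_mono2[of p s 1] by simp
  have e: "0 < e" using sp k cd r by (simp add: e_def)
  obtain L where L: "solid L" "measure lborel (centroid_body L) \<le> measure lborel (centroid_body K)"
    "measure lborel (?B - L) < e"
    using steiner_approaches_ball[OF K less_imp_le[OF r] vol, of "\<lambda>K. measure lborel (centroid_body K)" e]
      measure_centroid_body_steiner e by metis
  have gauge: "s * gauge_norm ?B u \<le> gauge_norm L u" for u
  proof -
    have "(c + d) * r powr p * norm u powr p * measure lborel (?B - L)
       \<le> (c + d) * r powr p * norm u powr p * e"
      using L(3) cd by (intro mult_left_mono) auto
    also have "\<dots> = (1 - s powr p) * (k * norm u powr p)"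
      using cd r by (simp add: e_def)
    also have "\<dots> \<le> (1 - s powr p) * moment ?B u"
      using sp k(2)[of ?B u] by (intro mult_left_mono) auto
    finally have "s powr p * moment ?B u \<le> moment L u"
      using moment_deficit[OF solidD(1)[OF L(1)] less_imp_le[OF r], of u] by (simp add: left_diff_distrib)
    then have "(s powr p * moment ?B u) powr (1 / p) \<le> gauge_norm L u"
      unfolding gauge_norm_def using p1 moment_nonneg[of ?B u] by (intro powr_mono2) auto
    then show ?thesis
      using s p1 moment_nonneg by (simp add: gauge_norm_def powr_mult powr_powr)
  qed
  have sub: "(*\<^sub>R) s ` centroid_body ?B \<subseteq> centroid_body L"
  proof clarify
    fix y assume y: "y \<in> centroid_body ?B"
    have "u \<bullet> (s *\<^sub>R y) \<le> gauge_norm L u" for u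
    proof -
      have "u \<bullet> (s *\<^sub>R y) \<le> s * gauge_norm ?B u"
        using mult_left_mono[OF centroid_body_le[OF y, of u], of s] s by simp
      also have "\<dots> \<le> gauge_norm L u" by (rule gauge)
      finally show ?thesis .
    qed
    then show "s *\<^sub>R y \<in> centroid_body L" by (simp add: centroid_body_def)
  qed
  have compact: "compact ((*\<^sub>R) s ` centroid_body ?B)" "compact (centroid_body L)"
    using solidD(1)[OF solid_centroid_body] B L(1) by (auto intro: compact_scaling)
  have "q * measure lborel (centroid_body ?B) = measure lborel ((*\<^sub>R) s ` centroid_body ?B)"
    using measure_scaleR_image[OF s(1) solidD(1)[OF solid_centroid_body[OF B]]] s(3) by simp
  also have "\<dots> \<le> measure lborel (centroid_body L)"
    using sub compact emeasure_compact_finite[OF compact(2)]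
    by (intro measure_mono_fmeasurable fmeasurableI) (auto intro: borel_compact)
  also have "\<dots> \<le> measure lborel (centroid_body K)" by (rule L(2))
  finally show "q * measure lborel (centroid_body ?B) \<le> measure lborel (centroid_body K)" .
qed

end

section \<open>The case of equality\<close>

lemma solid_closure_interior:
  assumes "solid B" "x \<in> B" shows "x \<in> closure (interior B)"
proof -
  have "closure (interior B) = closure B"
    using convex_closure_interior[OF solidD(2)[OF assms(1)]] solidD(3)[OF assms(1)] by blast
  then show ?thesis using assms(2) closure_subset by blast
qed

text \<open>Near a point of \<open>B\<close> outside the closed set \<open>A\<close> there are interior points of \<open>B\<close>, hence an open
  set of positive measure between \<open>A\<close> and \<open>B\<close>.\<close>

lemma compact_eq_if_measure_eq:
  assumes A: "compact A" and B: "solid B" and sub: "A \<subseteq> B"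
    and eq: "measure lborel A = measure lborel B"
  shows "A = B"
proof (rule ccontr)
  assume "A \<noteq> B"
  then obtain x where x: "x \<in> B" "x \<notin> A" using sub by blast
  define W where "W = interior B - A"
  have "open W" unfolding W_def using compact_imp_closed[OF A] by (intro open_Diff) auto
  moreover have "W \<noteq> {}"
    using solid_closure_interior[OF B x(1)] compact_imp_closed[OF A] x
      open_Int_closure_eq_empty[of "- A" "interior B"] by (auto simp: W_def open_Compl)
  moreover have "measure lborel (B - A) = 0"
    using A B sub eq measurable_measure_Diff[of B lborel A] solidD(4)[OF B] borel_compact[OF A]
      emeasure_compact_finite[OF solidD(1)[OF B]] by (auto simp: fmeasurable_def)
  then have "AE y in lborel. y \<notin> B - A"
  proof -
    have "B - A \<in> fmeasurable lborel"
      using solidD(4)[OF B] borel_compact[OF A] emeasure_compact_finite[OF solidD(1)[OF B]]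
      by (intro fmeasurable_Diff fmeasurableI) auto
    then have "emeasure lborel (B - A) = 0"
      using \<open>measure lborel (B - A) = 0\<close> emeasure_eq_measure2 by (metis ennreal_0)
    then show ?thesis
      using solidD(4)[OF B] borel_compact[OF A] by (intro AE_not_in) (auto simp: null_sets_def)
  qed
  ultimately obtain y where "y \<in> W" "y \<notin> B - A" using AE_meets_open by metis
  then show False using interior_subset by (auto simp: W_def)
qed

lemma convex_le_closure_interior:
  assumes B: "solid B" and le: "\<And>x. x \<in> interior B \<Longrightarrow> n \<bullet> x \<le> \<beta>" and x: "x \<in> B"
  shows "n \<bullet> x \<le> \<beta>"
proof -
  have "closure (interior B) \<subseteq> {x. n \<bullet> x \<le> \<beta>}"
    using le by (intro closure_minimal closed_halfspace_le) auto
  then show ?thesis using solid_closure_interior[OF B x] by blast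
qed

context asym_exponent
begin

text \<open>The ray from a contact point \<open>a\<close> of \<open>N\<close> into the direction \<open>-v\<close> enters the interior:
  otherwise a hyperplane separating the ray from the interior would support the body at \<open>a\<close> with a
  normal that is not a multiple of \<open>N\<close>. At the other end of the chord a supporting hyperplane is
  then not parallel to \<open>v\<close>.\<close>

lemma opposite_normal:
  fixes K :: "'a::euclidean_space set"
  assumes K: "solid K" and Nv: "N \<bullet> v = 1"
  obtains a b \<tau> N2 where "a \<in> centroid_body K" "b \<in> centroid_body K" "a = b + \<tau> *\<^sub>R v"
    "N \<bullet> a = gauge_norm K N" "N2 \<bullet> b = gauge_norm K N2" "N2 \<bullet> v = - 1"
proof -
  let ?M = "centroid_body K"
  have solM: "solid ?M" by (rule solid_centroid_body[OF K])
  note M = solidD[OF solM]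
  have v0: "v \<noteq> 0" and N0: "N \<noteq> 0" using Nv by auto
  have normal: "gauge_norm K n = n \<bullet> z" if "z \<in> ?M" "\<And>x. x \<in> ?M \<Longrightarrow> n \<bullet> x \<le> n \<bullet> z" for n z
  proof -
    obtain w where "w \<in> ?M" "n \<bullet> w = gauge_norm K n" by (rule centroid_body_attained[OF K])
    then show ?thesis using that(2)[of w] centroid_body_le[OF that(1), of n] by simp
  qed
  obtain a where a: "a \<in> ?M" "N \<bullet> a = gauge_norm K N" by (rule centroid_body_attained[OF K])
  define R where "R = (\<lambda>t. a - t *\<^sub>R v) ` {0<..}"
  have "R \<inter> interior ?M \<noteq> {}"
  proof
    assume disj: "R \<inter> interior ?M = {}"
    have "convex R"
    proof -
      have "R = (+) a ` ((\<lambda>t. t *\<^sub>R (- v)) ` {0<..})" by (auto simp: R_def image_image)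
      then show ?thesis
        by (simp only:) (intro convex_translation convex_linear_image linearI; simp add: algebra_simps)
    qed
    moreover have "R \<noteq> {}" by (auto simp: R_def)
    moreover have "convex (interior ?M)" "interior ?M \<noteq> {}" using M by auto
    ultimately obtain n \<beta> where n: "n \<noteq> 0" "\<And>x. x \<in> interior ?M \<Longrightarrow> n \<bullet> x \<le> \<beta>" "\<And>x. x \<in> R \<Longrightarrow> \<beta> \<le> n \<bullet> x"
      using separating_hyperplane_sets[of "interior ?M" R] disj by (metis Int_commute)
    have le: "n \<bullet> x \<le> \<beta>" if "x \<in> ?M" for x using convex_le_closure_interior[OF solM n(2) that] .
    have ray: "\<beta> \<le> n \<bullet> a - t * (n \<bullet> v)" if "0 < t" for t
      using n(3)[of "a - t *\<^sub>R v"] that by (auto simp: R_def inner_diff_right)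
    have nv: "n \<bullet> v \<le> 0" using ray[of 1] le[OF a(1)] by simp
    have "\<beta> \<le> n \<bullet> a"
    proof (rule field_le_epsilon)
      fix e :: real assume e: "0 < e"
      define t where "t = e / (1 - n \<bullet> v)"
      have t: "0 < t" "- t * (n \<bullet> v) \<le> e" using e nv by (auto simp: t_def field_simps)
      show "\<beta> \<le> n \<bullet> a + e" using ray[OF t(1)] t(2) by simp
    qed
    then have "n \<bullet> a = \<beta>" using le[OF a(1)] by simp
    then have gn: "gauge_norm K n = n \<bullet> a" using a(1) le by (intro normal) auto
    have "gauge_norm K (N + n) = gauge_norm K N + gauge_norm K n"
    proof (rule antisym[OF gauge_add[OF K]])
      show "gauge_norm K N + gauge_norm K n \<le> gauge_norm K (N + n)"
        using centroid_body_le[OF a(1), of "N + n"] a(2) gn by (simp add: inner_add_left)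
    qed
    then have "gauge_norm K n *\<^sub>R N = gauge_norm K N *\<^sub>R n"
      by (rule gauge_add_eqD[OF K N0 n(1)])
    then have "(gauge_norm K n *\<^sub>R N) \<bullet> v = (gauge_norm K N *\<^sub>R n) \<bullet> v" by simp
    then have "gauge_norm K n = gauge_norm K N * (n \<bullet> v)" using Nv by simp
    moreover have "gauge_norm K N * (n \<bullet> v) \<le> 0" using nv by (intro mult_nonneg_nonpos) auto
    ultimately show False using gauge_pos[OF K n(1)] by simp
  qed
  then obtain \<delta> where y: "a - \<delta> *\<^sub>R v \<in> interior ?M" by (auto simp: R_def)
  define y where "y = a - \<delta> *\<^sub>R v"
  have yM: "y \<in> interior ?M" "y \<in> ?M" using y interior_subset by (auto simp: y_def)
  have ch: "{t. y + t *\<^sub>R v \<in> ?M} \<noteq> {}" using yM by (auto intro!: exI[of _ 0])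
  obtain lo hi where lohi: "lo \<le> hi" "{t. y + t *\<^sub>R v \<in> ?M} = {lo..hi}"
    using chord_interval[OF M(1,2) v0, of y] ch by metis
  have mem: "y + t *\<^sub>R v \<in> ?M \<longleftrightarrow> t \<in> {lo..hi}" for t unfolding lohi(2)[symmetric] by simp
  have lo0: "lo \<le> 0" using mem[of 0] yM by auto
  define b where "b = y + lo *\<^sub>R v"
  have bM: "b \<in> ?M" using mem[of lo] lohi(1) by (simp add: b_def)
  have "b \<notin> interior ?M"
  proof
    assume "b \<in> interior ?M"
    then obtain e where e: "0 < e" "cball b e \<subseteq> ?M" unfolding mem_interior_cball by blast
    have "b - (e / norm v) *\<^sub>R v \<in> ?M" using e v0 by (intro subsetD[OF e(2)]) (auto simp: dist_norm)
    then have "lo - e / norm v \<in> {lo..hi}"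
      using mem[of "lo - e / norm v"] by (simp add: b_def algebra_simps)
    moreover have "0 < e / norm v" using e v0 by simp
    ultimately show False by simp
  qed
  then obtain n where n: "n \<noteq> 0" "\<And>x. x \<in> ?M \<Longrightarrow> n \<bullet> b \<le> n \<bullet> x" "\<And>x. x \<in> interior ?M \<Longrightarrow> n \<bullet> b < n \<bullet> x"
    using supporting_hyperplane_rel_boundary[OF M(2) bM] M(3) rel_interior_nonempty_interior[of ?M]
    by (metis empty_iff)
  have "n \<bullet> b < n \<bullet> y" using n(3) yM by blast
  then have "lo * (n \<bullet> v) < 0" by (simp add: b_def inner_add_right)
  then have nv: "0 < n \<bullet> v" using lo0 by (auto simp: mult_less_0_iff)
  define N2 where "N2 = (- 1 / (n \<bullet> v)) *\<^sub>R n"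
  have "gauge_norm K N2 = N2 \<bullet> b"
    using n(2) nv by (intro normal bM) (simp add: N2_def divide_right_mono)
  moreover have "N2 \<bullet> v = - 1" using nv by (simp add: N2_def)
  moreover have "a = b + (\<delta> - lo) *\<^sub>R v" by (simp add: b_def y_def algebra_simps)
  ultimately show ?thesis using that[OF a(1) bM _ a(2)] by metis
qed

text \<open>Equality of the volumes makes the centroid body of the symmetral equal to the symmetral of the
  centroid body, which contains the point obtained from the two ends \<open>a\<close> and \<open>b\<close> of a chord. At this point the
  combined functional takes the sum of the two norms, so the inequality for the norms is an equality.\<close>

lemma chord_midpoints:
  fixes K :: "'a::euclidean_space set"
  assumes K: "solid K" and v: "norm v = 1"
    and eq: "measure lborel (centroid_body (steiner v K)) = measure lborel (centroid_body K)"
    and Nv: "N \<bullet> v = 1"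
  obtains q where "q \<bullet> v = - 2"
    "AE x in lborel. \<forall>lo hi. {t. x + t *\<^sub>R v \<in> K} = {lo..hi} \<longrightarrow>
        (\<exists>t\<in>{lo<..<hi}. 0 < \<phi> (N \<bullet> (x + t *\<^sub>R v))) \<longrightarrow> lo + hi = q \<bullet> x"
proof -
  have vv: "v \<bullet> v = 1" using v by (simp add: dot_square_norm)
  note M = solidD[OF solid_centroid_body[OF K]]
  have "centroid_body (steiner v K) = steiner v (centroid_body K)"
  proof (rule compact_eq_if_measure_eq)
    show "compact (centroid_body (steiner v K))"
      using solidD(1)[OF solid_centroid_body[OF solid_steiner[OF K v]]] .
    show "measure lborel (centroid_body (steiner v K)) = measure lborel (steiner v (centroid_body K))"
      using eq emeasure_steiner[OF M(1,2) v] by (simp add: measure_def)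
  qed (intro solid_steiner solid_centroid_body K v centroid_body_steiner)+
  note sets_eq = this
  obtain a b \<tau> N2 where ab: "a \<in> centroid_body K" "b \<in> centroid_body K" "a = b + \<tau> *\<^sub>R v"
    "N \<bullet> a = gauge_norm K N" "N2 \<bullet> b = gauge_norm K N2" "N2 \<bullet> v = - 1"
    using opposite_normal[OF K Nv] by metis
  define z where "z = a - (((a + b) \<bullet> v) / 2) *\<^sub>R v"
  have "a - (a \<bullet> v) *\<^sub>R v = b - (b \<bullet> v) *\<^sub>R v"
    unfolding ab(3) by (simp add: inner_add_left vv algebra_simps)
  then have "z \<in> steiner v (centroid_body K)"
    unfolding steiner_def z_def using ab(1,2) by (intro image_eqI[of _ _ "(a, b)"]) auto
  then have z: "z \<in> centroid_body (steiner v K)" by (simp add: sets_eq)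
  let ?N = "N + N2 + (2 * (N \<bullet> v)) *\<^sub>R v"
  have "?N \<bullet> z = gauge_norm K N + gauge_norm K N2"
  proof -
    define \<mu> where "\<mu> = ((a + b) \<bullet> v) / 2"
    have ba: "b = a - \<tau> *\<^sub>R v" using ab(3) by simp
    have \<mu>: "\<mu> = a \<bullet> v - \<tau> / 2" unfolding \<mu>_def ba by (simp add: inner_add_left inner_diff_left vv field_simps)
    have "N2 \<bullet> a = gauge_norm K N2 - \<tau>" using ab(5,6) by (simp add: ba inner_diff_right)
    moreover have "?N \<bullet> z = N \<bullet> a - \<mu> + (N2 \<bullet> a + \<mu>) + 2 * (a \<bullet> v - \<mu>)"
      unfolding z_def \<mu>_def[symmetric] using Nv ab(6) inner_commute[of v a]
      by (simp add: inner_add_left inner_diff_right vv)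
    ultimately show ?thesis using ab(4) \<mu> by simp
  qed
  then have ge: "gauge_norm K N + gauge_norm K N2 \<le> gauge_norm (steiner v K) ?N"
    using centroid_body_le[OF z, of ?N] by simp
  have ne: "N \<noteq> 0" "N2 \<noteq> 0" using Nv ab(6) by auto
  have opp: "N2 \<bullet> v = - (N \<bullet> v)" using Nv ab(6) by simp
  have "gauge_norm (steiner v K) ?N = gauge_norm K N + gauge_norm K N2"
    using ge gauge_steiner_le[OF K v opp ne] by simp
  from gauge_steiner_eqD[OF K v opp ne this Nv] show ?thesis
    using that[of "N2 - N"] Nv ab(6) by (simp add: inner_diff_left)
qed

lemma chord_through_interior:
  assumes K: "solid (K :: 'a::euclidean_space set)" and v: "norm v = 1" and x: "cball x e \<subseteq> K" "0 < e"
  obtains lo hi where "{t. x + t *\<^sub>R v \<in> K} = {lo..hi}" "lo \<le> - e" "e \<le> hi"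
proof -
  have v0: "v \<noteq> 0" using v by auto
  have mem: "x + t *\<^sub>R v \<in> K" if "\<bar>t\<bar> \<le> e" for t
    using that v by (intro subsetD[OF x(1)]) (auto simp: dist_norm)
  then have ne: "{t. x + t *\<^sub>R v \<in> K} \<noteq> {}" using x(2) mem[of 0] by (auto intro!: exI[of _ 0])
  obtain lo hi where lohi: "lo \<le> hi" "{t. x + t *\<^sub>R v \<in> K} = {lo..hi}"
    using chord_interval[OF solidD(1,2)[OF K] v0, of x] ne by metis
  have "e \<in> {t. x + t *\<^sub>R v \<in> K}" "- e \<in> {t. x + t *\<^sub>R v \<in> K}" using mem[of e] mem[of "- e"] x(2) by auto
  then show ?thesis using that lohi(2) by auto
qed

text \<open>For a given \<open>N\<close> the midpoints are known only for chords on which \<open>N\<close> contributes. All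
  chords close to the origin are of this kind, so the hyperplane does not depend on \<open>N\<close>; and
  away from the line in direction \<open>v\<close> through the origin, \<open>N\<close> can be tilted so as to contribute at a given point.\<close>

theorem affine_reflection_of_equality:
  fixes K :: "'a::euclidean_space set"
  assumes K: "solid K" and v: "norm v = 1" and dim: "2 \<le> DIM('a)"
    and eq: "measure lborel (centroid_body (steiner v K)) = measure lborel (centroid_body K)"
  obtains q where "q \<bullet> v = - 2" "\<And>x. x \<in> K \<Longrightarrow> x + (q \<bullet> x) *\<^sub>R v \<in> K"
proof -
  have vv: "v \<bullet> v = 1" using v by (simp add: dot_square_norm)
  define s :: real where "s = (if 0 < c then 1 else - 1)"
  have s: "\<bar>s\<bar> = 1" by (simp add: s_def)
  have phi_pos: "0 < \<phi> t" if "0 < s * t" for t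
    using that cd c0 by (auto simp: asym_pow_pos_iff[OF c0 d0] s_def split: if_splits)
  let ?mid = "\<lambda>N q x. \<forall>lo hi. {t. x + t *\<^sub>R v \<in> K} = {lo..hi} \<longrightarrow>
        (\<exists>t\<in>{lo<..<hi}. 0 < \<phi> (N \<bullet> (x + t *\<^sub>R v))) \<longrightarrow> lo + hi = q \<bullet> x"
  obtain q where q: "q \<bullet> v = - 2" "AE x in lborel. ?mid v q x"
    using chord_midpoints[OF K v eq vv] by blast
  obtain e where e: "0 < e" "cball 0 e \<subseteq> K" by (rule solid_contains_cball[OF K])
  have mid: "AE x in lborel. ?mid N q x" if Nv: "N \<bullet> v = 1" for N
  proof -
    obtain q' where q': "q' \<bullet> v = - 2" "AE x in lborel. ?mid N q' x"
      using chord_midpoints[OF K v eq Nv] by blast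
    define \<eta> where "\<eta> = e / (4 * (norm N + 2))"
    have \<eta>: "0 < \<eta>" "\<eta> * norm N < e / 4" "\<eta> < e / 4"
      using e(1) by (auto simp: \<eta>_def field_simps add_pos_nonneg)
    have "AE x in lborel. x \<in> ball 0 \<eta> \<longrightarrow> (q' - q) \<bullet> x = 0"
      using q(2) q'(2)
    proof eventually_elim
      case (elim x)
      show ?case
      proof
        assume "x \<in> ball 0 \<eta>"
        then have nx: "norm x < \<eta>" by simp
        have "cball x (e / 2) \<subseteq> K"
        proof
          fix y assume "y \<in> cball x (e / 2)"
          then have "norm y \<le> e" using nx \<eta>(3) e(1) norm_triangle_ineq[of x "y - x"] by (auto simp: dist_norm norm_minus_commute)
          then show "y \<in> K" using e(2) by auto
        qed
        then obtain lo hi where lohi: "{t. x + t *\<^sub>R v \<in> K} = {lo..hi}" "lo \<le> - (e / 2)" "e / 2 \<le> hi"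
          using chord_through_interior[OF K v, of x "e / 2"] e(1) by auto
        have t: "s * (e / 4) \<in> {lo<..<hi}" using lohi e(1) by (auto simp: s_def)
        have "0 < \<phi> (n \<bullet> (x + (s * (e / 4)) *\<^sub>R v))" if n: "n \<bullet> v = 1" "\<bar>n \<bullet> x\<bar> < e / 4" for n
        proof (rule phi_pos)
          have "s * (n \<bullet> (x + (s * (e / 4)) *\<^sub>R v)) = s * (n \<bullet> x) + e / 4"
            using n s by (simp add: inner_add_right s_def)
          moreover have "\<bar>s * (n \<bullet> x)\<bar> < e / 4" using n(2) s by (simp add: abs_mult)
          ultimately show "0 < s * (n \<bullet> (x + (s * (e / 4)) *\<^sub>R v))" by linarith
        qed
        moreover have "\<bar>v \<bullet> x\<bar> < e / 4" using Cauchy_Schwarz_ineq2[of v x] v nx \<eta>(3) by simp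
        moreover have "\<bar>N \<bullet> x\<bar> < e / 4"
        proof -
          have "norm N * norm x \<le> norm N * \<eta>" using nx by (intro mult_left_mono) auto
          then show ?thesis using Cauchy_Schwarz_ineq2[of N x] \<eta>(2) by (simp add: mult.commute)
        qed
        ultimately have "lo + hi = q \<bullet> x" "lo + hi = q' \<bullet> x"
          using elim lohi(1) t vv Nv by blast+
        then show "(q' - q) \<bullet> x = 0" by (simp add: inner_diff_left)
      qed
    qed
    then have "q' - q = 0" using \<eta>(1) by (intro inner_zero_on_open[of "ball 0 \<eta>"]) auto
    then show ?thesis using q'(2) by simp
  qed
  have "x + (q \<bullet> x) *\<^sub>R v \<in> K" if x: "x \<in> K" for x
  proof (rule ccontr)
    assume out: "x + (q \<bullet> x) *\<^sub>R v \<notin> K"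
    define U where "U = {x. x + (q \<bullet> x) *\<^sub>R v \<notin> K}"
    have "open U"
    proof -
      have "open ((\<lambda>x. x + (q \<bullet> x) *\<^sub>R v) -` (- K))"
        using solidD(7)[OF K] by (intro open_vimage open_Compl continuous_intros)
      then show ?thesis by (simp add: U_def vimage_def)
    qed
    define W0 where "W0 = U \<inter> interior K"
    have oW0: "open W0" unfolding W0_def using \<open>open U\<close> by (intro open_Int) auto
    have neW0: "W0 \<noteq> {}"
      using open_Int_closure_eq_empty[OF \<open>open U\<close>, of "interior K"] out
        solid_closure_interior[OF K x] by (auto simp: W0_def U_def)
    have "\<not> W0 \<subseteq> span {v}"
    proof
      assume "W0 \<subseteq> span {v}"
      then have "W0 \<subseteq> interior (span {v})" using oW0 by (simp add: interior_maximal)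
      moreover have "interior (span {v}) = {}"
        using dim dim_le_card'[of "{v}"] by (intro empty_interior_lowdim) (simp add: dim_span)
      ultimately show False using neW0 by simp
    qed
    then obtain x2 where x2: "x2 \<in> W0" "x2 \<notin> span {v}" by blast
    define P where "P = x2 - (x2 \<bullet> v) *\<^sub>R v"
    have P0: "P \<noteq> 0"
    proof
      assume "P = 0"
      then have "x2 = (x2 \<bullet> v) *\<^sub>R v" by (simp add: P_def)
      then show False using x2(2) by (metis singletonI span_base span_scale)
    qed
    have Pv: "P \<bullet> v = 0" by (simp add: P_def inner_diff_left vv)
    have Px: "P \<bullet> x2 = P \<bullet> P"
    proof -
      have "P \<bullet> P = P \<bullet> (x2 - (x2 \<bullet> v) *\<^sub>R v)" by (simp add: P_def)
      then show ?thesis by (simp add: inner_diff_right Pv)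
    qed
    define N where "N = v + ((s - v \<bullet> x2) / (P \<bullet> P)) *\<^sub>R P"
    have Nv: "N \<bullet> v = 1" by (simp add: N_def inner_add_left vv Pv)
    have Nx: "N \<bullet> x2 = s" using P0 by (simp add: N_def inner_add_left Px)
    define W where "W = W0 \<inter> {x. 0 < \<phi> (N \<bullet> x)}"
    have "0 < \<phi> (N \<bullet> x2)" unfolding Nx by (rule phi_pos) (simp add: s_def)
    then have "W \<noteq> {}" using x2 by (auto simp: W_def)
    moreover have "open W"
      unfolding W_def using oW0 by (intro open_Int open_Collect_less continuous_on_phi_inner) auto
    ultimately obtain y where y: "y \<in> W" "?mid N q y"
      using AE_meets_open[OF mid[OF Nv]] by blast
    have "y \<in> interior K" using y(1) by (simp add: W_def W0_def)
    then obtain e where e: "0 < e" "cball y e \<subseteq> K" unfolding mem_interior_cball by blast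
    obtain lo hi where lohi: "{t. y + t *\<^sub>R v \<in> K} = {lo..hi}" "lo \<le> - e" "e \<le> hi"
      by (rule chord_through_interior[OF K v e(2,1)])
    have "0 \<in> {lo<..<hi}" "0 < \<phi> (N \<bullet> (y + 0 *\<^sub>R v))" using lohi e(1) y(1) by (auto simp: W_def)
    then have "lo + hi = q \<bullet> y" using y(2) lohi(1) by blast
    moreover have "lo + hi \<in> {lo..hi}" using lohi e(1) by auto
    ultimately have "y + (q \<bullet> y) *\<^sub>R v \<in> K" unfolding lohi(1)[symmetric] by simp
    then show False using y(1) by (simp add: W_def W0_def U_def)
  qed
  then show ?thesis using that q(1) by blast
qed

end

section \<open>Bodies with affine reflections in all directions\<close>

text \<open>Gram-Schmidt orthogonalization.\<close>

lemma orthonormal_system_of_form: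
  fixes \<beta> :: "real ^ 'n \<Rightarrow> real ^ 'n \<Rightarrow> real"
  assumes sym: "\<And>u w. \<beta> u w = \<beta> w u" and lin: "\<And>w. linear (\<lambda>u. \<beta> u w)"
    and pos: "\<And>u. u \<noteq> 0 \<Longrightarrow> 0 < \<beta> u u"
  obtains w :: "'n \<Rightarrow> real ^ 'n" where "\<And>i j. \<beta> (w i) (w j) = (if i = j then 1 else 0)"
proof -
  have "\<exists>w. \<forall>i\<in>I. \<forall>j\<in>I. \<beta> (w i) (w j) = (if i = j then 1 else 0)" for I :: "'n set"
    using finite[of I]
  proof (induction I)
    case empty then show ?case by simp
  next
    case (insert k I)
    then obtain w where w: "\<And>i j. i \<in> I \<Longrightarrow> j \<in> I \<Longrightarrow> \<beta> (w i) (w j) = (if i = j then 1 else 0)" by blast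
    have "card (w ` I) < CARD('n)"
    proof -
      have "card (w ` I) \<le> card I" using insert.hyps(1) by (rule card_image_le)
      also have "\<dots> < card (insert k I)" using insert.hyps by simp
      also have "\<dots> \<le> CARD('n)" by (intro card_mono) auto
      finally show ?thesis .
    qed
    then have "span (w ` I) \<noteq> UNIV"
      using dim_le_card'[of "w ` I"] insert.hyps(1) by (metis DIM_cart DIM_real dim_UNIV dim_span finite_imageI mult.right_neutral not_less)
    then obtain x where x: "x \<notin> span (w ` I)" by blast
    define y where "y = x - (\<Sum>i\<in>I. \<beta> x (w i) *\<^sub>R w i)"
    have "(\<Sum>i\<in>I. \<beta> x (w i) *\<^sub>R w i) \<in> span (w ` I)" by (intro span_sum span_scale span_base) auto
    then have "y \<noteq> 0" using x by (auto simp: y_def)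
    then have yy: "0 < \<beta> y y" by (rule pos)
    have yw: "\<beta> y (w j) = 0" if "j \<in> I" for j
    proof -
      have "\<beta> y (w j) = \<beta> x (w j) - (\<Sum>i\<in>I. \<beta> x (w i) * \<beta> (w i) (w j))"
        unfolding y_def linear_diff[OF lin] linear_sum[OF lin] linear_scale[OF lin] by simp
      also have "(\<Sum>i\<in>I. \<beta> x (w i) * \<beta> (w i) (w j)) = (\<Sum>i\<in>I. if i = j then \<beta> x (w j) else 0)"
        using that by (intro sum.cong) (auto simp: w)
      also have "\<dots> = \<beta> x (w j)" using that insert.hyps(1) by simp
      finally show ?thesis by simp
    qed
    define w' where "w' = w(k := (1 / sqrt (\<beta> y y)) *\<^sub>R y)"
    have kk: "\<beta> ((1 / sqrt (\<beta> y y)) *\<^sub>R y) ((1 / sqrt (\<beta> y y)) *\<^sub>R y) = 1"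
    proof -
      have "\<beta> (s *\<^sub>R y) (s *\<^sub>R y) = s * s * \<beta> y y" for s
        using linear_scale[OF lin, of s y "s *\<^sub>R y"] sym[of y "s *\<^sub>R y"] linear_scale[OF lin, of s y y] by simp
      then show ?thesis using yy by simp
    qed
    have kj: "\<beta> (s *\<^sub>R y) (w j) = 0" if "j \<in> I" for j s
      using linear_scale[OF lin, of s y "w j"] yw[OF that] by simp
    have "\<beta> (w' i) (w' j) = (if i = j then 1 else 0)" if "i \<in> insert k I" "j \<in> insert k I" for i j
      using that insert.hyps(2) kk kj w sym[of "w i" "(1 / sqrt (\<beta> y y)) *\<^sub>R y"]
      by (cases "i = k"; cases "j = k") (auto simp: w'_def)
    then show ?case by blast
  qed
  from this[of UNIV] show ?thesis using that by auto
qed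

text \<open>The affine reflections preserve the second moments \<open>\<beta>(u, w) = \<integral>\<^sub>K (u\<cdot>x)(w\<cdot>x) dx\<close>, and this
  determines \<open>q\<close> from \<open>v\<close>: each of them is the orthogonal reflection with respect to the inner product
  dual to \<open>\<beta>\<close>. For any two points of the same norm in this inner product the one in the direction of
  their difference exchanges them, so the body is a ball for this norm.\<close>

theorem ellipsoid_of_affine_reflections:
  fixes K :: "(real ^ 'n) set"
  assumes K: "solid K"
    and refl: "\<And>v. norm v = 1 \<Longrightarrow> \<exists>q. q \<bullet> v = - 2 \<and> (\<forall>x\<in>K. x + (q \<bullet> x) *\<^sub>R v \<in> K)"
  shows "origin_ellipsoid K"
proof -
  note K' = solidD[OF K]
  have [measurable]: "K \<in> sets borel" by (rule K'(4))
  define \<beta> where "\<beta> u w = (LINT x:K|lborel. (u \<bullet> x) * (w \<bullet> x))" for u w :: "real ^ 'n"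
  have int: "set_integrable lborel K (\<lambda>x. (u \<bullet> x) * (w \<bullet> x))" for u w
    unfolding set_integrable_def using K'(1) by (intro borel_integrable_compact continuous_intros)
  have sym: "\<beta> u w = \<beta> w u" for u w unfolding \<beta>_def by (simp add: mult.commute)
  have lin: "linear (\<lambda>u. \<beta> u w)" for w
  proof (rule linearI)
    fix u u'
    have "\<beta> (u + u') w = (LINT x:K|lborel. (u \<bullet> x) * (w \<bullet> x) + (u' \<bullet> x) * (w \<bullet> x))"
      unfolding \<beta>_def by (simp add: inner_add_left distrib_right)
    also have "\<dots> = \<beta> u w + \<beta> u' w" unfolding \<beta>_def by (rule set_integral_add(2)[OF int int])
    finally show "\<beta> (u + u') w = \<beta> u w + \<beta> u' w" .
    show "\<beta> (s *\<^sub>R u) w = s *\<^sub>R \<beta> u w" for s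
      unfolding \<beta>_def by (simp add: mult.assoc)
  qed
  have expand: "\<beta> (u + w) (u + w) = \<beta> u u + 2 * \<beta> u w + \<beta> w w" for u w
    using linear_add[OF lin, of u w "u + w"] linear_add[OF lin, of u w u] linear_add[OF lin, of u w w]
      sym[of u "u + w"] sym[of w "u + w"] sym[of w u] by linarith
  have nn: "ennreal (\<beta> u u) = (\<integral>\<^sup>+x. indicator K x * ennreal ((u \<bullet> x)\<^sup>2) \<partial>lborel)" for u
  proof -
    have "(\<integral>\<^sup>+x. ennreal (indicator K x *\<^sub>R ((u \<bullet> x) * (u \<bullet> x))) \<partial>lborel) = ennreal (\<beta> u u)"
      unfolding \<beta>_def set_lebesgue_integral_def
      using int[of u u] unfolding set_integrable_def
      by (intro nn_integral_eq_integral) (auto simp: indicator_def)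
    moreover have "(\<integral>\<^sup>+x. ennreal (indicator K x *\<^sub>R ((u \<bullet> x) * (u \<bullet> x))) \<partial>lborel)
        = (\<integral>\<^sup>+x. indicator K x * ennreal ((u \<bullet> x)\<^sup>2) \<partial>lborel)"
      by (intro nn_integral_cong) (auto simp: indicator_def power2_eq_square)
    ultimately show ?thesis by simp
  qed
  have nonneg: "0 \<le> \<beta> u u" for u
    unfolding \<beta>_def set_lebesgue_integral_def
    by (intro integral_nonneg_AE) (auto simp: indicator_def)
  have pos: "0 < \<beta> u u" if u: "u \<noteq> 0" for u
  proof (rule ccontr)
    assume neg: "\<not> 0 < \<beta> u u"
    then have "(\<integral>\<^sup>+x. indicator K x * ennreal ((u \<bullet> x)\<^sup>2) \<partial>lborel) = 0" using nn[of u] nonneg[of u] neg by simp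
    then have "AE x in lborel. indicator K x * ennreal ((u \<bullet> x)\<^sup>2) = 0"
      by (subst (asm) nn_integral_0_iff_AE) measurable
    then have "AE x in lborel. x \<in> interior K \<longrightarrow> u \<bullet> x = 0"
    proof eventually_elim
      case (elim x)
      then show ?case using interior_subset[of K] by (auto simp: indicator_def ennreal_eq_0_iff split: if_splits)
    qed
    then have "u = 0" using K'(3) by (intro inner_zero_on_open[of "interior K"]) auto
    with u show False by simp
  qed
  obtain w :: "'n \<Rightarrow> real ^ 'n" where w: "\<And>i j. \<beta> (w i) (w j) = (if i = j then 1 else 0)"
    using orthonormal_system_of_form[of \<beta>] sym lin pos by metis
  define T where "T a = (\<Sum>i\<in>UNIV. a $ i *\<^sub>R w i)" for a :: "real ^ 'n"
  define L where "L x = (\<chi> i. w i \<bullet> x)" for x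
  have TL: "T a \<bullet> x = a \<bullet> L x" for a x
  proof -
    have "T a \<bullet> x = (\<Sum>i\<in>UNIV. a $ i * (w i \<bullet> x))" by (simp add: T_def inner_sum_left)
    also have "\<dots> = a \<bullet> L x" by (subst inner_vec_def) (simp add: L_def)
    finally show ?thesis .
  qed
  have linT: "linear T"
    unfolding T_def by (intro linearI) (simp_all add: scaleR_add_left sum.distrib scaleR_sum_right)
  have coef: "\<beta> (T a) (w j) = a $ j" for a j
  proof -
    have "\<beta> (T a) (w j) = (\<Sum>i\<in>UNIV. a $ i * \<beta> (w i) (w j))"
      unfolding T_def linear_sum[OF lin] linear_scale[OF lin] by simp
    also have "\<dots> = (\<Sum>i\<in>UNIV. if i = j then a $ j else 0)" by (intro sum.cong) (auto simp: w)
    finally show ?thesis by simp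
  qed
  have "inj T"
  proof (rule injI)
    fix a b assume "T a = T b"
    then have "a $ j = b $ j" for j using coef[of a j] coef[of b j] by simp
    then show "a = b" by (simp add: vec_eq_iff)
  qed
  then have surjT: "surj T" using linear_injective_imp_surjective[OF linT] by blast
  have linL: "linear L" unfolding L_def by (intro linearI) (simp_all add: vec_eq_iff inner_add_right)
  have L0: "x = 0" if "L x = 0" for x
  proof -
    obtain a where "x = T a" using surjT by (meson surjD)
    then have "x \<bullet> x = 0" using TL[of a x] that by simp
    then show ?thesis by simp
  qed
  then have injL: "inj L" using linL linear_injective_0 by blast

  \<comment> \<open>The transpose of the reflection fixes \<open>u\<close> and reverses \<open>q\<close>; since it preserves \<open>\<beta>\<close>, the
      two are orthogonal with respect to \<open>\<beta>\<close>.\<close>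
  have orth: "\<beta> u q = 0"
    if v: "norm v = 1" and q: "q \<bullet> v = - 2" "\<And>x. x \<in> K \<Longrightarrow> x + (q \<bullet> x) *\<^sub>R v \<in> K" and u: "u \<bullet> v = 0" for u v q
  proof -
    define \<rho> where "\<rho> x = x + (q \<bullet> x) *\<^sub>R v" for x
    have inv: "\<rho> (\<rho> x) = x" for x
      unfolding \<rho>_def by (simp add: inner_add_right q(1) algebra_simps flip: scaleR_add_left)
    have lin\<rho>: "linear \<rho>" unfolding \<rho>_def by (intro linearI) (auto simp: inner_add_right algebra_simps)
    have bij: "bij \<rho>" using inv by (intro o_bij[of \<rho>]) (auto simp: o_def)
    have \<rho>K: "\<rho> x \<in> K \<longleftrightarrow> x \<in> K" for x
      using q(2)[of x] q(2)[of "\<rho> x"] inv[of x] unfolding \<rho>_def[symmetric] by auto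
    then have ind: "indicator K (\<rho> x) = (indicator K x :: ennreal)" for x by (simp add: indicator_def)
    obtain \<delta> where \<delta>: "0 < \<delta>" "\<And>f. f \<in> borel_measurable borel \<Longrightarrow>
        (\<integral>\<^sup>+x. f (\<rho> x) \<partial>lborel) = ennreal \<delta> * (\<integral>\<^sup>+x. f x \<partial>lborel)"
      by (rule nn_integral_linear_change[OF lin\<rho> bij]) blast
    have "\<delta> = 1"
    proof -
      have fin: "K \<in> fmeasurable lborel"
        using K'(1,4) by (intro fmeasurableI emeasure_compact_finite) auto
      have volK: "0 < measure lborel K" by (rule measure_solid_pos[OF K])
      have "emeasure lborel K = ennreal \<delta> * emeasure lborel K"
        using \<delta>(2)[of "indicator K"] by (simp add: ind)
      then have "ennreal (measure lborel K) = ennreal (\<delta> * measure lborel K)"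
        unfolding emeasure_eq_measure2[OF fin] using \<delta>(1) by (simp add: ennreal_mult[symmetric])
      then have "measure lborel K = \<delta> * measure lborel K" using \<delta>(1) volK by (subst (asm) ennreal_inj) auto
      then show ?thesis using volK by simp
    qed
    have "(u - q) \<bullet> x = (u + q) \<bullet> \<rho> x" for x
      unfolding \<rho>_def by (simp add: inner_add_left inner_add_right inner_diff_left u q(1))
    then have "ennreal (\<beta> (u - q) (u - q)) = (\<integral>\<^sup>+x. indicator K (\<rho> x) * ennreal (((u + q) \<bullet> \<rho> x)\<^sup>2) \<partial>lborel)"
      unfolding nn by (simp add: ind)
    also have "\<dots> = ennreal (\<beta> (u + q) (u + q))"
      unfolding nn using \<delta>(2)[of "\<lambda>x. indicator K x * ennreal (((u + q) \<bullet> x)\<^sup>2)"] \<open>\<delta> = 1\<close> by simp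
    finally have "\<beta> (u - q) (u - q) = \<beta> (u + q) (u + q)"
      by (subst (asm) ennreal_inj) (auto simp: nonneg)
    moreover have "\<beta> (u + q) (u + q) = \<beta> u u + 2 * \<beta> u q + \<beta> q q"
      by (rule expand)
    moreover have "\<beta> (u - q) (u - q) = \<beta> u u - 2 * \<beta> u q + \<beta> q q"
      using expand[of u "- q"] linear_neg[OF lin, of q u] linear_neg[OF lin, of q "- q"]
        linear_neg[OF lin, of q q] sym[of u "- q"] sym[of u q] sym[of q "- q"] by simp
    ultimately show ?thesis by simp
  qed
  have exchange: "y \<in> K" if xK: "x \<in> K" and eq: "norm (L x) = norm (L y)" for x y
  proof (cases "x = y")
    case True then show ?thesis using xK by simp
  next
    case False
    define r where "r = norm (x - y)"
    have r: "0 < r" using False by (simp add: r_def)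
    define v where "v = (1 / r) *\<^sub>R (x - y)"
    have v: "norm v = 1" using r by (simp add: v_def r_def)
    have rv: "r *\<^sub>R v = x - y" using r by (simp add: v_def)
    obtain q where q: "q \<bullet> v = - 2" "\<And>x. x \<in> K \<Longrightarrow> x + (q \<bullet> x) *\<^sub>R v \<in> K" using refl[OF v] by blast
    obtain a where a: "q = T a" using surjT by (meson surjD)
    \<comment> \<open>The coordinates of \<open>q\<close> are proportional to those of \<open>L v\<close>.\<close>
    have proportional: "a $ i * L v $ j = a $ j * L v $ i" for i j
    proof -
      define u where "u = (w j \<bullet> v) *\<^sub>R w i - (w i \<bullet> v) *\<^sub>R w j"
      have "u \<bullet> v = 0" by (simp add: u_def inner_diff_left)
      then have "\<beta> u q = 0" using orth[OF v q] by blast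
      moreover have "\<beta> u q = (w j \<bullet> v) * a $ i - (w i \<bullet> v) * a $ j"
        unfolding u_def linear_diff[OF lin] linear_scale[OF lin] by (simp add: a sym[of "w _" "T a"] coef)
      ultimately show ?thesis by (simp add: L_def mult.commute)
    qed
    have "L v \<noteq> 0" using L0[of v] v by auto
    then obtain j where j: "L v $ j \<noteq> 0" by (auto simp: vec_eq_iff)
    define k where "k = a $ j / L v $ j"
    have ak: "a = k *\<^sub>R L v"
      using proportional[of _ j] j by (simp add: vec_eq_iff k_def field_simps)
    have qL: "q \<bullet> z = k * (L v \<bullet> L z)" for z by (simp add: a TL ak)
    have Lxy: "r *\<^sub>R L v = L x - L y"
      using linear_scale[OF linL, of r v] linear_diff[OF linL, of x y] rv by simp
    have "(L x - L y) \<bullet> (L x - L y) = 2 * ((L x - L y) \<bullet> L x)"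
      using eq[unfolded norm_eq]
      by (simp add: inner_diff_left inner_diff_right inner_commute[of "L y" "L x"])
    then have "r * (L v \<bullet> L v) = 2 * (L v \<bullet> L x)"
      unfolding Lxy[symmetric] using r by simp
    then have "q \<bullet> x = r / 2 * (q \<bullet> v)" unfolding qL by (simp add: algebra_simps)
    then have "q \<bullet> x = - r" using q(1) by simp
    then have "x + (q \<bullet> x) *\<^sub>R v = y" using rv by simp
    then show ?thesis using q(2)[OF xK] by simp
  qed
  have contL: "continuous_on K (\<lambda>x. norm (L x))"
    using linL by (intro continuous_intros linear_continuous_on) (simp add: linear_conv_bounded_linear)
  obtain z where z: "z \<in> K" "\<And>x. x \<in> K \<Longrightarrow> norm (L x) \<le> norm (L z)"
    using continuous_attains_sup[OF K'(1) _ contL] K'(5) by blast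
  define R where "R = norm (L z)"
  have R: "0 < R"
  proof -
    obtain e where e: "0 < e" "cball 0 e \<subseteq> K" by (rule solid_contains_cball[OF K])
    obtain b :: "real ^ 'n" where b: "norm b = e" using vector_choose_size[of e] e(1) by auto
    then have "0 < norm (L b)" using L0[of b] e(1) by auto
    then show ?thesis using z(2)[of b] b e(2) by (auto simp: R_def)
  qed
  have KL: "K = {x. norm (L x) \<le> R}"
  proof (intro set_eqI iffI)
    fix x assume "x \<in> {x. norm (L x) \<le> R}"
    then have x: "norm (L x) \<le> R" by simp
    show "x \<in> K"
    proof (cases "x = 0")
      case True then show ?thesis using K'(5) by simp
    next
      case False
      then have nx: "0 < norm (L x)" using L0 by auto
      define t where "t = norm (L x) / R"
      have t: "0 \<le> t" "t \<le> 1" "t \<noteq> 0" using x nx R by (auto simp: t_def)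
      have "norm (L ((1 / t) *\<^sub>R x)) = norm (L z)"
        using nx R by (simp add: linear_scale[OF linL] t_def R_def)
      then have "(1 / t) *\<^sub>R x \<in> K" using exchange[OF z(1)] by simp
      then have "t *\<^sub>R ((1 / t) *\<^sub>R x) + (1 - t) *\<^sub>R 0 \<in> K"
        using t K'(2,5) by (intro convexD) auto
      then show ?thesis using t by simp
    qed
  qed (use z in \<open>auto simp: R_def\<close>)
  obtain G where G: "linear G" "\<And>x. G (L x) = x" "\<And>x. L (G x) = x"
    using linear_injective_isomorphism[OF linL injL] by blast
  have linA: "linear (\<lambda>y. R *\<^sub>R G y)" "linear (\<lambda>x. (1 / R) *\<^sub>R L x)"
    using G(1) linL by (auto intro!: linear_compose_scale_right)
  define A where "A = matrix (\<lambda>y. R *\<^sub>R G y)"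
  have Av: "A *v y = R *\<^sub>R G y" for y unfolding A_def using matrix_works[of "\<lambda>y. R *\<^sub>R G y"] linA(1) by (simp add: linear_matrix_vector_mul_eq)
  have "invertible A"
    unfolding invertible_def
  proof (intro exI conjI)
    let ?A' = "matrix (\<lambda>x. (1 / R) *\<^sub>R L x)"
    have 1: "(\<lambda>y. R *\<^sub>R G y) \<circ> (\<lambda>x. (1 / R) *\<^sub>R L x) = id" "(\<lambda>x. (1 / R) *\<^sub>R L x) \<circ> (\<lambda>y. R *\<^sub>R G y) = id"
      using R by (auto simp: fun_eq_iff linear_scale[OF G(1)] linear_scale[OF linL] G(2,3))
    show "A ** ?A' = mat 1" "?A' ** A = mat 1"
      unfolding A_def matrix_compose[OF linA(2) linA(1), symmetric] matrix_compose[OF linA(1) linA(2), symmetric] 1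
      by (simp_all add: matrix_id_mat_1)
  qed
  moreover have "K = (\<lambda>x. A *v x) ` cball 0 1"
  proof (intro set_eqI iffI)
    fix x assume "x \<in> K"
    then have "norm ((1 / R) *\<^sub>R L x) \<le> 1" using KL R by simp
    moreover have "A *v ((1 / R) *\<^sub>R L x) = x" using R by (simp add: Av linear_scale[OF G(1)] G(2))
    ultimately show "x \<in> (\<lambda>x. A *v x) ` cball 0 1" by (metis image_eqI mem_cball_0)
  next
    fix x assume "x \<in> (\<lambda>x. A *v x) ` cball 0 1"
    then obtain y where y: "norm y \<le> 1" "x = R *\<^sub>R G y" by (auto simp: Av)
    have "norm (L x) = R * norm y" using R by (simp add: y(2) linear_scale[OF linL] G(3))
    also have "\<dots> \<le> R" using y(1) R by (simp add: mult_left_le)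
    finally show "x \<in> K" using KL by simp
  qed
  ultimately show ?thesis unfolding origin_ellipsoid_def by blast
qed

section \<open>Identification of the bodies\<close>

lemma solid_iff_convex_body_o: "solid K \<longleftrightarrow> convex_body_o K"
  using interior_subset unfolding solid_def convex_body_o_def convex_body_def by auto

lemma sublinear_body:
  fixes h :: "real ^ 'n \<Rightarrow> real"
  assumes "\<And>u w. h (u + w) \<le> h u + h w" "\<And>s u. 0 \<le> s \<Longrightarrow> h (s *\<^sub>R u) = s * h u" "\<And>u. 0 \<le> h u"
  shows "convex_body {y. \<forall>u. u \<bullet> y \<le> h u}" "support_fun {y. \<forall>u. u \<bullet> y \<le> h u} u = h u"
proof -
  note att = sublinear_attained[OF assms]
  show "convex_body {y. \<forall>u. u \<bullet> y \<le> h u}"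
    unfolding convex_body_def
    using sublinear_body_compact[OF assms] sublinear_body_convex[OF assms] att by auto
  obtain y where "\<forall>u. u \<bullet> y \<le> h u" "u \<bullet> y = h u" using att[of u] by blast
  then show "support_fun {y. \<forall>u. u \<bullet> y \<le> h u} u = h u"
    unfolding support_fun_def by (intro cSup_eq_maximum) (auto simp: image_iff intro!: exI[of _ y])
qed

context asym_exponent
begin

lemma centroid_body_support:
  fixes K :: "(real ^ 'n) set"
  assumes "solid K"
  shows "convex_body (centroid_body K)" "support_fun (centroid_body K) u = gauge_norm K u"
  unfolding centroid_body_def
  by (intro sublinear_body gauge_add[OF assms] gauge_scale gauge_nonneg; assumption)+

end

text \<open>Nonnegative support functions with the same \<open>p\<close>-th power on the sphere coincide, so that
  the definite descriptions denote the bodies constructed above.\<close>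

lemma convex_body_eq_if_support_powr_eq:
  assumes "0 < p" "convex_body M" "convex_body L"
    and "\<And>u. u \<in> sphere 0 1 \<Longrightarrow> 0 \<le> support_fun M u" "\<And>u. u \<in> sphere 0 1 \<Longrightarrow> 0 \<le> support_fun L u"
    and "\<And>u. u \<in> sphere 0 1 \<Longrightarrow> support_fun M u powr p = support_fun L u powr p"
  shows "M = L"
proof (rule convex_body_eq_if_support_eq[OF assms(2,3)])
  fix u :: "real ^ 'a" assume u: "u \<in> sphere 0 1"
  have "(support_fun M u powr p) powr (1 / p) = (support_fun L u powr p) powr (1 / p)"
    using assms(6)[OF u] by simp
  then show "support_fun M u = support_fun L u"
    using assms(1) assms(4,5)[OF u] by (simp add: powr_powr)
qed

lemma set_integral_lebesgue_eq_lborel: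
  fixes f :: "'a::euclidean_space \<Rightarrow> real"
  assumes [measurable]: "K \<in> sets borel" "f \<in> borel_measurable borel"
  shows "(LINT x:K|lebesgue. f x) = (LINT x:K|lborel. f x)"
  unfolding set_lebesgue_integral_def by (rule integral_completion) measurable

lemma c_np_pos: "0 < p \<Longrightarrow> 0 < n \<Longrightarrow> 0 < c_np n p"
  unfolding c_np_def by (intro divide_pos_pos mult_pos_pos Gamma_real_pos) auto

lemma moment_body_plus_eq:
  fixes K :: "(real ^ 'n) set"
  assumes p: "1 < p" and K: "solid K"
  defines "C \<equiv> c_np CARD('n) p * (real CARD('n) + p)"
  shows "convex_body (moment_body_plus p K)" "0 \<le> support_fun (moment_body_plus p K) u"
    "support_fun (moment_body_plus p K) u powr p = C * (LINT x:K|lborel. max 0 (u \<bullet> x) powr p)"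
proof -
  have C: "0 < C" unfolding C_def using p c_np_pos[of p "CARD('n)"] by (intro mult_pos_pos) auto
  interpret E: asym_exponent p C 0 by unfold_locales (use p C in auto)
  have [measurable]: "K \<in> sets borel" by (rule solidD(4)[OF K])
  have mom: "E.moment K u = C * (LINT x:K|lborel. max 0 (u \<bullet> x) powr p)" for u
    unfolding E.moment_def asym_pow_def by simp
  have leb: "(LINT x:K|lebesgue. max 0 (u \<bullet> x) powr p) = (LINT x:K|lborel. max 0 (u \<bullet> x) powr p)" for u
    by (rule set_integral_lebesgue_eq_lborel) measurable
  note S = E.centroid_body_support[OF K]
  have "moment_body_plus p K = E.centroid_body K"
    unfolding moment_body_plus_def
  proof (rule the_equality)
    show "convex_body (E.centroid_body K) \<and> (\<forall>u\<in>sphere 0 1. 0 \<le> support_fun (E.centroid_body K) u \<and>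
        support_fun (E.centroid_body K) u powr p = c_np CARD('n) p * (real CARD('n) + p) *
          (LINT x:K|lebesgue. max 0 (u \<bullet> x) powr p))"
      unfolding S(2) leb E.gauge_powr mom C_def[symmetric] using S(1) by simp
    fix M assume M: "convex_body M \<and> (\<forall>u\<in>sphere 0 1. 0 \<le> support_fun M u \<and>
        support_fun M u powr p = c_np CARD('n) p * (real CARD('n) + p) *
          (LINT x:K|lebesgue. max 0 (u \<bullet> x) powr p))"
    show "M = E.centroid_body K"
    proof (rule convex_body_eq_if_support_powr_eq[of p])
      fix u :: "real ^ 'n" assume "u \<in> sphere 0 1"
      then show "support_fun M u powr p = support_fun (E.centroid_body K) u powr p"
        using M unfolding S(2) E.gauge_powr mom leb C_def[symmetric] by blast
    qed (use M S p in auto)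
  qed
  then show "convex_body (moment_body_plus p K)" "0 \<le> support_fun (moment_body_plus p K) u"
    "support_fun (moment_body_plus p K) u powr p = C * (LINT x:K|lborel. max 0 (u \<bullet> x) powr p)"
    using S by (simp_all add: E.gauge_powr mom)
qed

lemma set_integral_uminus_image:
  fixes f :: "'a::euclidean_space \<Rightarrow> real"
  assumes [measurable]: "K \<in> sets borel" "f \<in> borel_measurable borel"
  shows "(LINT x:uminus ` K|lborel. f x) = (LINT x:K|lborel. f (- x))"
proof -
  have dist: "distr lborel borel (\<lambda>x. - x) = (lborel :: 'a measure)"
    using lborel_affine[of "- 1" "0::'a"] by (simp add: density_1)
  have ind: "indicator (uminus ` K) (- x) = (indicator K x :: real)" for x
    by (auto simp: indicator_def)
  have K': "uminus ` K = (\<lambda>x. - x) -` K \<inter> space borel" by (force simp: image_iff)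
  have [measurable]: "uminus ` K \<in> sets borel" unfolding K' by measurable
  have "(LINT x|lborel. indicator (uminus ` K) x *\<^sub>R f x)
      = (LINT x|distr lborel borel (\<lambda>x. - x). indicator (uminus ` K) x *\<^sub>R f x)" by (simp only: dist)
  also have "\<dots> = (LINT x|lborel. indicator (uminus ` K) (- x) *\<^sub>R f (- x))"
    by (rule integral_distr) measurable
  finally show ?thesis by (simp add: set_lebesgue_integral_def ind)
qed

lemma Psi_eq_centroid_body:
  fixes K :: "(real ^ 'n) set"
  assumes p: "1 < p" and K: "solid K" and c: "0 \<le> c1" "0 \<le> c2" "0 < c1 + c2"
  defines "C \<equiv> c_np CARD('n) p * (real CARD('n) + p)"
  shows "Psi p c1 c2 K = asym_exponent.centroid_body p (C * c1) (C * c2) K"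
proof -
  have C: "0 < C" unfolding C_def using p c_np_pos[of p "CARD('n)"] by (intro mult_pos_pos) auto
  interpret E: asym_exponent p "C * c1" "C * c2"
    by unfold_locales (use p C c in \<open>auto simp flip: distrib_left\<close>)
  note S = E.centroid_body_support[OF K]
  have K': "solid (uminus ` K)"
    by (rule solid_linear_image[OF _ _ K]) (auto intro: linearI o_bij[of uminus])
  have int: "set_integrable lborel K (\<lambda>x. max 0 (w \<bullet> x) powr p)" for w
    unfolding set_integrable_def using solidD(1)[OF K] p
    by (intro borel_integrable_compact continuous_intros continuous_on_powr') auto
  have mom: "E.moment K u = c1 * support_fun (moment_body_plus p K) u powr p
      + c2 * support_fun (moment_body_minus p K) u powr p" for u
  proof -
    have "(LINT x:uminus ` K|lborel. max 0 (u \<bullet> x) powr p) = (LINT x:K|lborel. max 0 (- (u \<bullet> x)) powr p)"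
      using set_integral_uminus_image[OF solidD(4)[OF K], of "\<lambda>x. max 0 (u \<bullet> x) powr p"] by simp
    moreover have "E.moment K u = C * c1 * (LINT x:K|lborel. max 0 (u \<bullet> x) powr p)
        + C * c2 * (LINT x:K|lborel. max 0 (- (u \<bullet> x)) powr p)"
    proof -
      have "E.moment K u = (LINT x:K|lborel. C * c1 * max 0 (u \<bullet> x) powr p)
          + (LINT x:K|lborel. C * c2 * max 0 (- (u \<bullet> x)) powr p)"
        unfolding E.moment_def asym_pow_def
        using int[of u] int[of "- u"] by (intro set_integral_add(2) set_integrable_mult_right) auto
      then show ?thesis by simp
    qed
    ultimately show ?thesis
      unfolding moment_body_minus_def moment_body_plus_eq(3)[OF p K] moment_body_plus_eq(3)[OF p K'] C_def[symmetric]
      by simp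
  qed
  show ?thesis
    unfolding Psi_def Lp_comb_def
  proof (rule the_equality)
    show "convex_body (E.centroid_body K) \<and> (\<forall>u. 0 \<le> support_fun (E.centroid_body K) u \<and>
        support_fun (E.centroid_body K) u powr p = c1 * support_fun (moment_body_plus p K) u powr p
          + c2 * support_fun (moment_body_minus p K) u powr p)"
      using S by (simp add: E.gauge_powr mom)
    fix M assume M: "convex_body M \<and> (\<forall>u. 0 \<le> support_fun M u \<and>
        support_fun M u powr p = c1 * support_fun (moment_body_plus p K) u powr p
          + c2 * support_fun (moment_body_minus p K) u powr p)"
    show "M = E.centroid_body K"
      by (rule convex_body_eq_if_support_powr_eq[of p]) (use M S p in \<open>auto simp: E.gauge_powr mom\<close>)
  qed
qed

section \<open>The affine isoperimetric inequality\<close>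

context asym_exponent
begin

text \<open>The functional of the isoperimetric inequality; the exponent makes it invariant under dilations.\<close>

definition volume_ratio :: "'a::euclidean_space set \<Rightarrow> real" where
  "volume_ratio K = measure lborel K powr (- real DIM('a) / p - 1) * measure lborel (centroid_body K)"

lemma solid_unit_ball: "solid (cball (0::'a::euclidean_space) 1)"
  by (rule solidI_cball[of _ 1]) auto

lemma volume_ratio_linear_image:
  fixes A :: "'a::euclidean_space \<Rightarrow> 'a"
  assumes A: "linear A" "bij A" and K: "solid K"
  shows "volume_ratio (A ` K) = volume_ratio K"
proof -
  obtain J where J: "0 < J" "measure lborel (A ` K) = J * measure lborel K"
    "measure lborel (centroid_body (A ` K)) = J powr (real DIM('a) / p + 1) * measure lborel (centroid_body K)"
    by (rule measure_centroid_body_linear_image[OF A]) (use K in blast)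
  have "J powr (- real DIM('a) / p - 1) * J powr (real DIM('a) / p + 1) = 1"
    using J(1) by (simp flip: powr_add)
  then show ?thesis
    unfolding volume_ratio_def J(2,3)
    using J(1) measure_solid_pos[OF K] by (simp add: powr_mult mult_ac)
qed

lemma volume_ratio_ball:
  assumes "0 < r" shows "volume_ratio (cball (0::'a::euclidean_space) r) = volume_ratio (cball (0::'a) 1)"
proof -
  have "(*\<^sub>R) r ` cball (0::'a) 1 = cball 0 r"
    using assms cball_scale[of r "0::'a" 1] by simp
  moreover have "bij ((*\<^sub>R) r :: 'a \<Rightarrow> 'a)"
    using assms by (intro o_bij[of "(*\<^sub>R) (1 / r)"]) (auto simp: o_def)
  ultimately show ?thesis
    using volume_ratio_linear_image[OF linear_scaleR _ solid_unit_ball, of r] by metis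
qed

lemma ball_of_same_volume:
  assumes K: "solid (K :: 'a::euclidean_space set)"
  obtains r where "0 < r" "measure lborel K = measure lborel (cball (0::'a) r)"
proof -
  define q where "q = measure lborel K / measure lborel (cball (0::'a) 1)"
  have q: "0 < q" using measure_solid_pos[OF K] measure_solid_pos[OF solid_unit_ball] by (auto simp: q_def)
  define r where "r = root DIM('a) q"
  have r: "0 < r" "r ^ DIM('a) = q" using q by (auto simp: r_def real_root_gt_zero)
  have "measure lborel (cball (0::'a) r) = q * measure lborel (cball (0::'a) 1)"
    using content_ball_conv_unit_ball[of r "0::'a"] r by (simp add: content_cball_conv_ball)
  then have "measure lborel K = measure lborel (cball (0::'a) r)"
    using measure_solid_pos[OF solid_unit_ball, where 'a='a] by (simp add: q_def)
  then show ?thesis using that r(1) by blast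
qed

theorem volume_ratio_ge:
  fixes K :: "'a::euclidean_space set"
  assumes K: "solid K"
  shows "volume_ratio (cball (0::'a) 1) \<le> volume_ratio K"
proof -
  obtain r where r: "0 < r" "measure lborel K = measure lborel (cball (0::'a) r)"
    by (rule ball_of_same_volume[OF K])
  have "volume_ratio (cball (0::'a) r) \<le> volume_ratio K"
    unfolding volume_ratio_def r(2)
    using measure_centroid_body_ball_le[OF K r] by (intro mult_left_mono) auto
  then show ?thesis by (simp add: volume_ratio_ball[OF r(1)])
qed

text \<open>Every symmetral of a minimizer is a minimizer of the same volume, so no
  symmetrization reduces the volume of its centroid body.\<close>

theorem volume_ratio_eqD:
  fixes K :: "(real ^ 'n) set"
  assumes K: "solid K" and n: "2 \<le> CARD('n)"
    and eq: "volume_ratio K = volume_ratio (cball (0 :: real ^ 'n) 1)"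
  shows "origin_ellipsoid K"
proof (rule ellipsoid_of_affine_reflections[OF K])
  fix v :: "real ^ 'n" assume v: "norm v = 1"
  have S: "solid (steiner v K)" by (rule solid_steiner[OF K v])
  have vol: "measure lborel (steiner v K) = measure lborel K"
    using emeasure_steiner[OF solidD(1,2)[OF K] v] by (simp add: measure_def)
  have "volume_ratio K \<le> volume_ratio (steiner v K)" using volume_ratio_ge[OF S] eq by simp
  then have "measure lborel (centroid_body K) \<le> measure lborel (centroid_body (steiner v K))"
    using measure_solid_pos[OF K] by (simp add: volume_ratio_def vol mult_le_cancel_left)
  then have "measure lborel (centroid_body (steiner v K)) = measure lborel (centroid_body K)"
    using measure_centroid_body_steiner[OF K v] by simp
  then show "\<exists>q. q \<bullet> v = - 2 \<and> (\<forall>x\<in>K. x + (q \<bullet> x) *\<^sub>R v \<in> K)"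
    using affine_reflection_of_equality[OF K v] n by (metis DIM_cart DIM_real mult.right_neutral)
qed

lemma volume_ratio_ellipsoid:
  fixes K :: "(real ^ 'n) set"
  assumes "origin_ellipsoid K"
  shows "volume_ratio K = volume_ratio (cball (0 :: real ^ 'n) 1)"
proof -
  obtain A :: "real ^ 'n ^ 'n" where A: "invertible A" "K = (\<lambda>x. A *v x) ` cball 0 1"
    using assms unfolding origin_ellipsoid_def by blast
  have "bij ((*v) A)" using A(1) by (simp add: invertible_eq_bij)
  then show ?thesis
    unfolding A(2) by (intro volume_ratio_linear_image solid_unit_ball matrix_vector_mul_linear)
qed

end

theorem theorem2:
  fixes K :: "(real ^ 'n) set" and p c1 c2 :: real
  assumes "CARD('n) \<ge> 3" and "1 < p" and "convex_body_o K"
    and "0 \<le> c1" and "0 \<le> c2" and "\<not> (c1 = 0 \<and> c2 = 0)"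
  shows "vol K powr (- real CARD('n) / p - 1) * vol (Psi p c1 c2 K)
           \<ge> vol (cball 0 1 :: (real ^ 'n) set) powr (- real CARD('n) / p - 1)
               * vol (Psi p c1 c2 (cball 0 1 :: (real ^ 'n) set))
    \<and> (vol K powr (- real CARD('n) / p - 1) * vol (Psi p c1 c2 K)
           = vol (cball 0 1 :: (real ^ 'n) set) powr (- real CARD('n) / p - 1)
               * vol (Psi p c1 c2 (cball 0 1 :: (real ^ 'n) set))
         \<longleftrightarrow> origin_ellipsoid K)"
proof -
  define C where "C = c_np CARD('n) p * (real CARD('n) + p)"
  have C: "0 < C" unfolding C_def using assms(2) c_np_pos[of p "CARD('n)"] by (intro mult_pos_pos) auto
  have c: "0 < c1 + c2" using assms(4-6) by linarith
  interpret E: asym_exponent p "C * c1" "C * c2"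
    by unfold_locales (use assms C c in \<open>auto simp flip: distrib_left\<close>)
  have ratio: "vol Q powr (- real CARD('n) / p - 1) * vol (Psi p c1 c2 Q) = E.volume_ratio Q"
    if Q: "solid Q" for Q :: "(real ^ 'n) set"
  proof -
    have "vol Q = measure lborel Q" using solidD(4)[OF Q] by simp
    moreover have "vol (Psi p c1 c2 Q) = measure lborel (E.centroid_body Q)"
      using Psi_eq_centroid_body[OF assms(2) Q assms(4,5) c] solidD(4)[OF E.solid_centroid_body[OF Q]]
      by (simp add: C_def)
    ultimately show ?thesis by (simp add: E.volume_ratio_def)
  qed
  have K: "solid K" using assms(3) by (simp add: solid_iff_convex_body_o)
  show ?thesis
    unfolding ratio[OF K] ratio[OF E.solid_unit_ball]
    using E.volume_ratio_ge[OF K] E.volume_ratio_eqD[OF K] E.volume_ratio_ellipsoid[of K] assms(1)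
    by auto
qed

end
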